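(* Let $A\in\mathbb{Z}^{m\times(n+d)}$ have full row rank, i.e. $\operatorname{rank}(A)=m$, and let $\boldsymbol b\in\mathbb{Z}^m$, $\boldsymbol c\in\mathbb{Z}^{n+d}$. Assume that the mixed-integer optimization problem $$\max\left\{\boldsymbol c^T\boldsymbol x : A\boldsymbol x=\boldsymbol b,\ \boldsymbol x\ge\boldsymbol 0,\ \boldsymbol x\in\mathbb{Z}^n\times\mathbb{R}^d\right\}$$ is feasible. Then there exists an optimal solution $\boldsymbol z^*$ for this problem such that $$|\operatorname{supp}(\boldsymbol z^* )|\le 2m+\log\left(g^{-1}\sqrt{\det(AA^T)}\right)\le m+2m\log\left(2\sqrt{m}\,\|A\|_\infty\right),$$ where $g$ denotes the greatest common divisor of all $m\times m$ minors of $A$.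
   Context: For a real vector $\boldsymbol x$, $\operatorname{supp}(\boldsymbol x):=\{i: x_i\ne 0\}$ is the set of indices of its nonzero components. $\log$ is the logarithm with base two. $\|A\|_\infty$ denotes the maximum absolute value of an entry of the matrix $A$ (not an operator norm).
   Formalization: The objective is also assumed bounded above on the feasible set (else no optimal solution exists), and the inequality between the two bounds, false e.g. for A=(1,1,1,1,1), is replaced by: the same optimal z* satisfies both upper bounds on |supp(z* )|. *)

theory Defs
  imports
    Complex_Main
    "Jordan_Normal_Form.DL_Rank"
    "Jordan_Normal_Form.DL_Submatrix"
begin

definition supp_vec :: "'a::zero vec \<Rightarrow> nat set" where
  "supp_vec x = {i. i < dim_vec x \<and> x $ i \<noteq> 0}"

(* 0 is inserted only so that the maximum is also meaningful for a matrix without entries. *)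
definition max_abs_entry :: "int mat \<Rightarrow> int" where
  "max_abs_entry A = Max (insert 0 (abs ` elements_mat A))"

definition gcd_max_minors :: "int mat \<Rightarrow> int" where
  "gcd_max_minors A =
     Gcd {det (submatrix A UNIV J) | J. J \<subseteq> {..<dim_col A} \<and> card J = dim_row A}"

definition mip_feasible :: "nat \<Rightarrow> nat \<Rightarrow> int mat \<Rightarrow> int vec \<Rightarrow> real vec set" where
  "mip_feasible n d A b =
     {x \<in> carrier_vec (n + d).
        map_mat real_of_int A *\<^sub>v x = map_vec real_of_int b \<and>
        0\<^sub>v (n + d) \<le> x \<and>
        (\<forall>i<n. x $ i \<in> \<int>)}"

definition mip_objective :: "int vec \<Rightarrow> real vec \<Rightarrow> real" where
  "mip_objective c x = map_vec real_of_int c \<bullet> x"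

definition mip_optimal :: "nat \<Rightarrow> nat \<Rightarrow> int mat \<Rightarrow> int vec \<Rightarrow> int vec \<Rightarrow> real vec \<Rightarrow> bool" where
  "mip_optimal n d A b c z \<longleftrightarrow>
     z \<in> mip_feasible n d A b \<and>
     (\<forall>x \<in> mip_feasible n d A b. mip_objective c x \<le> mip_objective c z)"

end

theory Submission
  imports "HOL-Probability.Distributions" Defs
begin

text \<open>Let \<open>z\<close> be an optimal solution of minimal support. The columns of the continuous support are
linearly independent, so there are at most \<open>m\<close> of them. On the integer support \<open>S\<close> no nonzero
\<open>y \<in> {-1, 0, 1}\<^sup>S\<close> satisfies \<open>A y = 0\<close>: both \<open>z + y\<close> and \<open>z - y\<close> would be feasible, hence \<open>c y = 0\<close>, and
moving along \<open>y\<close> until a coordinate vanishes would shrink the support. An optimum exists because the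
objective value of a solution with independent continuous columns lies in \<open>(1/K) \<int>\<close> for a \<open>K\<close> that
depends on \<open>A\<close> only.

It remains to show \<open>2\<^bsup>|S|\<^esup> g \<le> 2\<^sup>m sqrt (det (A A\<^sup>T))\<close>. Dividing \<open>A\<close> by a basis of the lattice
generated by its columns reduces this to \<open>g = 1\<close>. Let \<open>a\<^sub>j\<close> be the columns. Expanding
\<open>\<Prod>j\<in>S. cos\<^sup>2(\<pi> a\<^sub>j \<cdot> x)\<close> into cosines shows that its integral over the unit cube is \<open>2\<^bsup>-|S|\<^esup>\<close>. The set
\<open>{x. \<forall>j. |a\<^sub>j \<cdot> x| < 1/2}\<close>, taken over all columns, meets every coset of \<open>\<int>\<^sup>m\<close> at most once, so
this integral is at least the integral over \<open>\<real>\<^sup>m\<close> of the product over all columns of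
\<open>f (a\<^sub>j \<cdot> x)\<close>, where \<open>f\<close> is \<open>cos\<^sup>2(\<pi> t)\<close> cut off at \<open>|t| = 1/2\<close>. As in Vaaler's cube
slicing theorem, \<open>f\<close> is more peaked than the Gaussian \<open>exp (-4 \<pi> t\<^sup>2)\<close> of the same mass, and marginals of
even log-concave functions are even and decreasing, so replacing the factors \<open>f\<close> by Gaussians one at a
time only decreases the integral. The Gaussian integral is \<open>1 / (2\<^sup>m sqrt (det (A A\<^sup>T)))\<close>.

For the second bound the same inequality is applied to the submatrix formed by \<open>S\<close> and \<open>m\<close>
independent columns, whose Gram determinant is estimated by Hadamard's inequality.\<close>

section \<open>The one-dimensional Prekopa-Leindler inequality\<close>

text \<open>The squared cosine is chosen because it serves two purposes at once. As a trigonometric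
  polynomial of frequencies -1, 0 and 1 it makes the torus integral see exactly the sign vectors
  that optimality excludes; cut down to a single arch it is log-concave, so convex geometry applies.
  Folding the arches modulo \<int>^m connects the two readings. The exponent 4 \<pi> gives each
  Gaussian the mass 1/2, and this 1/2, once per dimension, is the origin of the factor 2^m. The
  second bound is not read off the first: det(A A^T) grows with every column of A, even with those
  that the solution does not use. Restricting to |S| + m columns gives an inequality with |S| on
  both sides, which is then solved for |S|.\<close>

lemma emeasure_lborel_le_diameter:
  fixes A :: "real set"
  assumes "bounded A"
  shows "emeasure lborel A \<le> ennreal (Sup A - Inf A)"
proof (cases "A = {}")
  case False
  have "A \<subseteq> {Inf A..Sup A}"
    using assms by (auto intro!: cInf_lower cSup_upper bounded_imp_bdd_below bounded_imp_bdd_above)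
  then have "emeasure lborel A \<le> emeasure lborel {Inf A..Sup A}"
    by (intro emeasure_mono) auto
  moreover have "Inf A \<le> Sup A"
    using False assms by (intro cInf_le_cSup bounded_imp_bdd_below bounded_imp_bdd_above) auto
  ultimately show ?thesis by simp
qed simp

text \<open>Convex subsets of the line are intervals up to their end points, so it suffices to
  approximate the ends from inside. This case is enough because superlevel sets of log-concave
  functions are convex.\<close>

lemma brunn_minkowski_interval:
  fixes A B C :: "real set" and l :: real
  assumes "convex A" "convex B" "A \<noteq> {}" "B \<noteq> {}" "bounded A" "bounded B"
    and C: "C \<in> sets lborel" and l: "0 < l" "l < 1"
    and ABC: "\<And>x y. x \<in> A \<Longrightarrow> y \<in> B \<Longrightarrow> (1 - l) * x + l * y \<in> C"
  shows "ennreal (1 - l) * emeasure lborel A + ennreal l * emeasure lborel B \<le> emeasure lborel C"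
proof -
  have seg: "ennreal ((1 - l) * (a2 - a1) + l * (b2 - b1)) \<le> emeasure lborel C"
    if a: "a1 \<in> A" "a2 \<in> A" "a1 \<le> a2" and b: "b1 \<in> B" "b2 \<in> B" "b1 \<le> b2" for a1 a2 b1 b2
  proof -
    define lo where "lo = (1 - l) * a1 + l * b1"
    define hi where "hi = (1 - l) * a2 + l * b2"
    have lohi: "lo \<le> hi" unfolding lo_def hi_def using a b l
      by (intro add_mono mult_left_mono) auto
    have "{lo..hi} \<subseteq> C"
    proof
      fix x assume x: "x \<in> {lo..hi}"
      \<comment> \<open>The same parameter \<open>s\<close> is used in both segments, so
        \<open>x\<close> becomes the combination of one point of \<open>A\<close> and one of
        \<open>B\<close>.\<close>
      obtain s where s: "0 \<le> s" "s \<le> 1" "x = (1 - s) * lo + s * hi"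
      proof (cases "lo = hi")
        case True then show ?thesis using x that[of 0] by auto
      next
        case False
        then have "lo < hi" using lohi by simp
        then have "x = (1 - (x - lo) / (hi - lo)) * lo + ((x - lo) / (hi - lo)) * hi"
          by (simp add: divide_simps) (simp add: algebra_simps)
        then show ?thesis using x \<open>lo < hi\<close> by (intro that[of "(x - lo) / (hi - lo)"]) auto
      qed
      have "(1 - s) * a1 + s * a2 \<in> A"
        using convexD[OF assms(1) a(1,2), of "1 - s" s] s by simp
      moreover have "(1 - s) * b1 + s * b2 \<in> B"
        using convexD[OF assms(2) b(1,2), of "1 - s" s] s by simp
      ultimately have "(1 - l) * ((1 - s) * a1 + s * a2) + l * ((1 - s) * b1 + s * b2) \<in> C"
        by (rule ABC)
      then show "x \<in> C" unfolding s(3) lo_def hi_def by (simp add: algebra_simps)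
    qed
    then have "emeasure lborel {lo..hi} \<le> emeasure lborel C"
      by (intro emeasure_mono C)
    then show ?thesis using lohi unfolding lo_def hi_def by (simp add: algebra_simps)
  qed
  have bdd: "bdd_below A" "bdd_above A" "bdd_below B" "bdd_above B"
    using assms bounded_imp_bdd_below bounded_imp_bdd_above by auto
  have ord: "Inf A \<le> Sup A" "Inf B \<le> Sup B"
    using assms bdd by (auto intro!: cInf_le_cSup)
  have "ennreal ((1 - l) * (Sup A - Inf A) + l * (Sup B - Inf B)) \<le> emeasure lborel C"
  proof (rule ennreal_le_epsilon)
    fix e :: real assume e: "0 < e"
    obtain a1 where a1: "a1 \<in> A" "a1 < Inf A + e / 2"
      using cInf_lessD[of A "Inf A + e / 2"] assms e by auto
    obtain b1 where b1: "b1 \<in> B" "b1 < Inf B + e / 2"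
      using cInf_lessD[of B "Inf B + e / 2"] assms e by auto
    obtain a2' where a2': "a2' \<in> A" "Sup A - e / 2 < a2'"
      using less_cSupD[of A "Sup A - e / 2"] assms e by auto
    obtain b2' where b2': "b2' \<in> B" "Sup B - e / 2 < b2'"
      using less_cSupD[of B "Sup B - e / 2"] assms e by auto
    \<comment> \<open>The maximum only enforces the order of the end points; both candidates lie in
      the set.\<close>
    define a2 b2 where "a2 = max a1 a2'" and "b2 = max b1 b2'"
    have *: "a2 \<in> A" "b2 \<in> B" "a1 \<le> a2" "b1 \<le> b2" "Sup A - e / 2 < a2" "Sup B - e / 2 < b2"
      using a1 a2' b1 b2' by (auto simp: a2_def b2_def max_def)
    have "(1 - l) * (Sup A - Inf A) + l * (Sup B - Inf B) \<le> (1 - l) * (a2 - a1 + e) + l * (b2 - b1 + e)"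
      using * a1 b1 l by (intro add_mono mult_left_mono) auto
    also have "\<dots> = ((1 - l) * (a2 - a1) + l * (b2 - b1)) + e" by (simp add: algebra_simps)
    finally have "ennreal ((1 - l) * (Sup A - Inf A) + l * (Sup B - Inf B))
        \<le> ennreal (((1 - l) * (a2 - a1) + l * (b2 - b1)) + e)" by (rule ennreal_leI)
    also have "\<dots> = ennreal ((1 - l) * (a2 - a1) + l * (b2 - b1)) + ennreal e"
      using * e l by (intro ennreal_plus) auto
    also have "\<dots> \<le> emeasure lborel C + ennreal e"
      by (intro add_right_mono seg a1 b1 *)
    finally show "ennreal ((1 - l) * (Sup A - Inf A) + l * (Sup B - Inf B)) \<le> emeasure lborel C + ennreal e" .
  qed
  moreover have "ennreal (1 - l) * emeasure lborel A + ennreal l * emeasure lborel B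
      \<le> ennreal (1 - l) * ennreal (Sup A - Inf A) + ennreal l * ennreal (Sup B - Inf B)"
    by (intro add_mono mult_left_mono emeasure_lborel_le_diameter assms) auto
  moreover have "\<dots> = ennreal ((1 - l) * (Sup A - Inf A) + l * (Sup B - Inf B))"
    using l ord by (simp add: ennreal_mult ennreal_plus)
  ultimately show ?thesis by (metis order.trans)
qed

lemma nn_integral_layer_cake:
  fixes f :: "real \<Rightarrow> real"
  assumes [measurable]: "f \<in> borel_measurable borel" and "\<And>x. 0 \<le> f x"
  shows "(\<integral>\<^sup>+x. ennreal (f x) \<partial>lborel) = (\<integral>\<^sup>+t. indicator {0..} t * emeasure lborel {x. t < f x} \<partial>lborel)"
proof -
  have "(\<integral>\<^sup>+x. ennreal (f x) \<partial>lborel) = (\<integral>\<^sup>+x. (\<integral>\<^sup>+t. indicator {0..<f x} t \<partial>lborel) \<partial>lborel)"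
    using assms(2) by (intro nn_integral_cong) simp
  also have "\<dots> = (\<integral>\<^sup>+x. (\<integral>\<^sup>+t. indicator {0..} t * indicator {x. t < f x} x \<partial>lborel) \<partial>lborel)"
    by (intro nn_integral_cong) (auto simp: indicator_def)
  also have "\<dots> = (\<integral>\<^sup>+t. (\<integral>\<^sup>+x. indicator {0..} t * indicator {x. t < f x} x \<partial>lborel) \<partial>lborel)"
    by (rule lborel_pair.Fubini') simp
  also have "\<dots> = (\<integral>\<^sup>+t. indicator {0..} t * emeasure lborel {x. t < f x} \<partial>lborel)"
    by (intro nn_integral_cong) (simp add: nn_integral_cmult)
  finally show ?thesis .
qed

text \<open>After division by their suprema \<open>a\<close> and \<open>b\<close>, \<open>f\<close>
  and \<open>g\<close> have nonempty superlevel sets for the same levels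
  \<open>0 \<le> t < 1\<close>, so the interval inequality applies at each of them. Integrating over
  \<open>t\<close> gives an arithmetic mean of the normalised integrals, which dominates the
  geometric mean. The common bound and the bounded supports keep the suprema finite and the level
  sets bounded.\<close>

lemma prekopa_leindler_1d:
  fixes f g h :: "real \<Rightarrow> real" and l :: real
  assumes [measurable]: "f \<in> borel_measurable borel" "g \<in> borel_measurable borel" "h \<in> borel_measurable borel"
    and nonneg: "\<And>x. 0 \<le> f x" "\<And>x. 0 \<le> g x" "\<And>x. 0 \<le> h x"
    and bnd: "\<And>x. f x \<le> b0" "\<And>x. g x \<le> b0"
    and supp: "\<And>x. f x \<noteq> 0 \<Longrightarrow> \<bar>x\<bar> \<le> r0" "\<And>x. g x \<noteq> 0 \<Longrightarrow> \<bar>x\<bar> \<le> r0"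
    and cvx: "\<And>t. 0 \<le> t \<Longrightarrow> convex {x. t < f x}" "\<And>t. 0 \<le> t \<Longrightarrow> convex {x. t < g x}"
    and l: "0 < l" "l < 1"
    and fgh: "\<And>x y. f x powr (1 - l) * g y powr l \<le> h ((1 - l) * x + l * y)"
    and F: "(\<integral>\<^sup>+x. ennreal (f x) \<partial>lborel) = ennreal F" "0 \<le> F"
    and G: "(\<integral>\<^sup>+x. ennreal (g x) \<partial>lborel) = ennreal G" "0 \<le> G"
  shows "ennreal (F powr (1 - l) * G powr l) \<le> (\<integral>\<^sup>+x. ennreal (h x) \<partial>lborel)"
proof (cases "F = 0 \<or> G = 0")
  case True
  then show ?thesis by auto
next
  case False
  then have FG: "0 < F" "0 < G" using F G by auto
  define a where "a = Sup (range f)"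
  define b where "b = Sup (range g)"
  have bdd: "bdd_above (range f)" "bdd_above (range g)" using bnd by (auto intro!: bdd_aboveI)
  have fa: "f x \<le> a" "g x \<le> b" for x unfolding a_def b_def by (auto intro!: cSup_upper bdd)
  have "\<exists>x. f x \<noteq> 0"
  proof (rule ccontr)
    assume "\<not> ?thesis" then have "(\<integral>\<^sup>+x. ennreal (f x) \<partial>lborel) = 0" by simp
    then show False using F FG by simp
  qed
  then obtain x0 where "f x0 \<noteq> 0" ..
  then have a: "0 < a" using fa(1)[of x0] nonneg(1)[of x0] by linarith
  have "\<exists>x. g x \<noteq> 0"
  proof (rule ccontr)
    assume "\<not> ?thesis" then have "(\<integral>\<^sup>+x. ennreal (g x) \<partial>lborel) = 0" by simp
    then show False using G FG by simp
  qed
  then obtain y0 where "g y0 \<noteq> 0" ..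
  then have b: "0 < b" using fa(2)[of y0] nonneg(2)[of y0] by linarith
  \<comment> \<open>The matching normalisation of \<open>h\<close>: it satisfies
    \<open>(t * a) powr (1 - l) * (t * b) powr l = t * c\<close>.\<close>
  define c where "c = a powr (1 - l) * b powr l"
  have c: "0 < c" unfolding c_def using a b by simp
  have lev: "ennreal (1 - l) * emeasure lborel {x. t < f x / a} + ennreal l * emeasure lborel {x. t < g x / b}
      \<le> emeasure lborel {x. t < h x / c}" if t: "0 \<le> t" "t < 1" for t
  proof -
    have A: "{x. t < f x / a} = {x. t * a < f x}" and B: "{x. t < g x / b} = {x. t * b < g x}"
      using a b by (auto simp: field_simps)
    have ta: "0 \<le> t * a" "0 \<le> t * b" using t a b by auto
    show ?thesis
    proof (rule brunn_minkowski_interval)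
      show "convex {x. t < f x / a}" "convex {x. t < g x / b}" unfolding A B using ta cvx by auto
      have "t * a < a" "t * b < b" using t a b by auto
      then obtain x y where "t * a < f x" "t * b < g y"
        using less_cSupD[of "range f" "t * a"] less_cSupD[of "range g" "t * b"] unfolding a_def b_def by auto
      then show "{x. t < f x / a} \<noteq> {}" "{x. t < g x / b} \<noteq> {}" unfolding A B by auto
      have "x \<in> {-r0..r0}" if "t * a < f x" for x using supp(1)[of x] that ta by (auto simp: abs_le_iff)
      moreover have "x \<in> {-r0..r0}" if "t * b < g x" for x using supp(2)[of x] that ta by (auto simp: abs_le_iff)
      ultimately have sub: "{x. t * a < f x} \<subseteq> {-r0..r0}" "{x. t * b < g x} \<subseteq> {-r0..r0}" by blast+
      show "bounded {x. t < f x / a}" unfolding A by (rule bounded_subset[OF bounded_closed_interval sub(1)])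
      show "bounded {x. t < g x / b}" unfolding B by (rule bounded_subset[OF bounded_closed_interval sub(2)])
      show "{x. t < h x / c} \<in> sets lborel" by measurable
      show "0 < l" "l < 1" by fact+
      fix x y assume xy: "x \<in> {x. t < f x / a}" "y \<in> {x. t < g x / b}"
      then have xy': "t * a < f x" "t * b < g y" unfolding A B by auto
      have "t * c = (t * a) powr (1 - l) * (t * b) powr l"
      proof (cases "t = 0")
        case False
        then have "t powr (1 - l) * t powr l = t" using t by (simp flip: powr_add)
        then show ?thesis using t a b by (simp add: c_def powr_mult mult_ac)
      qed (use l in simp)
      also have "\<dots> < f x powr (1 - l) * g y powr l"
        using xy' ta l by (intro mult_strict_mono' powr_less_mono2) auto
      also have "\<dots> \<le> h ((1 - l) * x + l * y)" by (rule fgh)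
      finally show "(1 - l) * x + l * y \<in> {x. t < h x / c}" using c by (simp add: field_simps)
    qed
  qed
  have small: "{x. t < f x / a} = {}" "{x. t < g x / b} = {}" if "1 \<le> t" for t
  proof -
    have "f x / a \<le> 1" "g x / b \<le> 1" for x using fa[of x] a b by auto
    then show "{x. t < f x / a} = {}" "{x. t < g x / b} = {}" using that
      by (auto simp: not_less intro: order.trans)
  qed
  have scale: "(\<integral>\<^sup>+x. ennreal (u x / k) \<partial>lborel) = (\<integral>\<^sup>+x. ennreal (u x) \<partial>lborel) / ennreal k"
    if [measurable]: "u \<in> borel_measurable borel" and "\<And>x. 0 \<le> u x" "0 < k" for u :: "real \<Rightarrow> real" and k
    using that by (simp add: divide_ennreal[symmetric] divide_ennreal_def nn_integral_multc)
  \<comment> \<open>Weighted arithmetic-geometric mean inequality. The factor \<open>c\<close> taken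
    out here is restored in the last lines.\<close>
  have "ennreal ((F / a) powr (1 - l) * (G / b) powr l) \<le> ennreal ((1 - l) * (F / a) + l * (G / b))"
    using Youngs_inequality_0[of "1 - l" l "F / a" "G / b"] FG a b l by (intro ennreal_leI) auto
  also have "\<dots> = ennreal (1 - l) * (\<integral>\<^sup>+x. ennreal (f x / a) \<partial>lborel) + ennreal l * (\<integral>\<^sup>+x. ennreal (g x / b) \<partial>lborel)"
    using FG a b l nonneg by (simp add: scale F G divide_ennreal ennreal_plus ennreal_mult[symmetric])
  also have "\<dots> = (\<integral>\<^sup>+t. ennreal (1 - l) * (indicator {0..} t * emeasure lborel {x. t < f x / a})
        + ennreal l * (indicator {0..} t * emeasure lborel {x. t < g x / b}) \<partial>lborel)"
    using nonneg a b by (simp add: nn_integral_layer_cake nn_integral_add nn_integral_cmult)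
  also have "\<dots> \<le> (\<integral>\<^sup>+t. indicator {0..} t * emeasure lborel {x. t < h x / c} \<partial>lborel)"
  proof (rule nn_integral_mono)
    fix t :: real
    consider "t < 0" | "0 \<le> t" "t < 1" | "1 \<le> t" by linarith
    then show "ennreal (1 - l) * (indicator {0..} t * emeasure lborel {x. t < f x / a})
        + ennreal l * (indicator {0..} t * emeasure lborel {x. t < g x / b})
        \<le> indicator {0..} t * emeasure lborel {x. t < h x / c}"
      by cases (use lev small in auto)
  qed
  also have "\<dots> = (\<integral>\<^sup>+x. ennreal (h x / c) \<partial>lborel)"
    using nonneg c by (subst nn_integral_layer_cake) auto
  also have "\<dots> = (\<integral>\<^sup>+x. ennreal (h x) \<partial>lborel) / ennreal c"
    using nonneg c by (simp add: scale)
  finally have "ennreal c * ennreal ((F / a) powr (1 - l) * (G / b) powr l)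
      \<le> ennreal c * ((\<integral>\<^sup>+x. ennreal (h x) \<partial>lborel) / ennreal c)" by (rule mult_left_mono) simp
  also have "\<dots> = (\<integral>\<^sup>+x. ennreal (h x) \<partial>lborel)"
    using c by (metis ennreal_eq_0_iff ennreal_neq_top ennreal_times_divide linorder_not_le mult.commute mult_divide_eq_ennreal)
  also have "ennreal c * ennreal ((F / a) powr (1 - l) * (G / b) powr l) = ennreal (F powr (1 - l) * G powr l)"
    using a b FG c by (simp add: c_def powr_divide ennreal_mult[symmetric])
  finally show ?thesis .
qed

section \<open>Iterated integrals and log-concave marginals\<close>

text \<open>Points have coordinates at all natural numbers. The dimension is expressed only by the
  list of coordinates that are integrated; the others act as parameters.\<close>

abbreviation vec_borel :: "(nat \<Rightarrow> real) measure" where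
  "vec_borel \<equiv> PiM UNIV (\<lambda>_. borel)"

definition marginal :: "real measure \<Rightarrow> nat \<Rightarrow> ((nat \<Rightarrow> real) \<Rightarrow> ennreal) \<Rightarrow> (nat \<Rightarrow> real) \<Rightarrow> ennreal" where
  "marginal M p H x = (\<integral>\<^sup>+t. H (x(p := t)) \<partial>M)"

text \<open>The head of the list is the innermost integral. The result is a function on the whole
  space that no longer depends on the listed coordinates.\<close>

fun iter_int :: "real measure \<Rightarrow> nat list \<Rightarrow> ((nat \<Rightarrow> real) \<Rightarrow> ennreal) \<Rightarrow> (nat \<Rightarrow> real) \<Rightarrow> ennreal" where
  "iter_int M [] H = H"
| "iter_int M (p # ps) H = iter_int M ps (marginal M p H)"

lemma vec_borel_component [measurable]: "(\<lambda>x. x i) \<in> borel_measurable vec_borel"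
  by (rule measurable_component_singleton) simp

lemma measurable_fun_upd_vec_borel [measurable]:
  assumes "f \<in> measurable N vec_borel" "h \<in> borel_measurable N"
  shows "(\<lambda>x. (f x)(p := h x)) \<in> measurable N vec_borel"
  using assms by (intro measurable_fun_upd[where J = UNIV]) auto

lemma section_measurable:
  assumes "sets M = sets borel" "H \<in> borel_measurable vec_borel"
  shows "(\<lambda>t. H (x(p := t))) \<in> borel_measurable M"
proof (rule measurable_compose[OF measurable_fun_upd_vec_borel assms(2)])
  show "(\<lambda>t. x) \<in> measurable M vec_borel" by (rule measurable_const) (simp add: space_PiM)
  show "(\<lambda>t. t) \<in> borel_measurable M"
    using measurable_ident_sets[OF assms(1)] by (simp add: id_def)
qed

lemma marginal_measurable:
  assumes "sigma_finite_measure M" and M: "sets M = sets borel"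
    and H: "H \<in> borel_measurable vec_borel"
  shows "marginal M p H \<in> borel_measurable vec_borel"
proof -
  interpret sigma_finite_measure M by fact
  have "(\<lambda>z. H ((fst z)(p := snd z))) \<in> borel_measurable (vec_borel \<Otimes>\<^sub>M M)"
  proof (rule measurable_compose[OF measurable_fun_upd_vec_borel H])
    show "snd \<in> borel_measurable (vec_borel \<Otimes>\<^sub>M M)"
      using measurable_snd[of vec_borel M] measurable_cong_sets[OF refl M] by blast
  qed (rule measurable_fst)
  then show ?thesis
    unfolding marginal_def[abs_def]
    by (drule_tac borel_measurable_nn_integral_fst) simp
qed

lemma iter_int_measurable:
  assumes "sigma_finite_measure M" "sets M = sets borel" "H \<in> borel_measurable vec_borel"
  shows "iter_int M ps H \<in> borel_measurable vec_borel"
  using assms by (induction ps arbitrary: H) (auto intro: marginal_measurable)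

lemma marginal_swap:
  assumes "sigma_finite_measure M" "sets M = sets borel" "sigma_finite_measure N" "sets N = sets borel"
    "H \<in> borel_measurable vec_borel" "p \<noteq> q"
  shows "marginal M p (marginal N q H) = marginal N q (marginal M p H)"
proof
  fix x
  interpret M: sigma_finite_measure M by fact
  interpret N: sigma_finite_measure N by fact
  interpret P: pair_sigma_finite M N ..
  note [measurable_cong] = assms(2,4) and [measurable] = assms(5)
  have [measurable]: "(\<lambda>y. x) \<in> measurable (M \<Otimes>\<^sub>M N) vec_borel" by (rule measurable_const) (simp add: space_PiM)
  have "(\<integral>\<^sup>+t. (\<integral>\<^sup>+s. H (x(p := t, q := s)) \<partial>N) \<partial>M) = (\<integral>\<^sup>+s. (\<integral>\<^sup>+t. H (x(p := t, q := s)) \<partial>M) \<partial>N)"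
    by (rule P.Fubini'[symmetric]) measurable
  then show "marginal M p (marginal N q H) x = marginal N q (marginal M p H) x"
    unfolding marginal_def using assms(6) by (simp add: fun_upd_twist)
qed

text \<open>Two measures are needed because coordinates pass from the line to the unit interval one
  at a time, so both kinds of integral occur together.\<close>

lemma marginal_iter_int:
  assumes "sigma_finite_measure M" "sets M = sets borel" "sigma_finite_measure N" "sets N = sets borel"
    "H \<in> borel_measurable vec_borel" "p \<notin> set ps"
  shows "marginal M p (iter_int N ps H) = iter_int N ps (marginal M p H)"
  using assms(5,6)
proof (induction ps arbitrary: H)
  case (Cons q ps)
  have "marginal M p (iter_int N ps (marginal N q H)) = iter_int N ps (marginal M p (marginal N q H))"
    using Cons.prems by (intro Cons.IH marginal_measurable assms) auto
  also have "marginal M p (marginal N q H) = marginal N q (marginal M p H)"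
    using Cons.prems by (intro marginal_swap assms) auto
  finally show ?case by simp
qed simp

text \<open>Lets a coordinate with nonzero coefficient be chosen as pivot and integrated
  first.\<close>

lemma iter_int_move_to_front:
  assumes "sigma_finite_measure M" "sets M = sets borel" "H \<in> borel_measurable vec_borel" "p \<in> set ps" "distinct ps"
  shows "iter_int M ps H = iter_int M (p # remove1 p ps) H"
  using assms
proof (induction ps arbitrary: H)
  case (Cons q ps)
  show ?case
  proof (cases "p = q")
    case False
    have "iter_int M (q # ps) H = iter_int M ps (marginal M q H)" by simp
    also have "\<dots> = iter_int M (p # remove1 p ps) (marginal M q H)"
      using Cons.prems False
      by (intro Cons.IH marginal_measurable) auto
    also have "\<dots> = iter_int M (remove1 p ps) (marginal M p (marginal M q H))" by simp
    also have "marginal M p (marginal M q H) = marginal M q (marginal M p H)"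
      using Cons.prems False by (intro marginal_swap) auto
    finally show ?thesis using False by simp
  qed simp
qed simp

lemma iter_int_mono:
  assumes "\<And>x. H x \<le> G x"
  shows "iter_int M ps H x \<le> iter_int M ps G x"
  using assms
proof (induction ps arbitrary: H G)
  case (Cons p ps)
  have "marginal M p H y \<le> marginal M p G y" for y
    unfolding marginal_def by (rule nn_integral_mono) (rule Cons.prems)
  then show ?case unfolding iter_int.simps by (rule Cons.IH)
qed simp

lemma iter_int_cmult:
  assumes "sigma_finite_measure M" "sets M = sets borel" "H \<in> borel_measurable vec_borel"
  shows "iter_int M ps (\<lambda>x. c * H x) = (\<lambda>x. c * iter_int M ps H x)"
  using assms
proof (induction ps arbitrary: H)
  case (Cons p ps)
  have "marginal M p (\<lambda>x. c * H x) = (\<lambda>x. c * marginal M p H x)"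
  proof
    fix x
    show "marginal M p (\<lambda>x. c * H x) x = c * marginal M p H x"
      unfolding marginal_def by (rule nn_integral_cmult) (intro section_measurable Cons.prems)
  qed
  moreover have "iter_int M ps (\<lambda>x. c * marginal M p H x) = (\<lambda>x. c * iter_int M ps (marginal M p H) x)"
    by (intro Cons.IH marginal_measurable Cons.prems)
  ultimately show ?case by simp
qed simp

lemma iter_int_SUP:
  assumes "sigma_finite_measure M" "sets M = sets borel" "\<And>n. H n \<in> borel_measurable vec_borel"
    and "\<And>x. incseq (\<lambda>n. H n x)"
  shows "iter_int M ps (\<lambda>x. SUP n. H n x) = (\<lambda>x. SUP n. iter_int M ps (H n) x)"
  using assms
proof (induction ps arbitrary: H)
  case (Cons p ps)
  have "marginal M p (\<lambda>x. SUP n. H n x) = (\<lambda>x. SUP n. marginal M p (H n) x)"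
  proof
    fix x
    show "marginal M p (\<lambda>x. SUP n. H n x) x = (SUP n. marginal M p (H n) x)"
      unfolding marginal_def
    proof (rule nn_integral_monotone_convergence_SUP)
      show "incseq (\<lambda>i t. H i (x(p := t)))"
        using Cons.prems(4) by (auto simp: incseq_def le_fun_def)
    qed (intro section_measurable Cons.prems)
  qed
  moreover have "incseq (\<lambda>n. marginal M p (H n) x)" for x
    using Cons.prems(4) unfolding marginal_def incseq_def by (auto intro!: nn_integral_mono)
  then have "iter_int M ps (\<lambda>x. SUP n. marginal M p (H n) x) = (\<lambda>x. SUP n. iter_int M ps (marginal M p (H n)) x)"
    by (intro Cons.IH marginal_measurable Cons.prems)
  ultimately show ?case by simp
qed simp

text \<open>Stated through real lower bounds because \<open>ennreal\<close> has no real powers.\<close>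

definition log_concave_fn :: "((nat \<Rightarrow> real) \<Rightarrow> ennreal) \<Rightarrow> bool" where
  "log_concave_fn H \<longleftrightarrow> (\<forall>x y l a b. 0 < l \<longrightarrow> l < 1 \<longrightarrow> 0 \<le> a \<longrightarrow> 0 \<le> b \<longrightarrow>
     ennreal a \<le> H x \<longrightarrow> ennreal b \<le> H y \<longrightarrow>
     ennreal (a powr (1 - l) * b powr l) \<le> H (\<lambda>i. (1 - l) * x i + l * y i))"

lemma log_concave_fnD:
  assumes "log_concave_fn H" "0 < l" "l < 1" "0 \<le> a" "0 \<le> b" "ennreal a \<le> H x" "ennreal b \<le> H y"
  shows "ennreal (a powr (1 - l) * b powr l) \<le> H (\<lambda>i. (1 - l) * x i + l * y i)"
  using assms unfolding log_concave_fn_def by blast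

text \<open>The sections of \<open>H\<close> along coordinate \<open>p\<close> over
  \<open>x\<close>, \<open>y\<close> and their convex combination satisfy the one-dimensional
  hypothesis. Boundedness and bounded support in \<open>p\<close> make sections and marginals
  finite, so that real powers are available.\<close>

lemma log_concave_fn_marginal:
  fixes H :: "(nat \<Rightarrow> real) \<Rightarrow> ennreal"
  assumes lc: "log_concave_fn H" and H: "H \<in> borel_measurable vec_borel"
    and bnd: "\<And>x. H x \<le> ennreal b0" and supp: "\<And>x. H x \<noteq> 0 \<Longrightarrow> \<bar>x p\<bar> \<le> r0"
  shows "log_concave_fn (marginal lborel p H)"
  unfolding log_concave_fn_def
proof (intro allI impI)
  fix x y :: "nat \<Rightarrow> real" and l a b :: real
  assume l: "0 < l" "l < 1" and ab: "0 \<le> a" "0 \<le> b"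
    and ax: "ennreal a \<le> marginal lborel p H x" and bx: "ennreal b \<le> marginal lborel p H y"
  define z where "z = (\<lambda>i. (1 - l) * x i + l * y i)"
  define f where "f w t = enn2real (H (w(p := t)))" for w :: "nat \<Rightarrow> real" and t
  have fin: "H w < top_class.top" for w using bnd[of w] by (metis ennreal_less_top order.strict_trans1)
  have fH: "ennreal (f w t) = H (w(p := t))" for w t unfolding f_def using fin by simp
  have fm: "f w \<in> borel_measurable borel" for w
    unfolding f_def by (rule measurable_compose[OF section_measurable[OF _ H]]) simp_all
  have nn: "0 \<le> f w t" for w t unfolding f_def by simp
  have fb: "f w t \<le> max 0 b0" for w t
  proof -
    have "f w t \<le> enn2real (ennreal b0)" unfolding f_def by (intro enn2real_mono bnd) simp
    also have "\<dots> \<le> max 0 b0" by (cases "0 \<le> b0") (auto simp: ennreal_neg)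
    finally show ?thesis .
  qed
  have fs: "\<bar>t\<bar> \<le> r0" if "f w t \<noteq> 0" for w t
  proof -
    have "H (w(p := t)) \<noteq> 0" using that unfolding f_def by auto
    from supp[OF this] show ?thesis by simp
  qed
  \<comment> \<open>Kept general in \<open>u\<close>, \<open>v\<close> and \<open>k\<close> because
    it is used twice: with \<open>u = v\<close> for the convexity of the level sets, and with
    different base points for the inequality itself.\<close>
  have mid: "f u s powr (1 - k) * f v t powr k \<le> f (\<lambda>i. (1 - k) * u i + k * v i) ((1 - k) * s + k * t)"
    if k: "0 < k" "k < 1" for u v s t k
  proof -
    have "ennreal (f u s powr (1 - k) * f v t powr k)
      \<le> H (\<lambda>i. (1 - k) * (u(p := s)) i + k * (v(p := t)) i)"
      by (rule log_concave_fnD[OF lc k nn nn]) (simp_all only: fH order_refl)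
    also have "(\<lambda>i. (1 - k) * (u(p := s)) i + k * (v(p := t)) i)
        = (\<lambda>i. (1 - k) * u i + k * v i)(p := (1 - k) * s + k * t)" by auto
    also have "H \<dots> = ennreal (f (\<lambda>i. (1 - k) * u i + k * v i) ((1 - k) * s + k * t))" by (simp add: fH)
    finally show ?thesis using nn by simp
  qed
  have cvx: "convex {s. \<tau> < f w s}" if "0 \<le> \<tau>" for w \<tau>
  proof (rule convexI)
    fix s t u v :: real assume st: "s \<in> {s. \<tau> < f w s}" "t \<in> {s. \<tau> < f w s}" and uv: "0 \<le> u" "0 \<le> v" "u + v = 1"
    show "u *\<^sub>R s + v *\<^sub>R t \<in> {s. \<tau> < f w s}"
    proof (cases "u = 0 \<or> v = 0")
      case True then show ?thesis using st uv by auto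
    next
      case False
      then have v: "0 < v" "v < 1" and u: "u = 1 - v" using uv by auto
      define m where "m = min (f w s) (f w t)"
      have m: "\<tau> < m" "m \<le> f w s" "m \<le> f w t" using st by (auto simp: m_def)
      have "\<tau> < m powr (1 - v) * m powr v" using m that by (simp flip: powr_add)
      also have "\<dots> \<le> f w s powr (1 - v) * f w t powr v"
        using m v that by (intro mult_mono powr_mono2) auto
      also have "\<dots> \<le> f (\<lambda>i. (1 - v) * w i + v * w i) ((1 - v) * s + v * t)" by (rule mid[OF v])
      also have "(\<lambda>i. (1 - v) * w i + v * w i) = w" by (auto simp: algebra_simps)
      finally show ?thesis by (simp add: u)
    qed
  qed
  have marg: "marginal lborel p H w = (\<integral>\<^sup>+t. ennreal (f w t) \<partial>lborel)" for w
    unfolding marginal_def fH ..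
  have mfin: "marginal lborel p H w < top_class.top" for w
  proof -
    have "marginal lborel p H w \<le> (\<integral>\<^sup>+t. ennreal (max 0 b0) * indicator {-r0..r0} t \<partial>lborel)"
      unfolding marg
    proof (rule nn_integral_mono)
      fix t show "ennreal (f w t) \<le> ennreal (max 0 b0) * indicator {-r0..r0} t"
      proof (cases "f w t = 0")
        case False
        then have "t \<in> {-r0..r0}" using fs[of w t] by (auto simp: abs_le_iff)
        then show ?thesis using fb[of w t] by (simp only: indicator_simps mult_1_right ennreal_leI)
      qed simp
    qed
    also have "\<dots> = ennreal (max 0 b0) * emeasure lborel {-r0..r0}" by (simp add: nn_integral_cmult)
    also have "\<dots> < top_class.top" by (simp add: ennreal_mult_less_top emeasure_lborel_Icc_eq)
    finally show ?thesis .
  qed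
  have "ennreal (enn2real (marginal lborel p H x) powr (1 - l) * enn2real (marginal lborel p H y) powr l)
      \<le> (\<integral>\<^sup>+t. ennreal (f z t) \<partial>lborel)"
  proof (rule prekopa_leindler_1d[of "f x" "f y" "f z" "max 0 b0" r0])
    show "(\<integral>\<^sup>+t. ennreal (f x t) \<partial>lborel) = ennreal (enn2real (marginal lborel p H x))"
      "(\<integral>\<^sup>+t. ennreal (f y t) \<partial>lborel) = ennreal (enn2real (marginal lborel p H y))"
      using mfin by (simp_all add: marg)
    show "f x s powr (1 - l) * f y t powr l \<le> f z ((1 - l) * s + l * t)" for s t
      unfolding z_def by (rule mid[OF l])
    show "0 \<le> f x t" "0 \<le> f y t" "0 \<le> f z t" "f x t \<le> max 0 b0" "f y t \<le> max 0 b0" for t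
      by (rule nn fb)+
    show "f x t \<noteq> 0 \<Longrightarrow> \<bar>t\<bar> \<le> r0" "f y t \<noteq> 0 \<Longrightarrow> \<bar>t\<bar> \<le> r0" for t
      by (rule fs, assumption)+
    show "0 \<le> t \<Longrightarrow> convex {s. t < f x s}" "0 \<le> t \<Longrightarrow> convex {s. t < f y s}" for t
      by (rule cvx, assumption)+
  qed (simp_all add: l fm)
  moreover have "a \<le> enn2real (marginal lborel p H x)" "b \<le> enn2real (marginal lborel p H y)"
    using ax bx mfin ab by (metis enn2real_ennreal enn2real_mono)+
  then have "ennreal (a powr (1 - l) * b powr l)
     \<le> ennreal (enn2real (marginal lborel p H x) powr (1 - l) * enn2real (marginal lborel p H y) powr l)"
    using ab l by (intro ennreal_leI mult_mono powr_mono2) auto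
  ultimately show "ennreal (a powr (1 - l) * b powr l) \<le> marginal lborel p H (\<lambda>i. (1 - l) * x i + l * y i)"
    unfolding z_def marg by (rule order.trans[rotated])
qed

section \<open>Peakedness of the cosine bump over the Gaussian\<close>

definition cos_bump :: "real \<Rightarrow> real" where
  "cos_bump x = (if \<bar>x\<bar> < 1/2 then (cos (pi * x))\<^sup>2 else 0)"

text \<open>The mass of \<open>exp (- c t^2)\<close> is \<open>sqrt (pi / c)\<close>; equality with
  the mass 1/2 of \<open>cos_bump\<close> forces \<open>c = 4 * pi\<close>. Both bumps have the
  value 1 at 0, so a zero column makes no difference between them.\<close>

definition gauss_bump :: "real \<Rightarrow> real" where
  "gauss_bump x = exp (- (4 * pi * x\<^sup>2))"

text \<open>Completing the square gives a normal density of mean \<open>- v / c\<close> and variance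
  \<open>1 / (2 * c)\<close>. The linear term stands for the mixed terms of a quadratic form when
  one variable is integrated out.\<close>

lemma nn_integral_gaussian:
  fixes c v :: real
  assumes "0 < c"
  shows "(\<integral>\<^sup>+t. ennreal (exp (- (c * t\<^sup>2 + 2 * v * t))) \<partial>lborel) = ennreal (sqrt (pi / c) * exp (v\<^sup>2 / c))"
proof -
  define s where "s = 1 / sqrt (2 * c)"
  define k where "k = sqrt (pi / c) * exp (v\<^sup>2 / c)"
  have s: "0 < s" "s\<^sup>2 = 1 / (2 * c)" using assms by (auto simp: s_def power_divide)
  have k: "0 < k" using assms by (simp add: k_def)
  have eq: "exp (- (c * t\<^sup>2 + 2 * v * t)) = k * normal_density (- v / c) s t" for t
  proof -
    have e: "- (c * t\<^sup>2 + 2 * v * t) = v\<^sup>2 / c + - ((t - (- v / c))\<^sup>2) / (2 * s\<^sup>2)"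
      unfolding s using assms by (simp add: field_simps power2_eq_square)
    have r: "sqrt (2 * pi * s\<^sup>2) = sqrt (pi / c)" unfolding s using assms by simp
    show ?thesis unfolding normal_density_def r k_def e exp_add using assms by simp
  qed
  interpret prob_space "density lborel (normal_density (- v / c) s)"
    by (rule prob_space_normal_density[OF s(1)])
  have "(\<integral>\<^sup>+t. ennreal (normal_density (- v / c) s t) \<partial>lborel) = 1"
    using emeasure_space_1 by (simp add: emeasure_density)
  then show ?thesis unfolding eq k_def[symmetric] using k
    by (simp add: ennreal_mult nn_integral_cmult)
qed

lemma nn_integral_gauss_bump: "(\<integral>\<^sup>+t. ennreal (gauss_bump t) \<partial>lborel) = ennreal (1/2)"
  using nn_integral_gaussian[of "4 * pi" 0] by (simp add: gauss_bump_def real_sqrt_divide)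

lemma cos_bump_measurable [measurable]: "cos_bump \<in> borel_measurable borel"
  unfolding cos_bump_def[abs_def] by measurable

lemma gauss_bump_measurable [measurable]: "gauss_bump \<in> borel_measurable borel"
  unfolding gauss_bump_def[abs_def] by measurable

lemma cos_bump_nonneg: "0 \<le> cos_bump x" and gauss_bump_nonneg: "0 \<le> gauss_bump x"
  and cos_bump_le_1: "cos_bump x \<le> 1" and gauss_bump_le_1: "gauss_bump x \<le> 1"
  and cos_bump_even: "cos_bump (- x) = cos_bump x" and gauss_bump_even: "gauss_bump (- x) = gauss_bump x"
  by (auto simp: cos_bump_def gauss_bump_def abs_square_le_1)

lemma nn_integral_cos_bump: "(\<integral>\<^sup>+t. ennreal (cos_bump t) \<partial>lborel) = ennreal (1/2)"
proof -
  have "(\<integral>\<^sup>+t. ennreal (cos_bump t) \<partial>lborel)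
      = (\<integral>\<^sup>+t. ennreal ((cos (pi * t))\<^sup>2) * indicator {-(1/2)..1/2} t \<partial>lborel)"
  proof (rule nn_integral_cong)
    fix t :: real
    show "ennreal (cos_bump t) = ennreal ((cos (pi * t))\<^sup>2) * indicator {-(1/2)..1/2} t"
    proof (cases "t = 1/2 \<or> t = -(1/2)")
      case True
      then have "pi * t = pi/2 \<or> pi * t = -(pi/2)" by (elim disjE) simp_all
      then have "cos (pi * t) = 0" by (elim disjE) (simp_all only: cos_minus cos_pi_half)
      then show ?thesis by (simp add: cos_bump_def)
    qed (auto simp: cos_bump_def indicator_def abs_less_iff)
  qed
  also have "\<dots> = ennreal ((1/2 / 2 + sin (2 * pi * (1/2)) / (4 * pi)) - (-(1/2) / 2 + sin (2 * pi * -(1/2)) / (4 * pi)))"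
  proof (rule nn_integral_FTC_Icc)
    fix x :: real
    have "((\<lambda>x. x / 2 + sin (2 * pi * x) / (4 * pi)) has_real_derivative (1/2 + cos (2 * (pi * x)) / 2)) (at x)"
      by (auto intro!: derivative_eq_intros simp: mult.assoc)
    also have "1/2 + cos (2 * (pi * x)) / 2 = (cos (pi * x))\<^sup>2"
      by (simp add: cos_double_cos diff_divide_distrib)
    finally show "((\<lambda>x. x / 2 + sin (2 * pi * x) / (4 * pi)) has_real_derivative (cos (pi * x))\<^sup>2) (at x)" .
  qed auto
  finally show ?thesis by simp
qed

definition log_concave_real :: "(real \<Rightarrow> real) \<Rightarrow> bool" where
  "log_concave_real h \<longleftrightarrow> (\<forall>x y l. 0 < l \<longrightarrow> l < 1 \<longrightarrow> h x powr (1 - l) * h y powr l \<le> h ((1 - l) * x + l * y))"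

lemma log_concave_gauss_bump: "log_concave_real gauss_bump"
  unfolding log_concave_real_def
proof (intro allI impI)
  fix x y l :: real assume l: "0 < l" "l < 1"
  have "((1 - l) * x + l * y)\<^sup>2 = (1 - l) * x\<^sup>2 + l * y\<^sup>2 - l * (1 - l) * (x - y)\<^sup>2"
    by (simp add: power2_eq_square algebra_simps)
  also have "\<dots> \<le> (1 - l) * x\<^sup>2 + l * y\<^sup>2" using l by simp
  finally have "4 * pi * ((1 - l) * x + l * y)\<^sup>2 \<le> 4 * pi * ((1 - l) * x\<^sup>2 + l * y\<^sup>2)"
    by (intro mult_left_mono) auto
  then show "gauss_bump x powr (1 - l) * gauss_bump y powr l \<le> gauss_bump ((1 - l) * x + l * y)"
    unfolding gauss_bump_def by (simp add: exp_powr_real exp_add[symmetric] algebra_simps)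
qed

lemma convex_on_neg_ln_cos: "convex_on {-(pi/2)<..<pi/2} (\<lambda>x. - ln (cos x))"
proof (rule f''_ge0_imp_convex)
  fix x :: real assume "x \<in> {-(pi/2)<..<pi/2}"
  then have c: "0 < cos x" by (intro cos_gt_zero_pi) auto
  show "((\<lambda>x. - ln (cos x)) has_real_derivative tan x) (at x)"
    using c by (auto intro!: derivative_eq_intros simp: tan_def)
  show "(tan has_real_derivative inverse ((cos x)\<^sup>2)) (at x)"
    using c by (intro DERIV_tan) auto
  show "0 \<le> inverse ((cos x)\<^sup>2)" by simp
qed auto

lemma log_concave_cos_bump: "log_concave_real cos_bump"
  unfolding log_concave_real_def
proof (intro allI impI)
  fix x y l :: real assume l: "0 < l" "l < 1"
  show "cos_bump x powr (1 - l) * cos_bump y powr l \<le> cos_bump ((1 - l) * x + l * y)"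
  proof (cases "\<bar>x\<bar> < 1/2 \<and> \<bar>y\<bar> < 1/2")
    case False
    then have "cos_bump x = 0 \<or> cos_bump y = 0" by (auto simp: cos_bump_def)
    then show ?thesis by (auto simp: cos_bump_nonneg)
  next
    case True
    define z where "z = (1 - l) * x + l * y"
    have dom: "pi * w \<in> {-(pi/2)<..<pi/2}" if "\<bar>w\<bar> < 1/2" for w
    proof -
      have "pi * w < pi * (1/2)" using that by (intro mult_strict_left_mono) auto
      moreover have "pi * (-(1/2)) < pi * w" using that by (intro mult_strict_left_mono) auto
      ultimately show ?thesis by auto
    qed
    have "z \<in> {-(1/2)<..<1/2}"
    proof -
      have "x \<in> {-(1/2)<..<1/2}" "y \<in> {-(1/2)<..<1/2}" using True by auto
      then show ?thesis using convexD[of "{-(1/2)<..<1/2::real}" x y "1 - l" l] l by (simp add: z_def)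
    qed
    then have z: "\<bar>z\<bar> < 1/2" by (auto simp: abs_less_iff)
    have pos: "0 < cos (pi * w)" if "\<bar>w\<bar> < 1/2" for w
      using dom[OF that] by (intro cos_gt_zero_pi) auto
    have "- ln (cos ((1 - l) *\<^sub>R (pi * x) + l *\<^sub>R (pi * y)))
       \<le> (1 - l) * - ln (cos (pi * x)) + l * - ln (cos (pi * y))"
      by (rule convex_onD[OF convex_on_neg_ln_cos]) (use dom[of x] dom[of y] True l in auto)
    moreover have "(1 - l) *\<^sub>R (pi * x) + l *\<^sub>R (pi * y) = pi * z" by (simp add: z_def algebra_simps)
    ultimately have le: "(1 - l) * ln (cos (pi * x)) + l * ln (cos (pi * y)) \<le> ln (cos (pi * z))"
      by simp
    have sq: "(cos (pi * w))\<^sup>2 = exp (2 * ln (cos (pi * w)))" if "\<bar>w\<bar> < 1/2" for w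
      using pos[OF that] by (simp add: exp_double)
    have "exp (2 * ln (cos (pi * x))) powr (1 - l) * exp (2 * ln (cos (pi * y))) powr l
       = exp (2 * ((1 - l) * ln (cos (pi * x)) + l * ln (cos (pi * y))))"
      by (simp add: exp_powr_real exp_add[symmetric] algebra_simps)
    also have "\<dots> \<le> exp (2 * ln (cos (pi * z)))" using le by simp
    finally show ?thesis
      using True z unfolding z_def[symmetric] cos_bump_def by (simp add: sq)
  qed
qed

text \<open>Convexity of \<open>tan\<close> together with \<open>tan 0 = 0\<close> makes
  \<open>tan t / t\<close> increasing; the quotients are cleared of denominators.\<close>

lemma tan_ratio_mono:
  assumes "0 < x" "x \<le> y" "y < pi/2"
  shows "tan x * y \<le> tan y * x"
proof (cases "x = y")
  case False
  have cvx: "convex_on {0..y} tan"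
  proof (rule f''_ge0_imp_convex)
    fix t assume t: "t \<in> {0..y}"
    then have c: "0 < cos t" using assms by (intro cos_gt_zero_pi) auto
    show "(tan has_real_derivative inverse ((cos t)\<^sup>2)) (at t)" using c by (intro DERIV_tan) auto
    show "((\<lambda>t. inverse ((cos t)\<^sup>2)) has_real_derivative 2 * sin t / cos t ^ 3) (at t)"
      using c by (auto intro!: derivative_eq_intros simp: field_simps power2_eq_square power3_eq_cube)
    show "0 \<le> 2 * sin t / cos t ^ 3" using c t assms by (auto intro!: divide_nonneg_nonneg sin_ge_zero)
  qed auto
  have "tan ((1 - x / y) *\<^sub>R 0 + (x / y) *\<^sub>R y) \<le> (1 - x / y) * tan 0 + (x / y) * tan y"
    by (rule convex_onD[OF cvx]) (use assms in auto)
  then show ?thesis using assms by (simp add: field_simps)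
qed simp

text \<open>Here \<open>h\<close> is the logarithm of the ratio of the two bumps, with
  \<open>h 0 = 0\<close>. Its derivative has the sign of \<open>4 - tan (pi * x) / x\<close>, and
  this quotient increases, so once \<open>h\<close> has become negative it stays negative.\<close>

lemma bump_single_crossing:
  obtains t0 where "0 \<le> t0" "\<And>x. \<bar>x\<bar> < t0 \<Longrightarrow> gauss_bump x \<le> cos_bump x" "\<And>x. t0 < \<bar>x\<bar> \<Longrightarrow> cos_bump x \<le> gauss_bump x"
proof -
  define h where "h x = 2 * ln (cos (pi * x)) + 4 * pi * x\<^sup>2" for x :: real
  have c: "0 < cos (pi * x)" if "0 \<le> x" "x < 1/2" for x
  proof -
    have "pi * x < pi * (1/2)" using that by (intro mult_strict_left_mono) auto
    moreover have "0 \<le> pi * x" using that by simp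
    ultimately show ?thesis using pi_gt_zero by (intro cos_gt_zero_pi) linarith+
  qed
  have dh: "(h has_real_derivative 2 * pi * (4 * x - tan (pi * x))) (at x)" if "0 \<le> x" "x < 1/2" for x
    unfolding h_def[abs_def] using c[OF that]
    by (auto intro!: derivative_eq_intros simp: tan_def field_simps)
  have down: "h y < 0" if x: "0 \<le> x" "x \<le> y" "y < 1/2" "h x < 0" for x y
  proof (cases "x = y")
    case False
    have "x \<noteq> 0" using x by (auto simp: h_def)
    then have x0: "0 < x" using x by simp
    \<comment> \<open>Two uses of the mean value theorem: a negative slope at some \<open>z\<close>
      before \<open>x\<close>, then a slope at some \<open>w\<close> after \<open>x\<close> that
      must be negative as well.\<close>
    obtain z where z: "0 < z" "z < x" "h x - h 0 = (x - 0) * (2 * pi * (4 * z - tan (pi * z)))"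
      using MVT2[OF x0, of h "\<lambda>x. 2 * pi * (4 * x - tan (pi * x))"] dh x by auto
    have "4 * z - tan (pi * z) < 0"
    proof (rule ccontr)
      assume "\<not> ?thesis"
      then have "0 \<le> (x - 0) * (2 * pi * (4 * z - tan (pi * z)))" using x0 by simp
      then show False using z(3) x by (simp add: h_def)
    qed
    then have tz: "4 * z < tan (pi * z)" by simp
    have xy: "x < y" using x False by simp
    obtain w where w: "x < w" "w < y" "h y - h x = (y - x) * (2 * pi * (4 * w - tan (pi * w)))"
      using MVT2[OF xy, of h "\<lambda>x. 2 * pi * (4 * x - tan (pi * x))"] dh x by auto
    have "pi * w < pi * (1/2)" using w x by (intro mult_strict_left_mono) auto
    then have "tan (pi * z) * (pi * w) \<le> tan (pi * w) * (pi * z)"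
      using z w by (intro tan_ratio_mono) auto
    then have "tan (pi * z) * w \<le> tan (pi * w) * z" by (simp add: mult.left_commute)
    moreover have "4 * z * w < tan (pi * z) * w" using tz z w by (intro mult_strict_right_mono) auto
    ultimately have "z * (4 * w) < z * tan (pi * w)" by (simp add: mult_ac)
    then have "4 * w < tan (pi * w)" using z by simp
    then have "(y - x) * (2 * pi * (4 * w - tan (pi * w))) < 0"
      using xy by (intro mult_pos_neg) auto
    then show ?thesis using w(3) x by linarith
  qed (use x in simp)
  have sgn: "cos_bump x = exp (h \<bar>x\<bar>) * gauss_bump x" if "\<bar>x\<bar> < 1/2" for x
  proof -
    have "cos (pi * \<bar>x\<bar>) = cos (pi * x)" by (cases "0 \<le> x") auto
    then show ?thesis using that c[of "\<bar>x\<bar>"]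
      by (simp add: cos_bump_def gauss_bump_def h_def exp_add[symmetric] exp_double)
  qed
  \<comment> \<open>The crossing point is the supremum of the arguments at which the cosine bump
    still dominates.\<close>
  define S where "S = {x. 0 \<le> x \<and> x < 1/2 \<and> 0 \<le> h x}"
  define t0 where "t0 = Sup S"
  have S0: "0 \<in> S" by (simp add: S_def h_def)
  have bdd: "bdd_above S" by (rule bdd_aboveI[of _ "1/2"]) (auto simp: S_def)
  show ?thesis
  proof (rule that[of t0])
    show "0 \<le> t0" unfolding t0_def using S0 bdd by (rule cSup_upper)
  next
    fix x :: real assume "\<bar>x\<bar> < t0"
    then obtain y where y: "y \<in> S" "\<bar>x\<bar> < y" unfolding t0_def using less_cSupD[of S] S0 by blast
    then have x: "\<bar>x\<bar> < 1/2" "0 \<le> h \<bar>x\<bar>" using down[of "\<bar>x\<bar>" y] by (auto simp: S_def not_less[symmetric])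
    have "1 * gauss_bump x \<le> exp (h \<bar>x\<bar>) * gauss_bump x" using x by (intro mult_right_mono) (auto simp: gauss_bump_nonneg)
    then show "gauss_bump x \<le> cos_bump x" unfolding sgn[OF x(1)] by simp
  next
    fix x :: real assume a: "t0 < \<bar>x\<bar>"
    show "cos_bump x \<le> gauss_bump x"
    proof (cases "\<bar>x\<bar> < 1/2")
      case True
      have "\<bar>x\<bar> \<notin> S" using a cSup_upper[OF _ bdd, of "\<bar>x\<bar>"] unfolding t0_def by auto
      then have "h \<bar>x\<bar> < 0" using True by (auto simp: S_def)
      then have "exp (h \<bar>x\<bar>) * gauss_bump x \<le> 1 * gauss_bump x" by (intro mult_right_mono) (auto simp: gauss_bump_nonneg)
      then show ?thesis unfolding sgn[OF True] by simp
    qed (simp add: cos_bump_def gauss_bump_nonneg)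
  qed
qed

text \<open>Without the common part \<open>u\<close>, the excess \<open>p\<close> of the cosine bump
  lives inside the crossing point and the excess \<open>q\<close> of the Gaussian outside. They have
  equal mass, and \<open>F\<close> is at least \<open>F t0\<close> on the first region and at most
  \<open>F t0\<close> on the second.\<close>

lemma nn_integral_gauss_bump_le_cos_bump:
  fixes F :: "real \<Rightarrow> ennreal"
  assumes [measurable]: "F \<in> borel_measurable borel" and mono: "\<And>s t. \<bar>s\<bar> \<le> \<bar>t\<bar> \<Longrightarrow> F t \<le> F s"
  shows "(\<integral>\<^sup>+t. ennreal (gauss_bump t) * F t \<partial>lborel) \<le> (\<integral>\<^sup>+t. ennreal (cos_bump t) * F t \<partial>lborel)"
proof -
  obtain t0 where t00: "0 \<le> t0" and t0: "\<And>x. \<bar>x\<bar> < t0 \<Longrightarrow> gauss_bump x \<le> cos_bump x" "\<And>x. t0 < \<bar>x\<bar> \<Longrightarrow> cos_bump x \<le> gauss_bump x"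
    using bump_single_crossing by blast
  define u where "u x = min (gauss_bump x) (cos_bump x)" for x
  define p where "p x = cos_bump x - u x" for x
  define q where "q x = gauss_bump x - u x" for x
  have [measurable]: "u \<in> borel_measurable borel" unfolding u_def[abs_def] by measurable
  have [measurable]: "p \<in> borel_measurable borel" "q \<in> borel_measurable borel"
    unfolding p_def[abs_def] q_def[abs_def] by measurable
  have nn: "0 \<le> u x" "0 \<le> p x" "0 \<le> q x" for x
    by (auto simp: u_def p_def q_def cos_bump_nonneg gauss_bump_nonneg)
  have cu: "ennreal (cos_bump x) = ennreal (u x) + ennreal (p x)" and gu: "ennreal (gauss_bump x) = ennreal (u x) + ennreal (q x)" for x
    using nn[of x] by (simp_all add: p_def q_def ennreal_plus[symmetric] del: ennreal_plus)
  \<comment> \<open>Cancellation in \<open>ennreal\<close> needs the common part to be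
    finite.\<close>
  have ufin: "(\<integral>\<^sup>+x. ennreal (u x) \<partial>lborel) \<noteq> top_class.top"
  proof -
    have "(\<integral>\<^sup>+x. ennreal (u x) \<partial>lborel) \<le> (\<integral>\<^sup>+x. ennreal (gauss_bump x) \<partial>lborel)"
      by (intro nn_integral_mono ennreal_leI) (simp add: u_def)
    then show ?thesis unfolding nn_integral_gauss_bump by (auto simp: top_unique)
  qed
  have "(\<integral>\<^sup>+x. ennreal (u x) \<partial>lborel) + (\<integral>\<^sup>+x. ennreal (p x) \<partial>lborel)
      = (\<integral>\<^sup>+x. ennreal (u x) \<partial>lborel) + (\<integral>\<^sup>+x. ennreal (q x) \<partial>lborel)"
    using nn_integral_cos_bump nn_integral_gauss_bump unfolding cu gu by (simp add: nn_integral_add)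
  then have pq: "(\<integral>\<^sup>+x. ennreal (p x) \<partial>lborel) = (\<integral>\<^sup>+x. ennreal (q x) \<partial>lborel)"
    using ufin by (simp add: ennreal_add_left_cancel)
  have "(\<integral>\<^sup>+x. ennreal (q x) * F x \<partial>lborel) \<le> (\<integral>\<^sup>+x. ennreal (q x) * F t0 \<partial>lborel)"
  proof (rule nn_integral_mono)
    fix x show "ennreal (q x) * F x \<le> ennreal (q x) * F t0"
    proof (cases "\<bar>x\<bar> < t0")
      case True then show ?thesis using t0(1)[of x] by (simp add: q_def u_def min_absorb1)
    next
      case False then show ?thesis using t00 by (intro mult_left_mono mono) auto
    qed
  qed
  also have "\<dots> = (\<integral>\<^sup>+x. ennreal (p x) * F t0 \<partial>lborel)" by (simp add: nn_integral_multc pq)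
  also have "\<dots> \<le> (\<integral>\<^sup>+x. ennreal (p x) * F x \<partial>lborel)"
  proof (rule nn_integral_mono)
    fix x show "ennreal (p x) * F t0 \<le> ennreal (p x) * F x"
    proof (cases "t0 < \<bar>x\<bar>")
      case True then show ?thesis using t0(2)[of x] by (simp add: p_def u_def min_absorb2)
    next
      case False then show ?thesis using t00 by (intro mult_left_mono mono) auto
    qed
  qed
  finally have "(\<integral>\<^sup>+x. ennreal (u x) * F x \<partial>lborel) + (\<integral>\<^sup>+x. ennreal (q x) * F x \<partial>lborel)
      \<le> (\<integral>\<^sup>+x. ennreal (u x) * F x \<partial>lborel) + (\<integral>\<^sup>+x. ennreal (p x) * F x \<partial>lborel)"
    by (rule add_left_mono)
  then show ?thesis unfolding cu gu by (simp add: distrib_right nn_integral_add)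
qed

section \<open>Products of bumps along linear forms\<close>

text \<open>The index set is explicit so that splitting off a pivot coordinate leaves a form over
  \<open>Q - {p}\<close>.\<close>

definition lin_form :: "nat set \<Rightarrow> (nat \<Rightarrow> real) \<Rightarrow> (nat \<Rightarrow> real) \<Rightarrow> real" where
  "lin_form Q a x = (\<Sum>q\<in>Q. a q * x q)"

lemma lin_form_measurable [measurable]: "lin_form Q a \<in> borel_measurable vec_borel"
  unfolding lin_form_def[abs_def] by measurable

lemma prod_lin_form_measurable:
  assumes "h \<in> borel_measurable borel"
  shows "(\<lambda>x. \<Prod>j\<in>X. ennreal (h (lin_form Q (a j) x))) \<in> borel_measurable vec_borel"
proof (rule borel_measurable_prod_ennreal)
  fix j
  have "(\<lambda>t. ennreal (h t)) \<in> borel_measurable borel" using assms by simp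
  from measurable_compose[OF lin_form_measurable this]
  show "(\<lambda>x. ennreal (h (lin_form Q (a j) x))) \<in> borel_measurable vec_borel" .
qed

lemma lin_form_convex: "lin_form Q a (\<lambda>i. (1 - l) * x i + l * y i) = (1 - l) * lin_form Q a x + l * lin_form Q a y"
  unfolding lin_form_def by (simp add: sum_distrib_left sum.distrib[symmetric] algebra_simps)

lemma lin_form_uminus: "lin_form Q a (\<lambda>i. - x i) = - lin_form Q a x"
  unfolding lin_form_def by (simp add: sum_negf)

lemma lin_form_upd_notin: "p \<notin> Q \<Longrightarrow> lin_form Q a (x(p := t)) = lin_form Q a x"
  unfolding lin_form_def by (auto intro!: sum.cong)

lemma lin_form_upd:
  assumes "finite Q" "p \<in> Q"
  shows "lin_form Q a (x(p := t)) = lin_form (Q - {p}) a x + a p * t"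
  using assms lin_form_upd_notin[of p "Q - {p}" a x t] unfolding lin_form_def
  by (simp add: sum.remove)

lemma log_concave_fn_mult:
  assumes "log_concave_fn H" "log_concave_real h" "\<And>x. 0 \<le> h x" "\<And>x. H x < top_class.top"
  shows "log_concave_fn (\<lambda>x. ennreal (h (lin_form Q c x)) * H x)"
  unfolding log_concave_fn_def
proof (intro allI impI)
  fix x y :: "nat \<Rightarrow> real" and l a b :: real
  define z where "z = (\<lambda>i. (1 - l) * x i + l * y i)"
  define u v where "u = h (lin_form Q c x)" and "v = h (lin_form Q c y)"
  define f g where "f = enn2real (H x)" and "g = enn2real (H y)"
  assume l: "0 < l" "l < 1" and ab: "0 \<le> a" "0 \<le> b"
  have uv: "0 \<le> u" "0 \<le> v" using assms(3) by (simp_all add: u_def v_def)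
  have fg: "0 \<le> f" "0 \<le> g" "H x = ennreal f" "H y = ennreal g" using assms(4) by (simp_all add: f_def g_def)
  assume "ennreal a \<le> ennreal (h (lin_form Q c x)) * H x" "ennreal b \<le> ennreal (h (lin_form Q c y)) * H y"
  then have *: "a \<le> u * f" "b \<le> v * g"
    unfolding u_def[symmetric] v_def[symmetric] fg using uv fg(1,2) by (simp_all flip: ennreal_mult)
  have "a powr (1 - l) * b powr l \<le> (u * f) powr (1 - l) * (v * g) powr l"
    using * l ab by (intro mult_mono powr_mono2) auto
  also have "\<dots> = (u powr (1 - l) * v powr l) * (f powr (1 - l) * g powr l)"
    using uv fg by (simp add: powr_mult)
  finally have "ennreal (a powr (1 - l) * b powr l)
     \<le> ennreal ((u powr (1 - l) * v powr l) * (f powr (1 - l) * g powr l))" by (rule ennreal_leI)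
  also have "\<dots> = ennreal (u powr (1 - l) * v powr l) * ennreal (f powr (1 - l) * g powr l)"
    by (simp add: ennreal_mult)
  also have "\<dots> \<le> ennreal (h (lin_form Q c z)) * H z"
  proof (rule mult_mono)
    show "ennreal (u powr (1 - l) * v powr l) \<le> ennreal (h (lin_form Q c z))"
      using assms(2) l unfolding z_def lin_form_convex u_def v_def log_concave_real_def by (intro ennreal_leI) blast
    show "ennreal (f powr (1 - l) * g powr l) \<le> H z"
      unfolding z_def by (rule log_concave_fnD[OF assms(1) l]) (simp_all add: fg)
  qed auto
  finally show "ennreal (a powr (1 - l) * b powr l)
     \<le> ennreal (h (lin_form Q c (\<lambda>i. (1 - l) * x i + l * y i))) * H (\<lambda>i. (1 - l) * x i + l * y i)"
    unfolding z_def .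
qed

text \<open>Each integration keeps the hypotheses alive: the bound grows by the length
  \<open>2 * r\<close> of the interval, and the support condition on the remaining coordinates
  survives because these are not changed.\<close>

lemma log_concave_fn_iter_int:
  assumes "log_concave_fn H" "H \<in> borel_measurable vec_borel" "distinct ps" "0 \<le> r"
    and "\<And>x. H x \<le> ennreal b" "\<And>x q. q \<in> set ps \<Longrightarrow> H x \<noteq> 0 \<Longrightarrow> \<bar>x q\<bar> \<le> r"
  shows "log_concave_fn (iter_int lborel ps H)"
  using assms
proof (induction ps arbitrary: H b)
  case (Cons p ps)
  have supp: "\<bar>x p\<bar> \<le> r" if "H x \<noteq> 0" for x using Cons.prems(6)[of p x] that by simp
  have "log_concave_fn (iter_int lborel ps (marginal lborel p H))"
  proof (rule Cons.IH[where b = "max 0 b * (2 * r)"])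
    show "log_concave_fn (marginal lborel p H)"
      by (rule log_concave_fn_marginal[OF Cons.prems(1,2,5) supp])
    show "marginal lborel p H \<in> borel_measurable vec_borel"
      using Cons.prems(2) by (intro marginal_measurable lborel.sigma_finite_measure_axioms) auto
    fix x
    have "marginal lborel p H x \<le> (\<integral>\<^sup>+t. ennreal (max 0 b) * indicator {-r..r} t \<partial>lborel)"
      unfolding marginal_def
    proof (rule nn_integral_mono)
      fix t show "H (x(p := t)) \<le> ennreal (max 0 b) * indicator {-r..r} t"
      proof (cases "H (x(p := t)) = 0")
        case False
        then have "t \<in> {-r..r}" using supp[of "x(p := t)"] by auto
        moreover have "H (x(p := t)) \<le> ennreal (max 0 b)"
          by (rule order.trans[OF Cons.prems(5)]) (simp only: ennreal_leI max.cobounded2)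
        ultimately show ?thesis by simp
      qed simp
    qed
    also have "\<dots> = ennreal (max 0 b) * emeasure lborel {-r..r}" by (simp add: nn_integral_cmult)
    also have "\<dots> = ennreal (max 0 b * (2 * r))" using Cons.prems(4) by (simp add: ennreal_mult)
    finally show "marginal lborel p H x \<le> ennreal (max 0 b * (2 * r))" .
    show "\<bar>x q\<bar> \<le> r" if q: "q \<in> set ps" and nz: "marginal lborel p H x \<noteq> 0" for q
    proof -
      have "\<exists>t. H (x(p := t)) \<noteq> 0"
      proof (rule ccontr)
        assume "\<not> ?thesis" then have "marginal lborel p H x = 0" unfolding marginal_def by simp
        with nz show False by simp
      qed
      then obtain t where t: "H (x(p := t)) \<noteq> 0" ..
      have "\<bar>(x(p := t)) q\<bar> \<le> r" by (rule Cons.prems(6)[OF _ t]) (use q in simp)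
      moreover have "q \<noteq> p" using q Cons.prems(3) by auto
      ultimately show ?thesis by simp
    qed
  qed (use Cons.prems in auto)
  then show ?case by simp
qed simp

lemma iter_int_even:
  assumes "\<And>x. H (\<lambda>i. - x i) = H x" "H \<in> borel_measurable vec_borel"
  shows "iter_int lborel ps H (\<lambda>i. - x i) = iter_int lborel ps H x"
  using assms
proof (induction ps arbitrary: H)
  case (Cons p ps)
  have "marginal lborel p H (\<lambda>i. - x i) = marginal lborel p H x" for x
  proof -
    have "marginal lborel p H (\<lambda>i. - x i) = (\<integral>\<^sup>+t. H ((\<lambda>i. - x i)(p := 0 + (- 1) * t)) \<partial>lborel)"
      unfolding marginal_def
      by (subst nn_integral_real_affine[where c = "- 1" and t = 0])
         (simp_all add: section_measurable Cons.prems(2))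
    also have "\<dots> = (\<integral>\<^sup>+t. H (x(p := t)) \<partial>lborel)"
    proof (rule nn_integral_cong)
      fix t
      have "(\<lambda>i. - x i)(p := 0 + (- 1) * t) = (\<lambda>i. - (x(p := t)) i)" by auto
      then show "H ((\<lambda>i. - x i)(p := 0 + (- 1) * t)) = H (x(p := t))" using Cons.prems(1) by metis
    qed
    finally show ?thesis unfolding marginal_def .
  qed
  then show ?case unfolding iter_int.simps
    using Cons.prems(2) by (intro Cons.IH marginal_measurable lborel.sigma_finite_measure_axioms) auto
qed simp

lemma iter_int_pull_out:
  assumes "p \<notin> set ps" "H \<in> borel_measurable vec_borel"
  shows "iter_int lborel ps (\<lambda>x. g (x p) * H x) = (\<lambda>x. g (x p) * iter_int lborel ps H x)"
  using assms
proof (induction ps arbitrary: H)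
  case (Cons q ps)
  have "marginal lborel q (\<lambda>x. g (x p) * H x) = (\<lambda>x. g (x p) * marginal lborel q H x)"
  proof
    fix x
    show "marginal lborel q (\<lambda>x. g (x p) * H x) x = g (x p) * marginal lborel q H x"
      using Cons.prems unfolding marginal_def by (simp add: nn_integral_cmult section_measurable)
  qed
  moreover have "iter_int lborel ps (\<lambda>x. g (x p) * marginal lborel q H x) = (\<lambda>x. g (x p) * iter_int lborel ps (marginal lborel q H) x)"
    using Cons.prems by (intro Cons.IH marginal_measurable lborel.sigma_finite_measure_axioms) auto
  ultimately show ?case by simp
qed simp

text \<open>The point at \<open>s\<close> is a convex combination of the points at \<open>-t\<close>
  and \<open>t\<close>, where \<open>H\<close> has the same value.\<close>

lemma even_log_concave_decreasing:
  assumes "log_concave_fn H" "\<And>x. H (\<lambda>i. - x i) = H x" "\<bar>s\<bar> \<le> \<bar>t\<bar>"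
  shows "H ((\<lambda>_. 0)(p := t)) \<le> H ((\<lambda>_. 0)(p := s))"
proof -
  have neg: "H ((\<lambda>_. 0)(p := - t)) = H ((\<lambda>_. 0)(p := t))"
  proof -
    have "(\<lambda>_. 0)(p := - t) = (\<lambda>i. - ((\<lambda>_. 0)(p := t)) i)" by auto
    then show ?thesis using assms(2) by metis
  qed
  show ?thesis
  proof (cases "\<bar>s\<bar> = \<bar>t\<bar>")
    case True
    then have "s = t \<or> s = - t" by linarith
    with neg show ?thesis by auto
  next
    case False
    then have st: "\<bar>s\<bar> < \<bar>t\<bar>" using assms(3) by simp
    \<comment> \<open>The solution of \<open>(1 - l) * (- t) + l * t = s\<close>.\<close>
    define l where "l = (1 + s / t) / 2"
    have "\<bar>s / t\<bar> < 1" using st by (simp add: abs_divide divide_less_eq)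
    then have "-1 < s / t" "s / t < 1" by linarith+
    then have l: "0 < l" "l < 1" unfolding l_def by simp_all
    have t: "t \<noteq> 0" using st by auto
    have pt: "(\<lambda>i. (1 - l) * ((\<lambda>_. 0)(p := - t)) i + l * ((\<lambda>_. 0)(p := t)) i) = (\<lambda>_. 0)(p := s)"
      using t by (auto simp: l_def field_simps)
    have "ennreal a \<le> H ((\<lambda>_. 0)(p := s))" if "0 \<le> a" "ennreal a \<le> H ((\<lambda>_. 0)(p := t))" for a
    proof -
      have "ennreal (a powr (1 - l) * a powr l) \<le> H ((\<lambda>_. 0)(p := s))"
        unfolding pt[symmetric] by (rule log_concave_fnD[OF assms(1) l that(1,1)]) (simp_all only: neg that(2))
      moreover have "a powr (1 - l) * a powr l = a" using that(1) by (simp flip: powr_add)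
      ultimately show ?thesis by simp
    qed
    note le = this
    show ?thesis
    proof (cases "H ((\<lambda>_. 0)(p := t))")
      case (real a)
      then show ?thesis using le[of a] by simp
    next
      \<comment> \<open>At an infinite value every real is a lower bound, so a finite value at
        \<open>s\<close> would exceed itself by 1.\<close>
      case top
      show ?thesis
      proof (cases "H ((\<lambda>_. 0)(p := s))")
        case (real c)
        have "ennreal (c + 1) \<le> H ((\<lambda>_. 0)(p := s))" using real(1) top by (intro le) auto
        then have "c + 1 \<le> c" using real by (simp only: ennreal_le_iff)
        then show ?thesis by simp
      qed simp
    qed
  qed
qed

section \<open>Exchanging bumps for Gaussians one factor at a time\<close>

text \<open>What is required of the product of all factors that are not being exchanged, together
  with a cutoff to a box. The class is closed under multiplication by either bump.\<close>

definition peaked_class :: "nat set \<Rightarrow> real \<Rightarrow> ((nat \<Rightarrow> real) \<Rightarrow> ennreal) \<Rightarrow> bool" where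
  "peaked_class Q r H \<longleftrightarrow> log_concave_fn H \<and> H \<in> borel_measurable vec_borel \<and>
     (\<forall>x. H (\<lambda>i. - x i) = H x) \<and> (\<forall>x. H x \<le> 1) \<and> (\<forall>x. \<forall>q\<in>Q. H x \<noteq> 0 \<longrightarrow> \<bar>x q\<bar> \<le> r)"

lemma peaked_class_mult:
  assumes H: "peaked_class Q r H" and h: "log_concave_real h" "\<And>x. 0 \<le> h x" "\<And>x. h x \<le> 1" "\<And>x. h (- x) = h x"
    and [measurable]: "h \<in> borel_measurable borel"
  shows "peaked_class Q r (\<lambda>x. ennreal (h (lin_form P c x)) * H x)"
  unfolding peaked_class_def
proof (intro conjI allI ballI impI)
  note H' = H[unfolded peaked_class_def]
  have fin: "H x < top_class.top" for x using H' by (metis ennreal_one_less_top order.strict_trans1)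
  show "log_concave_fn (\<lambda>x. ennreal (h (lin_form P c x)) * H x)"
    using H' h fin by (intro log_concave_fn_mult) auto
  have [measurable]: "H \<in> borel_measurable vec_borel" using H' by blast
  show "(\<lambda>x. ennreal (h (lin_form P c x)) * H x) \<in> borel_measurable vec_borel" by measurable
  fix x
  show "ennreal (h (lin_form P c (\<lambda>i. - x i))) * H (\<lambda>i. - x i) = ennreal (h (lin_form P c x)) * H x"
    using H' h by (simp add: lin_form_uminus)
  have "ennreal (h (lin_form P c x)) * H x \<le> 1 * 1"
    using H' h(3)[of "lin_form P c x"] by (intro mult_mono) auto
  then show "ennreal (h (lin_form P c x)) * H x \<le> 1" by simp
  fix q assume "q \<in> Q" "ennreal (h (lin_form P c x)) * H x \<noteq> 0"
  then show "\<bar>x q\<bar> \<le> r" using H' by auto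
qed

text \<open>The value of the linear form is taken as a new coordinate in place of a pivot
  \<open>p\<close>. The exchanged factor then depends on this coordinate alone, and integrating the
  weight over the others leaves an even log-concave function of it, which decreases in absolute
  value. The Jacobian is the same for both bumps.\<close>

lemma iter_int_gauss_bump_le_cos_bump:
  assumes K: "peaked_class (set ps) r K" and ps: "distinct ps" and r: "0 \<le> r"
  shows "iter_int lborel ps (\<lambda>x. ennreal (gauss_bump (lin_form (set ps) a x)) * K x) (\<lambda>_. 0)
       \<le> iter_int lborel ps (\<lambda>x. ennreal (cos_bump (lin_form (set ps) a x)) * K x) (\<lambda>_. 0)"
proof (cases "\<forall>q\<in>set ps. a q = 0")
  case True
  then have "lin_form (set ps) a x = 0" for x by (simp add: lin_form_def)
  then show ?thesis by (simp add: gauss_bump_def cos_bump_def)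
next
  case False
  then obtain p where p: "p \<in> set ps" "a p \<noteq> 0" by blast
  note K' = K[unfolded peaked_class_def]
  have Km [measurable]: "K \<in> borel_measurable vec_borel" using K' by blast
  define rest where "rest = remove1 p ps"
  have rest: "p \<notin> set rest" "set rest = set ps - {p}" "distinct rest" using ps by (auto simp: rest_def)
  \<comment> \<open>The inverse change of variables: it solves for coordinate \<open>p\<close> so
    that the form at \<open>T x\<close> has the value \<open>x p\<close>.\<close>
  define T where "T x = x(p := (x p - lin_form (set rest) a x) / a p)" for x
  define K1 where "K1 x = K (T x)" for x
  have Tm [measurable]: "T \<in> measurable vec_borel vec_borel" unfolding T_def[abs_def]
    by (rule measurable_fun_upd_vec_borel) measurable
  have K1m [measurable]: "K1 \<in> borel_measurable vec_borel" unfolding K1_def[abs_def] by measurable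
  have key: "iter_int lborel ps (\<lambda>x. ennreal (h (lin_form (set ps) a x)) * K x) (\<lambda>_. 0)
    = ennreal \<bar>1 / a p\<bar> * (\<integral>\<^sup>+t. ennreal (h t) * iter_int lborel rest K1 ((\<lambda>_. 0)(p := t)) \<partial>lborel)"
    if hm [measurable]: "h \<in> borel_measurable borel" for h
  proof -
    define G where "G x = ennreal (h (x p)) * K1 x" for x
    have Gm [measurable]: "G \<in> borel_measurable vec_borel" unfolding G_def[abs_def] by measurable
    have fm [measurable]: "(\<lambda>x. ennreal (h (lin_form (set ps) a x)) * K x) \<in> borel_measurable vec_borel" by measurable
    let ?H = "\<lambda>x. ennreal (h (lin_form (set ps) a x)) * K x"
    have "marginal lborel p ?H = (\<lambda>x. ennreal \<bar>1 / a p\<bar> * marginal lborel p G x)"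
    proof
      fix x
      define c where "c = lin_form (set rest) a x"
      let ?w = "\<lambda>t. x(p := - c / a p + (1 / a p) * t)"
      have "marginal lborel p ?H x
        = ennreal \<bar>1 / a p\<bar> * (\<integral>\<^sup>+t. ennreal (h (lin_form (set ps) a (?w t))) * K (?w t) \<partial>lborel)"
        unfolding marginal_def
        by (rule nn_integral_real_affine) (use p section_measurable[OF _ fm, of lborel x] in auto)
      also have "(\<integral>\<^sup>+t. ennreal (h (lin_form (set ps) a (?w t))) * K (?w t) \<partial>lborel)
         = marginal lborel p G x"
        unfolding marginal_def
      proof (rule nn_integral_cong)
        fix t
        have "lin_form (set ps) a (?w t) = t"
          using p by (simp add: lin_form_upd c_def rest(2)[symmetric] field_simps)
        moreover have "T (x(p := t)) = ?w t"
          using rest p by (auto simp: T_def lin_form_upd_notin c_def field_simps)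
        ultimately show "ennreal (h (lin_form (set ps) a (?w t))) * K (?w t) = G (x(p := t))"
          by (simp add: G_def K1_def)
      qed
      finally show "marginal lborel p ?H x = ennreal \<bar>1 / a p\<bar> * marginal lborel p G x" .
    qed
    then have "iter_int lborel ps ?H
       = iter_int lborel rest (\<lambda>x. ennreal \<bar>1 / a p\<bar> * marginal lborel p G x)"
      using iter_int_move_to_front[OF lborel.sigma_finite_measure_axioms _ fm p(1) ps] by (simp add: rest_def)
    also have "\<dots> = (\<lambda>x. ennreal \<bar>1 / a p\<bar> * iter_int lborel rest (marginal lborel p G) x)"
      by (intro iter_int_cmult marginal_measurable lborel.sigma_finite_measure_axioms) auto
    also have "iter_int lborel rest (marginal lborel p G) = marginal lborel p (iter_int lborel rest G)"
      by (intro marginal_iter_int[symmetric] lborel.sigma_finite_measure_axioms) (auto simp: rest)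
    also have "iter_int lborel rest G = (\<lambda>x. ennreal (h (x p)) * iter_int lborel rest K1 x)"
      unfolding G_def[abs_def] by (rule iter_int_pull_out[where g = "\<lambda>t. ennreal (h t)"]) (auto simp: rest)
    finally show ?thesis by (simp add: marginal_def)
  qed
  have lcK1: "log_concave_fn K1"
    unfolding log_concave_fn_def
  proof (intro allI impI)
    fix x y :: "nat \<Rightarrow> real" and l u v :: real
    assume *: "0 < l" "l < 1" "0 \<le> u" "0 \<le> v" "ennreal u \<le> K1 x" "ennreal v \<le> K1 y"
    have "T (\<lambda>i. (1 - l) * x i + l * y i) = (\<lambda>i. (1 - l) * T x i + l * T y i)"
    proof
      fix i show "T (\<lambda>i. (1 - l) * x i + l * y i) i = (1 - l) * T x i + l * T y i"
        using p by (cases "i = p") (simp_all add: T_def lin_form_convex, simp add: field_simps)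
    qed
    then show "ennreal (u powr (1 - l) * v powr l) \<le> K1 (\<lambda>i. (1 - l) * x i + l * y i)"
      using log_concave_fnD[of K l u v "T x" "T y"] * K' by (simp add: K1_def)
  qed
  have evK1: "K1 (\<lambda>i. - x i) = K1 x" for x
  proof -
    have "T (\<lambda>i. - x i) = (\<lambda>i. - T x i)" using p by (auto simp: T_def lin_form_uminus field_simps)
    then show ?thesis using K' by (simp add: K1_def)
  qed
  have "log_concave_fn (iter_int lborel rest K1)"
  proof (rule log_concave_fn_iter_int[OF lcK1 K1m rest(3) r, where b = 1])
    show "K1 x \<le> ennreal 1" for x using K' by (simp add: K1_def)
    \<comment> \<open>Only the coordinates in \<open>rest\<close> are integrated, and
      \<open>T\<close> does not move them; no bound on coordinate \<open>p\<close> is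
      claimed.\<close>
    fix x q assume q: "q \<in> set rest" "K1 x \<noteq> 0"
    then have "\<bar>T x q\<bar> \<le> r" using K' rest by (auto simp: K1_def)
    then show "\<bar>x q\<bar> \<le> r" using q rest by (auto simp: T_def)
  qed
  then have dec: "iter_int lborel rest K1 ((\<lambda>_. 0)(p := t)) \<le> iter_int lborel rest K1 ((\<lambda>_. 0)(p := s))"
    if "\<bar>s\<bar> \<le> \<bar>t\<bar>" for s t
    using that iter_int_even[OF evK1 K1m] by (intro even_log_concave_decreasing) auto
  have "(\<lambda>t. iter_int lborel rest K1 ((\<lambda>_. 0)(p := t))) \<in> borel_measurable borel"
    by (intro section_measurable iter_int_measurable lborel.sigma_finite_measure_axioms K1m) auto
  then show ?thesis
    by (simp only: key[OF cos_bump_measurable] key[OF gauss_bump_measurable])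
       (intro mult_left_mono nn_integral_gauss_bump_le_cos_bump dec zero_le)
qed

text \<open>The weight \<open>K\<close> varies in the induction: first the new Gaussian is part of
  the weight while the old factors are exchanged, then the cosine bumps obtained are the weight for
  exchanging the new one.\<close>

lemma iter_int_prod_gauss_bump_le_cos_bump:
  assumes "finite X" and "peaked_class (set ps) r K" and ps: "distinct ps" and r: "0 \<le> r"
  shows "iter_int lborel ps (\<lambda>x. (\<Prod>j\<in>X. ennreal (gauss_bump (lin_form (set ps) (a j) x))) * K x) (\<lambda>_. 0)
       \<le> iter_int lborel ps (\<lambda>x. (\<Prod>j\<in>X. ennreal (cos_bump (lin_form (set ps) (a j) x))) * K x) (\<lambda>_. 0)"
  using assms(1,2)
proof (induction X arbitrary: K rule: finite_induct)
  case (insert i X)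
  let ?g = "\<lambda>j x. ennreal (gauss_bump (lin_form (set ps) (a j) x))"
  let ?c = "\<lambda>j x. ennreal (cos_bump (lin_form (set ps) (a j) x))"
  have K1: "peaked_class (set ps) r (\<lambda>x. ?g i x * K x)"
    by (intro peaked_class_mult insert.prems log_concave_gauss_bump gauss_bump_nonneg gauss_bump_le_1 gauss_bump_even gauss_bump_measurable)
  have K2: "peaked_class (set ps) r (\<lambda>x. (\<Prod>j\<in>X. ?c j x) * K x)"
    using \<open>finite X\<close>
  proof (induction X rule: finite_induct)
    case (insert j X)
    have "peaked_class (set ps) r (\<lambda>x. ?c j x * ((\<Prod>j\<in>X. ?c j x) * K x))"
      by (intro peaked_class_mult insert.IH log_concave_cos_bump cos_bump_nonneg cos_bump_le_1 cos_bump_even cos_bump_measurable)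
    then show ?case using insert.hyps by (simp add: mult.assoc)
  qed (use insert.prems in simp)
  have "iter_int lborel ps (\<lambda>x. (\<Prod>j\<in>insert i X. ?g j x) * K x) (\<lambda>_. 0)
    = iter_int lborel ps (\<lambda>x. (\<Prod>j\<in>X. ?g j x) * (?g i x * K x)) (\<lambda>_. 0)"
    using insert.hyps by (simp add: mult_ac)
  also have "\<dots> \<le> iter_int lborel ps (\<lambda>x. (\<Prod>j\<in>X. ?c j x) * (?g i x * K x)) (\<lambda>_. 0)"
    by (rule insert.IH[OF K1])
  also have "\<dots> = iter_int lborel ps (\<lambda>x. ?g i x * ((\<Prod>j\<in>X. ?c j x) * K x)) (\<lambda>_. 0)"
    by (simp add: mult_ac)
  also have "\<dots> \<le> iter_int lborel ps (\<lambda>x. ?c i x * ((\<Prod>j\<in>X. ?c j x) * K x)) (\<lambda>_. 0)"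
    by (rule iter_int_gauss_bump_le_cos_bump[OF K2 ps r])
  also have "\<dots> = iter_int lborel ps (\<lambda>x. (\<Prod>j\<in>insert i X. ?c j x) * K x) (\<lambda>_. 0)"
    using insert.hyps by (simp add: mult_ac)
  finally show ?case .
qed simp

lemma peaked_class_box:
  assumes "finite Q"
  shows "peaked_class Q r (indicator {x. \<forall>q\<in>Q. \<bar>x q\<bar> \<le> r})"
proof -
  have [measurable]: "{x. \<forall>q\<in>Q. \<bar>x q\<bar> \<le> r} \<in> sets vec_borel"
  proof -
    have "{x \<in> space vec_borel. \<forall>q\<in>Q. \<bar>x q\<bar> \<le> r} \<in> sets vec_borel"
      using assms by (intro sets.sets_Collect_finite_All) measurable
    then show ?thesis by (simp add: space_PiM)
  qed
  have "log_concave_fn (indicator {x. \<forall>q\<in>Q. \<bar>x q\<bar> \<le> r})"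
    unfolding log_concave_fn_def
  proof (intro allI impI)
    fix x y :: "nat \<Rightarrow> real" and l u v :: real
    assume l: "0 < l" "l < 1" and uv: "0 \<le> u" "0 \<le> v" "ennreal u \<le> indicator {x. \<forall>q\<in>Q. \<bar>x q\<bar> \<le> r} x"
      "ennreal v \<le> indicator {x. \<forall>q\<in>Q. \<bar>x q\<bar> \<le> r} y"
    show "ennreal (u powr (1 - l) * v powr l) \<le> indicator {x. \<forall>q\<in>Q. \<bar>x q\<bar> \<le> r} (\<lambda>i. (1 - l) * x i + l * y i)"
    proof (cases "u = 0 \<or> v = 0")
      case False
      have *: "w \<in> S" if "ennreal c \<le> indicator S w" "0 \<le> c" "c \<noteq> 0" for c S and w :: "nat \<Rightarrow> real"
        using that by (cases "w \<in> S") (auto simp: ennreal_le_iff2)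
      have xy: "\<forall>q\<in>Q. \<bar>x q\<bar> \<le> r" "\<forall>q\<in>Q. \<bar>y q\<bar> \<le> r"
        using *[OF uv(3,1)] *[OF uv(4,2)] False by auto
      then have uv1: "u \<le> 1" "v \<le> 1" using uv by auto
      have "\<bar>(1 - l) * x q + l * y q\<bar> \<le> r" if "q \<in> Q" for q
      proof -
        have "\<bar>(1 - l) * x q + l * y q\<bar> \<le> \<bar>(1 - l) * x q\<bar> + \<bar>l * y q\<bar>" by (rule abs_triangle_ineq)
        also have "\<dots> = (1 - l) * \<bar>x q\<bar> + l * \<bar>y q\<bar>" using l by (simp add: abs_mult)
        also have "\<dots> \<le> (1 - l) * r + l * r" using xy that l by (intro add_mono mult_left_mono) auto
        finally show ?thesis by (simp add: algebra_simps)
      qed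
      moreover have "u powr (1 - l) * v powr l \<le> 1"
        using powr_mono2[of "1 - l" u 1] powr_mono2[of l v 1] uv(1,2) uv1 l
        by (intro mult_le_one) simp_all
      ultimately show ?thesis by simp
    qed auto
  qed
  then show ?thesis unfolding peaked_class_def by (auto simp: indicator_def)
qed

text \<open>The comparison requires bounded support, so it is made in growing boxes. Monotone
  convergence removes the box on the Gaussian side; on the other side the indicator is just
  estimated by 1.\<close>

lemma iter_int_prod_gauss_bump_le:
  assumes "finite X" and ps: "distinct ps"
  shows "iter_int lborel ps (\<lambda>x. \<Prod>j\<in>X. ennreal (gauss_bump (lin_form (set ps) (a j) x))) (\<lambda>_. 0)
       \<le> iter_int lborel ps (\<lambda>x. \<Prod>j\<in>X. ennreal (cos_bump (lin_form (set ps) (a j) x))) (\<lambda>_. 0)"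
proof -
  define B :: "nat \<Rightarrow> (nat \<Rightarrow> real) set" where "B n = {x. \<forall>q\<in>set ps. \<bar>x q\<bar> \<le> real n}" for n
  define f where "f x = (\<Prod>j\<in>X. ennreal (gauss_bump (lin_form (set ps) (a j) x)))" for x
  define g where "g x = (\<Prod>j\<in>X. ennreal (cos_bump (lin_form (set ps) (a j) x)))" for x
  have fm: "f \<in> borel_measurable vec_borel" unfolding f_def[abs_def]
    by (rule prod_lin_form_measurable) (rule gauss_bump_measurable)
  have Bm: "(indicator (B n) :: _ \<Rightarrow> ennreal) \<in> borel_measurable vec_borel" for n
    using peaked_class_box[of "set ps" "real n"] unfolding peaked_class_def B_def by blast
  have inc: "incseq (\<lambda>n. f x * indicator (B n) x)" for x
  proof (rule incseq_SucI)
    fix n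
    have "B n \<subseteq> B (Suc n)" by (force simp: B_def)
    then show "f x * indicator (B n) x \<le> f x * indicator (B (Suc n)) x"
      by (intro mult_left_mono) (auto simp: indicator_def)
  qed
  have sup: "(SUP n. f x * indicator (B n) x) = f x" for x
  proof (rule antisym)
    show "(SUP n. f x * indicator (B n) x) \<le> f x" by (intro SUP_least) (auto simp: indicator_def)
    obtain n where "(\<Sum>q\<in>set ps. \<bar>x q\<bar>) \<le> real n" using real_arch_simple by blast
    moreover have "\<bar>x q\<bar> \<le> (\<Sum>q\<in>set ps. \<bar>x q\<bar>)" if "q \<in> set ps" for q
      using that by (intro member_le_sum) auto
    ultimately have "x \<in> B n" unfolding B_def by force
    then have "f x = f x * indicator (B n) x" by simp
    also have "\<dots> \<le> (SUP n. f x * indicator (B n) x)" by (intro SUP_upper) simp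
    finally show "f x \<le> (SUP n. f x * indicator (B n) x)" .
  qed
  have "iter_int lborel ps f (\<lambda>_. 0) = iter_int lborel ps (\<lambda>x. SUP n. f x * indicator (B n) x) (\<lambda>_. 0)"
    by (simp add: sup)
  also have "\<dots> = (SUP n. iter_int lborel ps (\<lambda>x. f x * indicator (B n) x) (\<lambda>_. 0))"
    by (subst iter_int_SUP[OF lborel.sigma_finite_measure_axioms sets_lborel borel_measurable_times_ennreal[OF fm Bm] inc])
       (rule refl)
  also have "\<dots> \<le> iter_int lborel ps g (\<lambda>_. 0)"
  proof (rule SUP_least)
    fix n
    have "iter_int lborel ps (\<lambda>x. f x * indicator (B n) x) (\<lambda>_. 0) \<le> iter_int lborel ps (\<lambda>x. g x * indicator (B n) x) (\<lambda>_. 0)"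
      unfolding f_def g_def B_def
      by (rule iter_int_prod_gauss_bump_le_cos_bump[OF assms(1) peaked_class_box ps, of "real n"]) auto
    also have "\<dots> \<le> iter_int lborel ps g (\<lambda>_. 0)"
      by (rule iter_int_mono) (auto simp: indicator_def)
    finally show "iter_int lborel ps (\<lambda>x. f x * indicator (B n) x) (\<lambda>_. 0) \<le> iter_int lborel ps g (\<lambda>_. 0)" .
  qed
  finally show ?thesis unfolding f_def g_def .
qed

section \<open>Gaussian integrals of quadratic forms\<close>

text \<open>A unipotent block matrix on the left clears the last column. Integrating the last
  variable of a Gaussian performs the same elimination on its quadratic form.\<close>

lemma det_schur_complement:
  fixes M :: "nat \<Rightarrow> nat \<Rightarrow> 'a :: field"
  assumes "M m m \<noteq> 0"
  shows "det (mat (Suc m) (Suc m) (\<lambda>(i, j). M i j))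
     = M m m * det (mat m m (\<lambda>(i, j). M i j - M i m * M m j / M m m))"
proof -
  define c where "c = M m m"
  define A where "A = mat (Suc m) (Suc m) (\<lambda>(i, j). M i j)"
  define A1 where "A1 = mat m m (\<lambda>(i, j). M i j)"
  define A2 where "A2 = mat m 1 (\<lambda>(i, j). M i m)"
  define A3 where "A3 = mat 1 m (\<lambda>(i, j). M m j)"
  define A4 where "A4 = mat 1 1 (\<lambda>(i, j). c)"
  define N where "N = mat m 1 (\<lambda>(i, j). - (M i m / c))"
  define S where "S = mat m m (\<lambda>(i, j). M i j - M i m * M m j / c)"
  have cs: "A1 \<in> carrier_mat m m" "A2 \<in> carrier_mat m 1" "A3 \<in> carrier_mat 1 m" "A4 \<in> carrier_mat 1 1"
    "N \<in> carrier_mat m 1" "S \<in> carrier_mat m m"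
    by (simp_all add: A1_def A2_def A3_def A4_def N_def S_def)
  define L where "L = four_block_mat (1\<^sub>m m) N (0\<^sub>m 1 m) (1\<^sub>m 1)"
  have A: "A = four_block_mat A1 A2 A3 A4"
    by (rule eq_matI) (auto simp: A_def A1_def A2_def A3_def A4_def c_def less_Suc_eq)
  have L: "L \<in> carrier_mat (Suc m) (Suc m)" unfolding L_def using cs by auto
  have Ac: "A \<in> carrier_mat (Suc m) (Suc m)" unfolding A_def by simp
  have detL: "det L = 1"
    unfolding L_def by (subst det_four_block_mat_lower_left_zero[of _ m _ 1]) (use cs in auto)
  have "L * A = four_block_mat (1\<^sub>m m * A1 + N * A3) (1\<^sub>m m * A2 + N * A4) (0\<^sub>m 1 m * A1 + 1\<^sub>m 1 * A3) (0\<^sub>m 1 m * A2 + 1\<^sub>m 1 * A4)"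
    unfolding L_def A by (rule mult_four_block_mat) (use cs in auto)
  also have "1\<^sub>m m * A1 + N * A3 = S"
    by (rule eq_matI) (auto simp: A1_def N_def A3_def S_def scalar_prod_def)
  also have "1\<^sub>m m * A2 + N * A4 = 0\<^sub>m m 1"
    using assms by (intro eq_matI) (auto simp: A2_def N_def A4_def c_def scalar_prod_def)
  also have "0\<^sub>m 1 m * A1 + 1\<^sub>m 1 * A3 = A3" using cs by auto
  also have "0\<^sub>m 1 m * A2 + 1\<^sub>m 1 * A4 = A4" using cs by auto
  finally have "L * A = four_block_mat S (0\<^sub>m m 1) A3 A4" .
  then have "det (L * A) = det S * det A4"
    using det_four_block_mat_upper_right_zero[of S m "0\<^sub>m m 1" 1 A3 A4] cs by simp
  moreover have "det (L * A) = det A" using det_mult[OF L Ac] detL by simp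
  moreover have "det A4 = c" using det_single[of A4] cs by (simp add: A4_def)
  ultimately show ?thesis unfolding A_def S_def c_def by simp
qed

definition quad_form :: "nat \<Rightarrow> (nat \<Rightarrow> nat \<Rightarrow> real) \<Rightarrow> (nat \<Rightarrow> real) \<Rightarrow> real" where
  "quad_form m M x = (\<Sum>p<m. \<Sum>q<m. M p q * x p * x q)"

lemma quad_form_measurable [measurable]: "quad_form m M \<in> borel_measurable vec_borel"
  unfolding quad_form_def[abs_def] by measurable

lemma quad_form_Suc:
  assumes "\<And>p q. p \<le> m \<Longrightarrow> q \<le> m \<Longrightarrow> M p q = M q p"
  shows "quad_form (Suc m) M (x(m := t)) = quad_form m M x + (M m m * t\<^sup>2 + 2 * (\<Sum>p<m. M p m * x p) * t)"
proof -
  have "quad_form (Suc m) M (x(m := t)) = (\<Sum>p<m. (\<Sum>q<m. M p q * x p * x q) + M p m * x p * t)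
      + ((\<Sum>q<m. M m q * t * x q) + M m m * t * t)"
    by (simp add: quad_form_def)
  also have "(\<Sum>q<m. M m q * t * x q) = (\<Sum>p<m. M p m * x p) * t"
    unfolding sum_distrib_right using assms by (intro sum.cong) auto
  also have "(\<Sum>p<m. (\<Sum>q<m. M p q * x p * x q) + M p m * x p * t) = quad_form m M x + (\<Sum>p<m. M p m * x p) * t"
    by (simp add: sum.distrib quad_form_def sum_distrib_right)
  finally show ?thesis unfolding fun_upd_def by (simp add: power2_eq_square algebra_simps)
qed

text \<open>This is what remains of the quadratic form after completing the square in the variable
  \<open>m\<close>.\<close>

lemma quad_form_schur:
  assumes "\<And>p q. p \<le> m \<Longrightarrow> q \<le> m \<Longrightarrow> M p q = M q p"
  shows "quad_form m (\<lambda>i j. M i j - M i m * M m j / M m m) x = quad_form m M x - (\<Sum>p<m. M p m * x p)\<^sup>2 / M m m"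
proof -
  have "(\<Sum>p<m. M p m * x p)\<^sup>2 / M m m = (\<Sum>p<m. \<Sum>q<m. M p m * M m q / M m m * x p * x q)"
    unfolding power2_eq_square sum_product sum_divide_distrib
    using assms by (intro sum.cong refl) (simp add: mult_ac)
  then show ?thesis unfolding quad_form_def by (simp add: sum_subtractf left_diff_distrib)
qed

text \<open>One elimination step yields all three claims: the determinant splits off the pivot
  \<open>c\<close>, the diagonal can only decrease (which gives Hadamard's inequality), and the
  integral splits off \<open>sqrt (pi / c)\<close>. The list is reversed so that the last variable
  goes first.\<close>

lemma gaussian_quad_form:
  fixes M :: "nat \<Rightarrow> nat \<Rightarrow> real"
  assumes "\<And>p q. p < m \<Longrightarrow> q < m \<Longrightarrow> M p q = M q p"
    and "\<And>x. \<exists>q<m. x q \<noteq> 0 \<Longrightarrow> 0 < quad_form m M x"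
  shows "0 < det (mat m m (\<lambda>(i, j). M i j)) \<and> det (mat m m (\<lambda>(i, j). M i j)) \<le> (\<Prod>p<m. M p p)
    \<and> iter_int lborel (rev [0..<m]) (\<lambda>x. ennreal (exp (- quad_form m M x)))
      = (\<lambda>_. ennreal (sqrt (pi ^ m / det (mat m m (\<lambda>(i, j). M i j)))))"
  using assms
proof (induction m arbitrary: M)
  case 0
  have "det (mat 0 0 (\<lambda>(i, j). M i j)) = 1" by (rule det_dim_zero) simp
  then show ?case by (simp add: quad_form_def)
next
  case (Suc m)
  define c where "c = M m m"
  define v where "v x = (\<Sum>p<m. M p m * x p)" for x
  define N where "N i j = M i j - M i m * M m j / M m m" for i j
  have sym: "M p q = M q p" if "p \<le> m" "q \<le> m" for p q using Suc.prems(1) that by simp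
  have qS: "quad_form (Suc m) M (x(m := t)) = quad_form m M x + (M m m * t\<^sup>2 + 2 * (\<Sum>p<m. M p m * x p) * t)" for x t
    by (rule quad_form_Suc) (rule sym)
  have pd: "0 < quad_form m M x + (c * t\<^sup>2 + 2 * v x * t)" if "t \<noteq> 0 \<or> (\<exists>q<m. x q \<noteq> 0)" for x t
  proof -
    have "\<exists>q<Suc m. (x(m := t)) q \<noteq> 0" using that by (auto simp: less_Suc_eq)
    from Suc.prems(2)[OF this] show ?thesis unfolding qS by (simp add: c_def v_def)
  qed
  have c: "0 < c" using pd[of 1 "\<lambda>_. 0"] by (simp add: quad_form_def v_def)
  have qN: "quad_form m N x = quad_form m M x - (v x)\<^sup>2 / c" for x
    unfolding N_def[abs_def] v_def c_def by (rule quad_form_schur) (rule sym)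
  have IH: "0 < det (mat m m (\<lambda>(i, j). N i j)) \<and> det (mat m m (\<lambda>(i, j). N i j)) \<le> (\<Prod>p<m. N p p)
    \<and> iter_int lborel (rev [0..<m]) (\<lambda>x. ennreal (exp (- quad_form m N x)))
      = (\<lambda>_. ennreal (sqrt (pi ^ m / det (mat m m (\<lambda>(i, j). N i j)))))"
  proof (rule Suc.IH)
    show "N p q = N q p" if "p < m" "q < m" for p q using that sym by (simp add: N_def mult.commute)
    \<comment> \<open>The reduced form is the minimum over the last variable, attained at
      \<open>- v x / c\<close>.\<close>
    show "0 < quad_form m N x" if "\<exists>q<m. x q \<noteq> 0" for x
      using pd[of "- v x / c" x] that c unfolding qN by (simp add: power2_eq_square field_simps)
  qed
  have d: "det (mat (Suc m) (Suc m) (\<lambda>(i, j). M i j)) = c * det (mat m m (\<lambda>(i, j). N i j))"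
    using det_schur_complement[of M m] c unfolding N_def c_def by simp
  have Nd: "0 \<le> N p p" "N p p \<le> M p p" if "p < m" for p
  proof -
    \<comment> \<open>A diagonal entry is the value of the form at a unit vector.\<close>
    have "N p p = quad_form m N (\<lambda>i. if i = p then 1 else 0)"
      using that by (simp add: quad_form_def if_distrib[of "\<lambda>z. _ * z"] sum.delta cong: if_cong)
    moreover have "0 < quad_form m N (\<lambda>i. if i = p then 1 else 0)"
      using pd[of "- v (\<lambda>i. if i = p then 1 else 0) / c" "\<lambda>i. if i = p then 1 else 0"] that c unfolding qN
      by (force simp: power2_eq_square field_simps)
    ultimately show "0 \<le> N p p" by simp
    show "N p p \<le> M p p" using c sym[of p m] that by (simp add: N_def c_def)
  qed
  have "(\<Prod>p<m. N p p) \<le> (\<Prod>p<m. M p p)"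
    by (rule prod_mono) (use Nd in auto)
  with IH have "det (mat m m (\<lambda>(i, j). N i j)) \<le> (\<Prod>p<m. M p p)" by linarith
  then have "c * det (mat m m (\<lambda>(i, j). N i j)) \<le> c * (\<Prod>p<m. M p p)"
    using c by (intro mult_left_mono) auto
  then have had: "det (mat (Suc m) (Suc m) (\<lambda>(i, j). M i j)) \<le> (\<Prod>p<Suc m. M p p)"
    unfolding d by (simp add: c_def mult.commute)
  have "marginal lborel m (\<lambda>x. ennreal (exp (- quad_form (Suc m) M x)))
      = (\<lambda>x. ennreal (sqrt (pi / c)) * ennreal (exp (- quad_form m N x)))"
  proof
    fix x
    have "marginal lborel m (\<lambda>x. ennreal (exp (- quad_form (Suc m) M x))) x
       = (\<integral>\<^sup>+t. ennreal (exp (- quad_form m M x)) * ennreal (exp (- (c * t\<^sup>2 + 2 * v x * t))) \<partial>lborel)"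
      unfolding marginal_def qS v_def[symmetric] c_def[symmetric] minus_add_distrib exp_add
      by (simp add: ennreal_mult)
    also have "\<dots> = ennreal (exp (- quad_form m M x)) * ennreal (sqrt (pi / c) * exp ((v x)\<^sup>2 / c))"
      unfolding nn_integral_gaussian[OF c, symmetric] by (rule nn_integral_cmult) simp
    also have "\<dots> = ennreal (sqrt (pi / c)) * ennreal (exp (- quad_form m N x))"
    proof -
      have "exp (- quad_form m M x) * (sqrt (pi / c) * exp ((v x)\<^sup>2 / c)) = sqrt (pi / c) * exp (- quad_form m N x)"
        unfolding qN minus_diff_eq exp_diff by (simp add: exp_minus field_simps)
      then show ?thesis using c by (simp only: ennreal_mult[symmetric] exp_ge_zero real_sqrt_ge_zero divide_nonneg_pos pi_ge_zero mult_nonneg_nonneg)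
    qed
    finally show "marginal lborel m (\<lambda>x. ennreal (exp (- quad_form (Suc m) M x))) x
       = ennreal (sqrt (pi / c)) * ennreal (exp (- quad_form m N x))" .
  qed
  then have "iter_int lborel (rev [0..<Suc m]) (\<lambda>x. ennreal (exp (- quad_form (Suc m) M x)))
     = iter_int lborel (rev [0..<m]) (\<lambda>x. ennreal (sqrt (pi / c)) * ennreal (exp (- quad_form m N x)))" by simp
  also have "\<dots> = (\<lambda>x. ennreal (sqrt (pi / c)) * ennreal (sqrt (pi ^ m / det (mat m m (\<lambda>(i, j). N i j)))))"
    using IH by (subst iter_int_cmult) (auto intro: lborel.sigma_finite_measure_axioms)
  also have "\<dots> = (\<lambda>x. ennreal (sqrt (pi ^ Suc m / det (mat (Suc m) (Suc m) (\<lambda>(i, j). M i j)))))"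
    unfolding d using c IH by (simp add: ennreal_mult[symmetric] real_sqrt_mult[symmetric])
  finally show ?case using had d c IH by (simp del: mult_pos_pos add: mult_pos_pos)
qed

text \<open>The exponents add up to the quadratic form of \<open>4 * pi\<close> times the Gram
  matrix, and \<open>full\<close> makes it positive definite. The powers of \<pi> cancel and
  \<open>4 ^ m\<close> leaves \<open>2 ^ m\<close> under the root.\<close>

lemma iter_int_prod_gauss_bump:
  fixes a :: "nat \<Rightarrow> nat \<Rightarrow> real"
  assumes "finite X" and G: "G = mat m m (\<lambda>(p, q). \<Sum>j\<in>X. a j p * a j q)"
    and full: "\<And>x. \<exists>q<m. x q \<noteq> 0 \<Longrightarrow> \<exists>j\<in>X. lin_form {..<m} (a j) x \<noteq> 0"
  shows "0 < det G" "det G \<le> (\<Prod>p<m. \<Sum>j\<in>X. (a j p)\<^sup>2)"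
    "iter_int lborel (rev [0..<m]) (\<lambda>x. \<Prod>j\<in>X. ennreal (gauss_bump (lin_form {..<m} (a j) x))) (\<lambda>_. 0)
       = ennreal (1 / (2 ^ m * sqrt (det G)))"
proof -
  define H where "H p q = (\<Sum>j\<in>X. a j p * a j q)" for p q
  have qf: "quad_form m H x = (\<Sum>j\<in>X. (lin_form {..<m} (a j) x)\<^sup>2)" for x
  proof -
    have "quad_form m H x = (\<Sum>p<m. \<Sum>q<m. \<Sum>j\<in>X. a j p * a j q * x p * x q)"
      by (simp add: quad_form_def H_def sum_distrib_right)
    also have "\<dots> = (\<Sum>p<m. \<Sum>j\<in>X. \<Sum>q<m. a j p * a j q * x p * x q)"
      by (intro sum.cong refl sum.swap)
    also have "\<dots> = (\<Sum>j\<in>X. \<Sum>p<m. \<Sum>q<m. a j p * a j q * x p * x q)" by (rule sum.swap)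
    also have "\<dots> = (\<Sum>j\<in>X. (lin_form {..<m} (a j) x)\<^sup>2)"
      by (intro sum.cong refl) (simp add: lin_form_def power2_eq_square sum_product mult_ac)
    finally show ?thesis .
  qed
  define M where "M p q = 4 * pi * H p q" for p q
  have qM: "quad_form m M x = 4 * pi * quad_form m H x" for x
    by (simp add: quad_form_def M_def sum_distrib_left mult.assoc)
  have pdH: "0 < quad_form m H x" if nz: "\<exists>q<m. x q \<noteq> 0" for x
  proof -
    obtain j where "j \<in> X" "lin_form {..<m} (a j) x \<noteq> 0" using full[OF nz] by blast
    then show ?thesis unfolding qf using assms(1) by (intro sum_pos2[of X j]) auto
  qed
  have symH: "H p q = H q p" for p q by (simp add: H_def mult.commute)
  have G': "G = mat m m (\<lambda>(i, j). H i j)" using G by (simp add: H_def)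
  have "H p p = (\<Sum>j\<in>X. (a j p)\<^sup>2)" for p by (simp add: H_def power2_eq_square)
  then show d: "0 < det G" "det G \<le> (\<Prod>p<m. \<Sum>j\<in>X. (a j p)\<^sup>2)"
    using gaussian_quad_form[of m H, OF symH pdH] unfolding G' by simp_all
  have "mat m m (\<lambda>(i, j). M i j) = (4 * pi) \<cdot>\<^sub>m G" unfolding G' by (rule eq_matI) (auto simp: M_def)
  then have dM: "det (mat m m (\<lambda>(i, j). M i j)) = (4 * pi) ^ m * det G" by (simp add: G')
  have A: "iter_int lborel (rev [0..<m]) (\<lambda>x. ennreal (exp (- quad_form m M x))) = (\<lambda>_. ennreal (sqrt (pi ^ m / ((4 * pi) ^ m * det G))))"
  proof -
    have "M p q = M q p" for p q by (simp add: M_def symH)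
    moreover have "0 < quad_form m M x" if "\<exists>q<m. x q \<noteq> 0" for x using pdH[OF that] by (simp add: qM)
    ultimately show ?thesis using gaussian_quad_form[of m M] unfolding dM[symmetric] by simp
  qed
  have B: "(\<Prod>j\<in>X. ennreal (gauss_bump (lin_form {..<m} (a j) x))) = ennreal (exp (- quad_form m M x))" for x
  proof -
    have "(\<Prod>j\<in>X. exp (- (4 * pi * (lin_form {..<m} (a j) x)\<^sup>2))) = exp (\<Sum>j\<in>X. - (4 * pi * (lin_form {..<m} (a j) x)\<^sup>2))"
      by (rule exp_sum[OF assms(1), symmetric])
    then show ?thesis unfolding qM qf gauss_bump_def by (simp add: prod_ennreal sum_distrib_left sum_negf)
  qed
  have C: "sqrt (pi ^ m / ((4 * pi) ^ m * det G)) = 1 / (2 ^ m * sqrt (det G))"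
  proof -
    define k :: real where "k = 2 ^ m"
    have k0: "0 < k" by (simp add: k_def)
    have "(4 :: real) ^ m = (2 * 2) ^ m" by simp
    also have "\<dots> = k\<^sup>2" unfolding k_def power2_eq_square by (rule power_mult_distrib)
    finally have k: "(4 :: real) ^ m = k\<^sup>2" .
    have "pi ^ m / ((4 * pi) ^ m * det G) = 1 / (k\<^sup>2 * det G)"
      unfolding power_mult_distrib k by simp
    then have "sqrt (pi ^ m / ((4 * pi) ^ m * det G)) = 1 / (sqrt (k\<^sup>2) * sqrt (det G))"
      by (simp only: real_sqrt_divide real_sqrt_mult real_sqrt_one)
    also have "sqrt (k\<^sup>2) = k" using k0 by (simp only: real_sqrt_abs abs_of_pos)
    finally show ?thesis unfolding k_def .
  qed
  show "iter_int lborel (rev [0..<m]) (\<lambda>x. \<Prod>j\<in>X. ennreal (gauss_bump (lin_form {..<m} (a j) x))) (\<lambda>_. 0)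
       = ennreal (1 / (2 ^ m * sqrt (det G)))"
    unfolding B A C ..
qed

section \<open>Lattice translates and trigonometric polynomials\<close>

text \<open>A density on the whole line, so that it fits \<open>iter_int\<close>; the half-open
  interval contains exactly one representative of each class modulo 1.\<close>

definition unit_lborel :: "real measure" where
  "unit_lborel = density lborel (indicator {0..<1})"

lemma sets_unit_lborel [simp]: "sets unit_lborel = sets borel"
  by (simp add: unit_lborel_def)

lemma sigma_finite_unit_lborel: "sigma_finite_measure unit_lborel"
proof -
  have "emeasure unit_lborel (space unit_lborel) \<noteq> \<infinity>"
    by (simp add: unit_lborel_def emeasure_density)
  then interpret finite_measure unit_lborel by (rule finite_measureI)
  show ?thesis by (rule sigma_finite_measure_axioms)
qed

text \<open>Periodisation in one coordinate; \<open>int_decode\<close> enumerates the integers,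
  which makes it a series over the naturals.\<close>

definition fold_coord :: "nat \<Rightarrow> ((nat \<Rightarrow> real) \<Rightarrow> ennreal) \<Rightarrow> (nat \<Rightarrow> real) \<Rightarrow> ennreal" where
  "fold_coord p H x = (\<Sum>n. H (x(p := x p + of_int (int_decode n))))"

fun fold_coords :: "nat list \<Rightarrow> ((nat \<Rightarrow> real) \<Rightarrow> ennreal) \<Rightarrow> (nat \<Rightarrow> real) \<Rightarrow> ennreal" where
  "fold_coords [] H = H"
| "fold_coords (p # ps) H = fold_coords ps (fold_coord p H)"

lemma fold_coord_measurable:
  assumes "H \<in> borel_measurable vec_borel"
  shows "fold_coord p H \<in> borel_measurable vec_borel"
  unfolding fold_coord_def[abs_def]
proof (rule borel_measurable_suminf_order)
  fix n
  have "(\<lambda>x. x p + of_int (int_decode n)) \<in> borel_measurable vec_borel" by measurable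
  then show "(\<lambda>x. H (x(p := x p + of_int (int_decode n)))) \<in> borel_measurable vec_borel"
    by (intro measurable_compose[OF measurable_fun_upd_vec_borel assms]) auto
qed

lemma fold_coords_measurable:
  "H \<in> borel_measurable vec_borel \<Longrightarrow> fold_coords ps H \<in> borel_measurable vec_borel"
  by (induction ps arbitrary: H) (auto intro: fold_coord_measurable)

text \<open>The line is cut into the unit intervals \<open>I n\<close>, and each piece is translated
  back to the interval from 0 to 1.\<close>

lemma marginal_fold:
  assumes H: "H \<in> borel_measurable vec_borel"
  shows "marginal lborel p H = marginal unit_lborel p (fold_coord p H)"
proof
  fix x
  define f where "f t = H (x(p := t))" for t
  have fm [measurable]: "f \<in> borel_measurable borel" unfolding f_def by (intro section_measurable H) simp
  have fs: "(\<lambda>t. f (t + c)) \<in> borel_measurable borel" for c by (rule measurable_compose[OF _ fm]) simp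
  define I where "I n = {of_int (int_decode n)..<of_int (int_decode n) + 1 :: real}" for n
  have dis: "disjoint_family I"
    unfolding disjoint_family_on_def
  proof (intro ballI impI)
    fix n k :: nat assume "n \<noteq> k"
    then have "int_decode n \<noteq> int_decode k" by (metis int_decode_inverse)
    moreover have "int_decode n = int_decode k" if "t \<in> I n" "t \<in> I k" for t
    proof -
      have "\<lfloor>t\<rfloor> = int_decode n" "\<lfloor>t\<rfloor> = int_decode k" using that unfolding I_def by (auto intro!: floor_unique)
      then show ?thesis by simp
    qed
    ultimately show "I n \<inter> I k = {}" by blast
  qed
  have one: "f t = (\<Sum>n. f t * indicator (I n) t)" for t
  proof -
    have "t \<in> I (int_encode \<lfloor>t\<rfloor>)" unfolding I_def by simp
    from suminf_cmult_indicator[OF dis this, of "\<lambda>_. f t"] show ?thesis by simp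
  qed
  have "marginal lborel p H x = (\<integral>\<^sup>+t. (\<Sum>n. f t * indicator (I n) t) \<partial>lborel)"
    unfolding marginal_def using one by (intro nn_integral_cong) (simp add: f_def)
  also have "\<dots> = (\<Sum>n. \<integral>\<^sup>+t. f t * indicator (I n) t \<partial>lborel)"
    by (rule nn_integral_suminf) (auto simp: I_def)
  also have "\<dots> = (\<Sum>n. \<integral>\<^sup>+t. f (of_int (int_decode n) + 1 * t) * indicator (I n) (of_int (int_decode n) + 1 * t) \<partial>lborel)"
  proof (rule suminf_cong)
    fix n
    have "(\<lambda>t. f t * indicator (I n) t) \<in> borel_measurable borel" by (simp add: I_def)
    from nn_integral_real_affine[OF this, of 1 "of_int (int_decode n)"]
    show "(\<integral>\<^sup>+t. f t * indicator (I n) t \<partial>lborel)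
       = (\<integral>\<^sup>+t. f (of_int (int_decode n) + 1 * t) * indicator (I n) (of_int (int_decode n) + 1 * t) \<partial>lborel)" by simp
  qed
  also have "\<dots> = (\<Sum>n. \<integral>\<^sup>+t. indicator {0..<1} t * f (t + of_int (int_decode n)) \<partial>lborel)"
    by (intro suminf_cong nn_integral_cong) (auto simp: I_def indicator_def add.commute)
  also have "\<dots> = (\<integral>\<^sup>+t. (\<Sum>n. indicator {0..<1} t * f (t + of_int (int_decode n))) \<partial>lborel)"
    by (rule nn_integral_suminf[symmetric]) (use fs in simp)
  also have "\<dots> = (\<integral>\<^sup>+t. indicator {0..<1} t * (\<Sum>n. f (t + of_int (int_decode n))) \<partial>lborel)"
    by (simp add: ennreal_suminf_cmult)
  also have "\<dots> = (\<integral>\<^sup>+t. (\<Sum>n. f (t + of_int (int_decode n))) \<partial>unit_lborel)"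
    unfolding unit_lborel_def by (rule nn_integral_density[symmetric]) (use fs in auto)
  also have "\<dots> = marginal unit_lborel p (fold_coord p H) x"
    by (simp add: marginal_def fold_coord_def f_def)
  finally show "marginal lborel p H x = marginal unit_lborel p (fold_coord p H) x" .
qed

lemma iter_int_fold:
  assumes "distinct ps" "H \<in> borel_measurable vec_borel"
  shows "iter_int lborel ps H = iter_int unit_lborel ps (fold_coords ps H)"
  using assms
proof (induction ps arbitrary: H)
  case (Cons p ps)
  note sf = lborel.sigma_finite_measure_axioms sigma_finite_unit_lborel
  have m: "fold_coord p H \<in> borel_measurable vec_borel" by (intro fold_coord_measurable Cons.prems)
  have "iter_int lborel (p # ps) H = iter_int lborel ps (marginal unit_lborel p (fold_coord p H))"
    using marginal_fold[OF Cons.prems(2)] by simp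
  also have "\<dots> = marginal unit_lborel p (iter_int lborel ps (fold_coord p H))"
    using Cons.prems m by (intro marginal_iter_int[symmetric] sf) auto
  also have "iter_int lborel ps (fold_coord p H) = iter_int unit_lborel ps (fold_coords ps (fold_coord p H))"
    using Cons.prems m by (intro Cons.IH) auto
  also have "marginal unit_lborel p \<dots> = iter_int unit_lborel ps (marginal unit_lborel p (fold_coords ps (fold_coord p H)))"
    using Cons.prems m by (intro marginal_iter_int sf fold_coords_measurable) auto
  finally show ?case by simp
qed simp

lemma suminf_le_if_unique_nonzero:
  fixes g :: "nat \<Rightarrow> ennreal"
  assumes "\<And>n. g n \<le> c" "\<And>i j. g i \<noteq> 0 \<Longrightarrow> g j \<noteq> 0 \<Longrightarrow> i = j"
  shows "suminf g \<le> c"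
proof (cases "\<exists>i. g i \<noteq> 0")
  case True
  then obtain i where "g i \<noteq> 0" by blast
  then have "suminf g = sum g {i}" using assms(2) by (intro suminf_finite) auto
  then show ?thesis using assms(1) by simp
next
  case False
  then have "g = (\<lambda>_. 0)" by auto
  then show ?thesis by simp
qed

text \<open>If at most one integer translate of \<open>x\<close> is seen by \<open>H\<close>, the
  iterated series has at most one nonzero term. The condition that \<open>k\<close> vanishes off
  \<open>ps\<close> makes \<open>k\<close> determined by its translate and passes through the
  induction.\<close>

lemma fold_coords_le:
  fixes x :: "nat \<Rightarrow> real"
  assumes "distinct ps"
    and "\<And>k :: nat \<Rightarrow> int. (\<And>i. i \<notin> set ps \<Longrightarrow> k i = 0) \<Longrightarrow> H (\<lambda>i. x i + of_int (k i)) \<le> c"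
    and "\<And>k l :: nat \<Rightarrow> int. (\<And>i. i \<notin> set ps \<Longrightarrow> k i = 0) \<Longrightarrow> (\<And>i. i \<notin> set ps \<Longrightarrow> l i = 0) \<Longrightarrow>
       H (\<lambda>i. x i + of_int (k i)) \<noteq> 0 \<Longrightarrow> H (\<lambda>i. x i + of_int (l i)) \<noteq> 0 \<Longrightarrow> k = l"
  shows "fold_coords ps H x \<le> c"
  using assms
proof (induction ps arbitrary: H)
  case Nil
  from Nil(2)[of "\<lambda>_. 0"] show ?case by simp
next
  case (Cons p ps)
  have fc: "fold_coord p H (\<lambda>i. x i + of_int (k i)) = (\<Sum>n. H (\<lambda>i. x i + of_int ((k(p := int_decode n)) i)))"
    if "\<forall>i. i \<notin> set ps \<longrightarrow> k i = 0" for k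
  proof -
    have "k p = 0" using that Cons.prems(1) by simp
    then have "(\<lambda>i. x i + of_int (k i))(p := x p + of_int (k p) + of_int (int_decode n)) = (\<lambda>i. x i + of_int ((k(p := int_decode n)) i))" for n
      by auto
    then show ?thesis by (simp add: fold_coord_def)
  qed
  have sup: "(k(p := a)) i = 0" if "\<forall>i. i \<notin> set ps \<longrightarrow> k i = 0" "i \<notin> set (p # ps)" for k :: "nat \<Rightarrow> int" and i a
    using that by simp
  have "fold_coords ps (fold_coord p H) x \<le> c"
  proof (rule Cons.IH)
    show "distinct ps" using Cons.prems(1) by simp
    fix k :: "nat \<Rightarrow> int" assume "\<And>i. i \<notin> set ps \<Longrightarrow> k i = 0"
    then have k: "\<forall>i. i \<notin> set ps \<longrightarrow> k i = 0" by blast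
    show "fold_coord p H (\<lambda>i. x i + of_int (k i)) \<le> c"
    unfolding fc[of k, OF k]
    proof (rule suminf_le_if_unique_nonzero)
      show "H (\<lambda>i. x i + of_int ((k(p := int_decode n)) i)) \<le> c" for n
        by (rule Cons.prems(2)) (erule sup[OF k])
      fix n n' assume "H (\<lambda>i. x i + of_int ((k(p := int_decode n)) i)) \<noteq> 0" "H (\<lambda>i. x i + of_int ((k(p := int_decode n')) i)) \<noteq> 0"
      then have "k(p := int_decode n) = k(p := int_decode n')"
        by (intro Cons.prems(3)[of "k(p := int_decode n)" "k(p := int_decode n')"] sup[OF k])
      then have "int_decode n = int_decode n'" by (metis fun_upd_same)
      then show "n = n'" by (metis int_decode_inverse)
    qed
  next
    fix k l :: "nat \<Rightarrow> int"
    assume "\<And>i. i \<notin> set ps \<Longrightarrow> k i = 0" "\<And>i. i \<notin> set ps \<Longrightarrow> l i = 0"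
      and nz: "fold_coord p H (\<lambda>i. x i + of_int (k i)) \<noteq> 0" "fold_coord p H (\<lambda>i. x i + of_int (l i)) \<noteq> 0"
    then have k: "\<forall>i. i \<notin> set ps \<longrightarrow> k i = 0" and l: "\<forall>i. i \<notin> set ps \<longrightarrow> l i = 0" by blast+
    obtain n where n: "H (\<lambda>i. x i + of_int ((k(p := int_decode n)) i)) \<noteq> 0"
      using nz(1) fc[of k, OF k] by fastforce
    obtain n' where n': "H (\<lambda>i. x i + of_int ((l(p := int_decode n')) i)) \<noteq> 0"
      using nz(2) fc[of l, OF l] by fastforce
    have eq: "k(p := int_decode n) = l(p := int_decode n')"
      by (intro Cons.prems(3)[of "k(p := int_decode n)" "l(p := int_decode n')"] sup[OF k] sup[OF l] n n')
    show "k = l"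
    proof
      fix i show "k i = l i"
        using fun_cong[OF eq, of i] k l Cons.prems(1) by (cases "i = p") auto
    qed
  qed
  then show ?case by simp
qed

section \<open>Integrating nonnegative trigonometric polynomials over a period\<close>

text \<open>A list of weights and integer frequency vectors. Frequencies may repeat, so equal terms
  never have to be collected.\<close>

definition trig_poly :: "nat set \<Rightarrow> (real \<times> (nat \<Rightarrow> int)) list \<Rightarrow> (nat \<Rightarrow> real) \<Rightarrow> real" where
  "trig_poly Q l x = (\<Sum>(w, v)\<leftarrow>l. w * cos (2 * pi * lin_form Q (\<lambda>q. of_int (v q)) x))"

text \<open>Over one period a cosine integrates to zero unless its frequency in coordinate
  \<open>p\<close> vanishes, in which case it is constant there. Nonnegativity of the remaining
  polynomial is inherited, since it is the increment of an antiderivative with nonnegative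
  derivative.\<close>

lemma trig_poly_integral:
  assumes fin: "finite Q" and p: "p \<in> Q" and nn: "\<And>x. 0 \<le> trig_poly Q l x"
  shows "0 \<le> trig_poly Q (filter (\<lambda>(w, v). v p = 0) l) x"
    and "marginal unit_lborel p (\<lambda>x. ennreal (trig_poly Q l x)) x \<le> ennreal (trig_poly Q (filter (\<lambda>(w, v). v p = 0) l) x)"
proof -
  define b where "b v = 2 * pi * lin_form (Q - {p}) (\<lambda>q. of_int (v q)) x" for v :: "nat \<Rightarrow> int"
  \<comment> \<open>Termwise antiderivative; the sine branch has equal values at 0 and 1, the other
    branch grows by \<open>cos (b v)\<close>.\<close>
  define c where "c t v = (if v p = 0 then cos (b v) * t else sin (b v + 2 * pi * of_int (v p) * t) / (2 * pi * of_int (v p)))" for t v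
  define F where "F t = (\<Sum>(w, v)\<leftarrow>l. w * c t v)" for t
  have up: "2 * pi * lin_form Q (\<lambda>q. of_int (v q)) (x(p := t)) = b v + 2 * pi * of_int (v p) * t" for v :: "nat \<Rightarrow> int" and t
    unfolding lin_form_upd[OF fin p] b_def by (simp add: algebra_simps)
  have dF: "(F has_real_derivative trig_poly Q l (x(p := t))) (at t)" for t
    unfolding F_def trig_poly_def up
  proof (induction l)
    case (Cons wv l)
    obtain w v where wv: "wv = (w, v)" by fastforce
    have "((\<lambda>t. w * c t v) has_real_derivative w * cos (b v + 2 * pi * of_int (v p) * t)) (at t)"
      unfolding c_def by (cases "v p = 0") (auto intro!: derivative_eq_intros)
    from DERIV_add[OF this Cons] show ?case by (simp add: wv)
  qed simp
  have per: "sin (b v + 2 * pi * of_int k) = sin (b v)" for v k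
    by (simp only: sin_add sin_int_2pin cos_int_2pin mult_1_right mult_zero_right add_0_right)
  have xp: "x = x(p := x p)" by simp
  have diff: "F 1 - F 0 = trig_poly Q (filter (\<lambda>(w, v). v p = 0) l) x"
    unfolding F_def trig_poly_def
  proof (induction l)
    case (Cons wv l)
    obtain w v where wv: "wv = (w, v)" by fastforce
    have "w * c 1 v - w * c 0 v = (if v p = 0 then w * cos (2 * pi * lin_form Q (\<lambda>q. of_int (v q)) x) else 0)"
      using up[of v "x p"] per[of v "v p"] by (simp add: c_def)
    with Cons show ?case by (cases "v p = 0") (auto simp: wv)
  qed simp
  show "0 \<le> trig_poly Q (filter (\<lambda>(w, v). v p = 0) l) x"
    using DERIV_nonneg_imp_nondecreasing[of 0 1 F] dF nn diff by fastforce
  have "(\<lambda>t. trig_poly Q l (x(p := t))) \<in> borel_measurable borel"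
  proof (rule borel_measurable_continuous_onI)
    show "continuous_on UNIV (\<lambda>t. trig_poly Q l (x(p := t)))"
      unfolding trig_poly_def up by (induction l) (auto intro!: continuous_intros simp: case_prod_beta)
  qed
  note tm = this
  have te: "(\<lambda>t. ennreal (trig_poly Q l (x(p := t)))) \<in> borel_measurable borel"
    by (rule measurable_compose[OF tm]) simp
  have "marginal unit_lborel p (\<lambda>x. ennreal (trig_poly Q l x)) x
      = (\<integral>\<^sup>+t. indicator {0..<1} t * ennreal (trig_poly Q l (x(p := t))) \<partial>lborel)"
    unfolding marginal_def unit_lborel_def by (rule nn_integral_density) (use te in simp_all)
  also have "\<dots> \<le> (\<integral>\<^sup>+t. ennreal (trig_poly Q l (x(p := t))) * indicator {0..1} t \<partial>lborel)"
    by (rule nn_integral_mono) (auto simp: indicator_def)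
  also have "\<dots> = ennreal (F 1 - F 0)"
    by (rule nn_integral_FTC_Icc) (use dF nn tm in auto)
  finally show "marginal unit_lborel p (\<lambda>x. ennreal (trig_poly Q l x)) x \<le> ennreal (trig_poly Q (filter (\<lambda>(w, v). v p = 0) l) x)"
    unfolding diff .
qed

lemma iter_int_trig_poly:
  assumes "finite Q" "set ps \<subseteq> Q" "\<And>x. 0 \<le> trig_poly Q l x"
  shows "iter_int unit_lborel ps (\<lambda>x. ennreal (trig_poly Q l x)) x
    \<le> ennreal (trig_poly Q (filter (\<lambda>(w, v). \<forall>p\<in>set ps. v p = 0) l) x)"
  using assms
proof (induction ps arbitrary: l)
  case (Cons p ps)
  have p: "p \<in> Q" using Cons.prems by simp
  note ti = trig_poly_integral[OF Cons.prems(1) p Cons.prems(3)]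
  have "iter_int unit_lborel (p # ps) (\<lambda>x. ennreal (trig_poly Q l x)) x
    \<le> iter_int unit_lborel ps (\<lambda>x. ennreal (trig_poly Q (filter (\<lambda>(w, v). v p = 0) l) x)) x"
    by (simp, rule iter_int_mono, rule ti(2))
  also have "\<dots> \<le> ennreal (trig_poly Q (filter (\<lambda>(w, v). \<forall>p\<in>set ps. v p = 0) (filter (\<lambda>(w, v). v p = 0) l)) x)"
    using Cons.prems ti(1) by (intro Cons.IH) auto
  also have "filter (\<lambda>(w, v). \<forall>p\<in>set ps. v p = 0) (filter (\<lambda>(w, v). v p = 0) l) = filter (\<lambda>(w, v). \<forall>p\<in>set (p # ps). v p = 0) l"
    by (simp only: filter_filter) (rule filter_cong, auto)
  finally show ?case .
qed (simp add: case_prod_beta)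

text \<open>Repeated use of \<open>(1 + cos a) * cos b = cos b + cos (a + b) / 2 + cos (- a + b) /
  2\<close>. The added terms have a nonzero entry at the new index, so the weight at the zero vector
  remains 1.\<close>

lemma prod_one_plus_cos:
  assumes "finite S"
  obtains l :: "(real \<times> (nat \<Rightarrow> int)) list" where
    "\<And>th :: nat \<Rightarrow> real. (\<Prod>j\<in>S. 1 + cos (th j)) = (\<Sum>(w, y)\<leftarrow>l. w * cos (\<Sum>j\<in>S. of_int (y j) * th j))"
    "\<And>w y. (w, y) \<in> set l \<Longrightarrow> (\<forall>j. y j \<in> {-1, 0, 1}) \<and> (\<forall>j. j \<notin> S \<longrightarrow> y j = 0)"
    "(\<Sum>(w, y)\<leftarrow>filter (\<lambda>(w, y). y = (\<lambda>_. 0)) l. w) = 1"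
  using assms
proof (induction S arbitrary: thesis rule: finite_induct)
  case empty
  show ?case by (rule empty[of "[(1, \<lambda>_. 0)]"]) auto
next
  case (insert i S)
  obtain l :: "(real \<times> (nat \<Rightarrow> int)) list" where
    l1: "\<And>th :: nat \<Rightarrow> real. (\<Prod>j\<in>S. 1 + cos (th j)) = (\<Sum>(w, y)\<leftarrow>l. w * cos (\<Sum>j\<in>S. of_int (y j) * th j))" and
    l2: "\<And>w y. (w, y) \<in> set l \<Longrightarrow> (\<forall>j. y j \<in> {-1, 0, 1}) \<and> (\<forall>j. j \<notin> S \<longrightarrow> y j = 0)" and
    l3: "(\<Sum>(w, y)\<leftarrow>filter (\<lambda>(w, y). y = (\<lambda>_. 0)) l. w) = 1"
    using insert.IH by blast
  define up where "up e = map (\<lambda>(w :: real, y :: nat \<Rightarrow> int). (w / 2, y(i := e))) l" for e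
  show ?case
  proof (rule insert.prems[of "l @ up 1 @ up (-1)"])
    fix th :: "nat \<Rightarrow> real"
    define g where "g y = (\<Sum>j\<in>S. of_int (y j) * th j)" for y :: "nat \<Rightarrow> int"
    have gu: "(\<Sum>j\<in>insert i S. of_int ((y(i := e)) j) * th j) = of_int e * th i + g y" for y e
      using insert.hyps unfolding g_def by (simp, intro sum.cong) auto
    have g0: "(\<Sum>j\<in>insert i S. of_int (y j) * th j) = g y" if "(w, y) \<in> set l" for w y
      using insert.hyps l2[OF that] unfolding g_def by simp
    have A: "(\<Sum>(w, y)\<leftarrow>l. w * cos (\<Sum>j\<in>insert i S. of_int (y j) * th j)) = (\<Sum>(w, y)\<leftarrow>l. w * cos (g y))"
      by (rule arg_cong[where f = sum_list], rule map_cong) (auto simp: g0)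
    have B: "(\<Sum>(w, y)\<leftarrow>up e. w * cos (\<Sum>j\<in>insert i S. of_int (y j) * th j)) = (\<Sum>(w, y)\<leftarrow>l. w / 2 * cos (of_int e * th i + g y))" for e
      unfolding up_def map_map by (rule arg_cong[where f = sum_list], rule map_cong) (auto simp: gu simp del: fun_upd_apply sum.insert)
    have "(\<Prod>j\<in>insert i S. 1 + cos (th j)) = (1 + cos (th i)) * (\<Sum>(w, y)\<leftarrow>l. w * cos (g y))"
      using insert.hyps by (simp add: l1 g_def)
    also have "\<dots> = (\<Sum>(w, y)\<leftarrow>l. w * cos (g y)) + ((\<Sum>(w, y)\<leftarrow>l. w / 2 * cos (of_int 1 * th i + g y)) + (\<Sum>(w, y)\<leftarrow>l. w / 2 * cos (of_int (-1) * th i + g y)))"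
    proof (induction l)
      case (Cons wy l)
      obtain w y where "wy = (w, y)" by fastforce
      with Cons show ?case by (simp add: algebra_simps cos_add cos_diff)
    qed simp
    finally show "(\<Prod>j\<in>insert i S. 1 + cos (th j)) = (\<Sum>(w, y)\<leftarrow>l @ up 1 @ up (-1). w * cos (\<Sum>j\<in>insert i S. of_int (y j) * th j))"
      by (simp only: map_append sum_list_append A B)
  next
    fix w y assume "(w, y) \<in> set (l @ up 1 @ up (-1))"
    then consider "(w, y) \<in> set l" | w' y' e where "(w', y') \<in> set l" "y = y'(i := e)" "e = 1 \<or> e = -1"
      unfolding up_def by auto
    then show "(\<forall>j. y j \<in> {-1, 0, 1}) \<and> (\<forall>j. j \<notin> insert i S \<longrightarrow> y j = 0)"
    proof cases
      case 1
      from l2[OF this] show ?thesis by blast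
    next
      case 2
      from l2[OF 2(1)] 2(2,3) show ?thesis by auto
    qed
  next
    have "filter (\<lambda>(w, y). y = (\<lambda>_. 0)) (up e) = []" if "e \<noteq> 0" for e
    proof -
      have "y(i := e) \<noteq> (\<lambda>_. 0)" for y using that by (metis fun_upd_same)
      then show ?thesis unfolding up_def filter_empty_conv by (simp add: case_prod_beta)
    qed
    then show "(\<Sum>(w, y)\<leftarrow>filter (\<lambda>(w, y). y = (\<lambda>_. 0)) (l @ up 1 @ up (-1)). w) = 1"
      using l3 by simp
  qed
qed

text \<open>After \<open>(cos t)^2 = (1 + cos (2 * t)) / 2\<close> the frequencies are the
  combinations \<open>V y\<close> of the columns with coefficients -1, 0 and 1. By
  \<open>nosol\<close> only \<open>y = 0\<close> has frequency zero, so just the constant term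
  survives the integration.\<close>

lemma iter_int_prod_cos_sq:
  fixes a :: "nat \<Rightarrow> nat \<Rightarrow> int"
  assumes S: "finite S" and ps: "distinct ps"
    and nosol: "\<And>y. (\<And>j. y j \<in> {-1, 0, 1}) \<Longrightarrow> (\<And>j. j \<notin> S \<Longrightarrow> y j = 0) \<Longrightarrow>
       (\<And>q. q \<in> set ps \<Longrightarrow> (\<Sum>j\<in>S. y j * a j q) = 0) \<Longrightarrow> y = (\<lambda>_. 0)"
  shows "iter_int unit_lborel ps (\<lambda>x. ennreal (\<Prod>j\<in>S. (cos (pi * lin_form (set ps) (\<lambda>q. of_int (a j q)) x))\<^sup>2)) x0
    \<le> ennreal (1 / 2 ^ card S)"
proof -
  define L where "L j x = lin_form (set ps) (\<lambda>q. of_int (a j q)) x" for j x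
  obtain l :: "(real \<times> (nat \<Rightarrow> int)) list" where
    l1: "\<And>th :: nat \<Rightarrow> real. (\<Prod>j\<in>S. 1 + cos (th j)) = (\<Sum>(w, y)\<leftarrow>l. w * cos (\<Sum>j\<in>S. of_int (y j) * th j))" and
    l2: "\<And>w y. (w, y) \<in> set l \<Longrightarrow> (\<forall>j. y j \<in> {-1, 0, 1}) \<and> (\<forall>j. j \<notin> S \<longrightarrow> y j = 0)" and
    l3: "(\<Sum>(w, y)\<leftarrow>filter (\<lambda>(w, y). y = (\<lambda>_. 0)) l. w) = 1"
    using prod_one_plus_cos[OF S] by blast
  define V where "V y q = (\<Sum>j\<in>S. y j * a j q)" for y :: "nat \<Rightarrow> int" and q
  define l' where "l' = map (\<lambda>(w, y). (w / 2 ^ card S, V y)) l"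
  have Vlin: "lin_form (set ps) (\<lambda>q. of_int (V y q)) x = (\<Sum>j\<in>S. of_int (y j) * L j x)" for y x
  proof -
    have "lin_form (set ps) (\<lambda>q. of_int (V y q)) x = (\<Sum>q\<in>set ps. \<Sum>j\<in>S. of_int (y j) * (of_int (a j q) * x q))"
      by (simp add: lin_form_def V_def sum_distrib_right mult.assoc)
    also have "\<dots> = (\<Sum>j\<in>S. of_int (y j) * L j x)"
      by (subst sum.swap) (simp add: L_def lin_form_def sum_distrib_left)
    finally show ?thesis .
  qed
  have "(\<Prod>j\<in>S. (cos (pi * L j x))\<^sup>2) = trig_poly (set ps) l' x" for x
  proof -
    have "(\<Prod>j\<in>S. (cos (pi * L j x))\<^sup>2) = (\<Prod>j\<in>S. (1 + cos (2 * pi * L j x)) / 2)"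
    proof (rule prod.cong)
      fix j show "(cos (pi * L j x))\<^sup>2 = (1 + cos (2 * pi * L j x)) / 2"
        using cos_double_cos[of "pi * L j x"] by (simp add: mult.assoc)
    qed simp
    also have "\<dots> = (\<Prod>j\<in>S. 1 + cos (2 * pi * L j x)) / 2 ^ card S" by (simp add: prod_dividef)
    also have "\<dots> = (\<Sum>(w, y)\<leftarrow>l. w * cos (\<Sum>j\<in>S. of_int (y j) * (2 * pi * L j x))) / 2 ^ card S"
      by (simp only: l1)
    also have "\<dots> = (\<Sum>(w, y)\<leftarrow>l. w / 2 ^ card S * cos (2 * pi * (\<Sum>j\<in>S. of_int (y j) * L j x)))"
    proof (induction l)
      case (Cons wy l)
      then show ?case by (cases wy) (simp add: add_divide_distrib sum_distrib_left mult_ac)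
    qed simp
    also have "\<dots> = trig_poly (set ps) l' x"
      unfolding trig_poly_def l'_def map_map by (rule arg_cong[where f = sum_list]) (auto simp: Vlin)
    finally show ?thesis .
  qed
  note tp = this
  have nn: "0 \<le> trig_poly (set ps) l' x" for x unfolding tp[symmetric] by (intro prod_nonneg) auto
  have fe: "filter (\<lambda>(w, v). \<forall>p\<in>set ps. v p = 0) l' = map (\<lambda>(w, y). (w / 2 ^ card S, V y)) (filter (\<lambda>(w, y). y = (\<lambda>_. 0)) l)"
    unfolding l'_def filter_map
  proof (rule arg_cong[where f = "map _"], rule filter_cong)
    fix wy assume wy: "wy \<in> set l"
    obtain w y where e: "wy = (w, y)" by fastforce
    have "y = (\<lambda>_. 0)" if "\<forall>p\<in>set ps. V y p = 0"
      using l2[of w y] wy that unfolding e V_def by (intro nosol) auto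
    then show "((\<lambda>(w, v). \<forall>p\<in>set ps. v p = 0) \<circ> (\<lambda>(w, y). (w / 2 ^ card S, V y))) wy = (case wy of (w, y) \<Rightarrow> y = (\<lambda>_. 0))"
      unfolding e by (auto simp: V_def)
  qed simp
  have ev: "trig_poly (set ps) (map (\<lambda>(w, y). (w / 2 ^ card S, V y)) (filter (\<lambda>(w, y). y = (\<lambda>_. 0)) k)) x0
     = (\<Sum>(w, y)\<leftarrow>filter (\<lambda>(w, y). y = (\<lambda>_. 0)) k. w) / 2 ^ card S" for k
    unfolding trig_poly_def
  proof (induction k)
    case (Cons wy k)
    then show ?case by (cases wy) (auto simp: V_def lin_form_def add_divide_distrib)
  qed simp
  have "iter_int unit_lborel ps (\<lambda>x. ennreal (trig_poly (set ps) l' x)) x0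
     \<le> ennreal (trig_poly (set ps) (filter (\<lambda>(w, v). \<forall>p\<in>set ps. v p = 0) l') x0)"
    by (rule iter_int_trig_poly) (use nn in auto)
  also have "\<dots> = ennreal (1 / 2 ^ card S)" unfolding fe ev l3 ..
  finally show ?thesis unfolding tp[symmetric] L_def .
qed

section \<open>The determinant bound for columns without sign relations\<close>

text \<open>The two sets play different roles: \<open>X\<close> has full rank, which makes the
  determinant positive and the translates distinguishable, and \<open>S\<close> carries the
  hypothesis on sign vectors.\<close>

theorem two_power_card_le_det:
  fixes a :: "nat \<Rightarrow> nat \<Rightarrow> int"
  assumes X: "finite X" and S: "S \<subseteq> X"
    and G: "G = mat m m (\<lambda>(p, q). \<Sum>j\<in>X. real_of_int (a j p) * real_of_int (a j q))"
    and full: "\<And>x. \<exists>q<m. x q \<noteq> 0 \<Longrightarrow> \<exists>j\<in>X. lin_form {..<m} (\<lambda>q. of_int (a j q)) x \<noteq> 0"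
    and nosol: "\<And>y. (\<And>j. y j \<in> {-1, 0, 1}) \<Longrightarrow> (\<And>j. j \<notin> S \<Longrightarrow> y j = 0) \<Longrightarrow>
       (\<And>q. q < m \<Longrightarrow> (\<Sum>j\<in>S. y j * a j q) = 0) \<Longrightarrow> y = (\<lambda>_. 0)"
  shows "2 ^ card S \<le> 2 ^ m * sqrt (det G)" "0 < det G"
    "det G \<le> (\<Prod>p<m. \<Sum>j\<in>X. (real_of_int (a j p))\<^sup>2)"
proof -
  define L where "L j x = lin_form {..<m} (\<lambda>q. of_int (a j q)) x" for j x
  define ps where "ps = rev [0..<m]"
  have ps: "distinct ps" "set ps = {..<m}" by (auto simp: ps_def)
  define H where "H x = (\<Prod>j\<in>X. ennreal (cos_bump (L j x)))" for x
  have Hm: "H \<in> borel_measurable vec_borel"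
    unfolding H_def[abs_def] L_def by (rule prod_lin_form_measurable) (rule cos_bump_measurable)
  note gb = iter_int_prod_gauss_bump[OF X G full]
  show "0 < det G" by (rule gb(1))
  show "det G \<le> (\<Prod>p<m. \<Sum>j\<in>X. (real_of_int (a j p))\<^sup>2)" by (rule gb(2))
  have Lshift: "L j (\<lambda>i. x i + of_int (k i)) = L j x + of_int (\<Sum>q<m. a j q * k q)" for j x k
    by (simp add: L_def lin_form_def sum.distrib algebra_simps)
  have le: "fold_coords ps H x \<le> ennreal (\<Prod>j\<in>S. (cos (pi * L j x))\<^sup>2)" for x
  proof (rule fold_coords_le[OF ps(1)])
    fix k :: "nat \<Rightarrow> int"
    \<comment> \<open>An integer shift changes \<open>cos (pi * t)\<close> at most by a sign, so the
      square does not depend on the translate.\<close>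
    have per: "(cos (pi * (t + of_int z)))\<^sup>2 = (cos (pi * t))\<^sup>2" for t z
    proof -
      have "sin (pi * of_int z) = 0" by (rule sin_npi_int)
      moreover from this have "(cos (pi * of_int z))\<^sup>2 = 1" by (simp add: cos_squared_eq)
      ultimately show ?thesis by (simp add: distrib_left cos_add power_mult_distrib)
    qed
    let ?y = "\<lambda>i. x i + of_int (k i)"
    have "H ?y = ennreal (\<Prod>j\<in>X. cos_bump (L j ?y))"
      unfolding H_def by (rule prod_ennreal) (rule cos_bump_nonneg)
    also have "\<dots> \<le> ennreal (\<Prod>j\<in>S. cos_bump (L j ?y))"
    proof (rule ennreal_leI)
      have "(\<Prod>j\<in>X. cos_bump (L j ?y)) = (\<Prod>j\<in>X - S. cos_bump (L j ?y)) * (\<Prod>j\<in>S. cos_bump (L j ?y))"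
        by (rule prod.subset_diff[OF S X])
      also have "\<dots> \<le> 1 * (\<Prod>j\<in>S. cos_bump (L j ?y))"
        by (intro mult_right_mono prod_le_1 prod_nonneg) (auto simp: cos_bump_nonneg cos_bump_le_1)
      finally show "(\<Prod>j\<in>X. cos_bump (L j ?y)) \<le> (\<Prod>j\<in>S. cos_bump (L j ?y))" by simp
    qed
    also have "\<dots> \<le> ennreal (\<Prod>j\<in>S. (cos (pi * L j ?y))\<^sup>2)"
    proof (intro ennreal_leI prod_mono conjI cos_bump_nonneg)
      fix j show "cos_bump (L j ?y) \<le> (cos (pi * L j ?y))\<^sup>2"
        by (simp add: cos_bump_def)
    qed
    also have "\<dots> = ennreal (\<Prod>j\<in>S. (cos (pi * L j x))\<^sup>2)" by (simp only: Lshift per)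
    finally show "H ?y \<le> ennreal (\<Prod>j\<in>S. (cos (pi * L j x))\<^sup>2)" .
  next
    fix k l :: "nat \<Rightarrow> int"
    assume kl: "\<And>i. i \<notin> set ps \<Longrightarrow> k i = 0" "\<And>i. i \<notin> set ps \<Longrightarrow> l i = 0"
      and nz: "H (\<lambda>i. x i + of_int (k i)) \<noteq> 0" "H (\<lambda>i. x i + of_int (l i)) \<noteq> 0"
    have small: "\<bar>L j y\<bar> < 1/2" if "H y \<noteq> 0" "j \<in> X" for j y
    proof -
      have "cos_bump (L j y) \<noteq> 0" using that X unfolding H_def by auto
      then show ?thesis by (auto simp: cos_bump_def split: if_splits)
    qed
    have z: "L j (\<lambda>q. real_of_int (k q - l q)) = 0" if "j \<in> X" for j
    proof -
      \<comment> \<open>Two points of one coset inside the cut-off region differ by an integer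
        smaller than 1 in every form, hence not at all.\<close>
      define u where "u = (\<Sum>q<m. a j q * k q) - (\<Sum>q<m. a j q * l q)"
      have "real_of_int u = L j (\<lambda>i. x i + of_int (k i)) - L j (\<lambda>i. x i + of_int (l i))"
        unfolding Lshift u_def by simp
      then have "\<bar>real_of_int u\<bar> < 1" using small[OF nz(1) that] small[OF nz(2) that] by linarith
      then have "u = 0" by linarith
      moreover have "L j (\<lambda>q. real_of_int (k q - l q)) = real_of_int u"
        by (simp add: L_def lin_form_def u_def sum_subtractf right_diff_distrib)
      ultimately show ?thesis by simp
    qed
    have "\<not> (\<exists>q<m. real_of_int (k q - l q) \<noteq> 0)"
      using full[of "\<lambda>q. real_of_int (k q - l q)"] z unfolding L_def by blast
    then show "k = l" using kl ps(2) by (intro ext) (metis eq_iff_diff_eq_0 lessThan_iff of_int_eq_0_iff)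
  qed
  have "ennreal (1 / (2 ^ m * sqrt (det G))) = iter_int lborel ps (\<lambda>x. \<Prod>j\<in>X. ennreal (gauss_bump (lin_form {..<m} (\<lambda>q. of_int (a j q)) x))) (\<lambda>_. 0)"
    unfolding ps_def by (rule gb(3)[symmetric])
  also have "\<dots> \<le> iter_int lborel ps H (\<lambda>_. 0)"
    unfolding H_def[abs_def] L_def using iter_int_prod_gauss_bump_le[OF X ps(1), of "\<lambda>j q. of_int (a j q)"] unfolding ps(2) .
  also have "\<dots> = iter_int unit_lborel ps (fold_coords ps H) (\<lambda>_. 0)"
    by (simp add: iter_int_fold[OF ps(1) Hm])
  also have "\<dots> \<le> iter_int unit_lborel ps (\<lambda>x. ennreal (\<Prod>j\<in>S. (cos (pi * L j x))\<^sup>2)) (\<lambda>_. 0)"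
    by (rule iter_int_mono) (rule le)
  also have "\<dots> \<le> ennreal (1 / 2 ^ card S)"
    unfolding L_def ps(2)[symmetric]
    by (rule iter_int_prod_cos_sq[OF finite_subset[OF S X] ps(1)]) (rule nosol, auto simp: ps(2))
  finally have "1 / (2 ^ m * sqrt (det G)) \<le> 1 / 2 ^ card S" by simp
  then show "2 ^ card S \<le> 2 ^ m * sqrt (det G)" using gb(1) by (simp add: divide_simps)
qed

section \<open>Lattice bases and the greatest common divisor of the maximal minors\<close>

text \<open>Indexed by an arbitrary function: columns may be repeated and permuted, as in the
  multilinear expansion of a determinant.\<close>

definition select_cols :: "'a mat \<Rightarrow> (nat \<Rightarrow> nat) \<Rightarrow> 'a mat" where
  "select_cols A k = mat (dim_row A) (dim_row A) (\<lambda>(i, j). A $$ (i, k j))"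

lemma select_cols_carrier [simp]: "A \<in> carrier_mat m n \<Longrightarrow> select_cols A k \<in> carrier_mat m m"
  by (auto simp: select_cols_def)

lemma det_real_of_int: "det (map_mat real_of_int A) = real_of_int (det A)"
  by (rule of_int_hom.hom_det)

lemma full_rank_select_cols:
  fixes A :: "int mat"
  assumes A: "A \<in> carrier_mat m n" and r: "vec_space.rank m (map_mat real_of_int A) = m"
  obtains k where "\<And>j. j < m \<Longrightarrow> k j < n" "det (select_cols A k) \<noteq> 0"
proof -
  interpret vec_space "TYPE(real)" m .
  define R where "R = map_mat real_of_int A"
  have R: "R \<in> carrier_mat m n" using A by (simp add: R_def)
  define P where "P T \<longleftrightarrow> T \<subseteq> set (cols R) \<and> lin_indpt T" for T
  have "P {}" unfolding P_def using dim_zero_vs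
    by (metis card.empty card_0_eq empty_subsetI finite.emptyI finite_basis_exists fin_dim basis_def subset_li_is_li vec_vs)
  obtain U where U: "finite U" "maximal U P"
    using maximal_exists_superset[of "set (cols R)" P "{}"] \<open>P {}\<close> unfolding P_def by auto
  have "rank R = card U"
    using rank_card_indpt[OF R] U(2) unfolding P_def[abs_def] by blast
  then have cU: "card U = m" using r unfolding R_def by simp
  have PU: "U \<subseteq> set (cols R)" "lin_indpt U" using U(2) unfolding maximal_def P_def by auto
  obtain us where us: "set us = U" "distinct us" using finite_distinct_list[OF U(1)] by blast
  have len: "length us = m" using us cU distinct_card by fastforce
  have "\<exists>k<n. us ! j = col R k" if "j < m" for j
  proof -
    have "us ! j \<in> set (cols R)" using PU us len that by (metis nth_mem subsetD)
    then show ?thesis using R by (auto simp: cols_def)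
  qed
  then obtain k where k: "\<And>j. j < m \<Longrightarrow> k j < n" "\<And>j. j < m \<Longrightarrow> us ! j = col R (k j)" by metis
  have usc: "set us \<subseteq> carrier_vec m" using PU us cols_dim[of R] R by auto
  define B where "B = mat_of_cols m us"
  have B: "B \<in> carrier_mat m m" "cols B = us" using usc len by (auto simp: B_def cols_mat_of_cols)
  have "rank B = m" using lin_indpt_full_rank[of B m] B us PU by simp
  then have "det B \<noteq> 0" using det_rank_iff[OF B(1)] by simp
  moreover have "B = map_mat real_of_int (select_cols A k)"
  proof (rule eq_matI)
    fix i j assume "i < dim_row (map_mat real_of_int (select_cols A k))" "j < dim_col (map_mat real_of_int (select_cols A k))"
    then have ij: "i < m" "j < m" using A by (auto simp: select_cols_def)
    then show "B $$ (i, j) = map_mat real_of_int (select_cols A k) $$ (i, j)"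
      using k[of j] A len by (simp add: B_def mat_of_cols_index R_def select_cols_def)
  qed (use A B in \<open>auto simp: select_cols_def\<close>)
  ultimately have "det (select_cols A k) \<noteq> 0" by (simp add: det_real_of_int)
  with k(1) show ?thesis by (rule that)
qed

text \<open>A common zero of all forms would be a left kernel vector of an invertible matrix. This
  provides the nondegeneracy needed for positive definiteness.\<close>

lemma select_cols_full:
  fixes A :: "int mat"
  assumes A: "A \<in> carrier_mat m n" and k: "\<And>j. j < m \<Longrightarrow> k j \<in> X" and d: "det (select_cols A k) \<noteq> 0"
    and x: "\<exists>q<m. x q \<noteq> 0"
  shows "\<exists>j\<in>X. lin_form {..<m} (\<lambda>q. real_of_int (A $$ (q, j))) x \<noteq> 0"
proof (rule ccontr)
  assume "\<not> ?thesis"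
  then have z: "lin_form {..<m} (\<lambda>q. real_of_int (A $$ (q, k j))) x = 0" if "j < m" for j using k that by blast
  define B where "B = transpose_mat (map_mat real_of_int (select_cols A k))"
  have B: "B \<in> carrier_mat m m" using A by (auto simp: B_def select_cols_def)
  have "B *\<^sub>v vec m x = 0\<^sub>v m"
  proof (rule eq_vecI)
    fix i assume "i < dim_vec (0\<^sub>v m :: real vec)"
    then have i: "i < m" by simp
    then have "(B *\<^sub>v vec m x) $ i = (\<Sum>q<m. real_of_int (A $$ (q, k i)) * x q)"
      using A B by (auto simp: B_def select_cols_def scalar_prod_def atLeast0LessThan intro!: sum.cong)
    then show "(B *\<^sub>v vec m x) $ i = 0\<^sub>v m $ i" using z[OF i] i by (simp add: lin_form_def)
  qed (use B in auto)
  moreover have "vec m x \<noteq> 0\<^sub>v m" using x by (metis index_vec index_zero_vec(1))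
  ultimately have "det B = 0" using det_0_iff_vec_prod_zero[OF B] by (metis vec_carrier)
  moreover have "det B = real_of_int (det (select_cols A k))"
    unfolding B_def using A by (subst det_transpose[of _ m]) (auto simp: det_real_of_int select_cols_def)
  ultimately show False using d by simp
qed

text \<open>A repeated column gives determinant zero; otherwise the chosen columns are a permutation
  of those of a maximal minor, and only the sign can change.\<close>

lemma gcd_max_minors_dvd_select_cols:
  assumes A: "A \<in> carrier_mat m n" and k: "\<And>j. j < m \<Longrightarrow> k j < n"
  shows "gcd_max_minors A dvd det (select_cols A k)"
proof (cases "inj_on k {..<m}")
  case False
  then obtain i j where ij: "i < m" "j < m" "i \<noteq> j" "k i = k j" by (auto simp: inj_on_def)
  have "col (select_cols A k) i = col (select_cols A k) j"
    using ij A by (auto simp: select_cols_def)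
  then have "det (select_cols A k) = 0"
    using det_identical_cols[OF select_cols_carrier[OF A] ij(3,1,2)] by blast
  then show ?thesis by simp
next
  case True
  define J where "J = k ` {..<m}"
  have J: "J \<subseteq> {..<n}" "card J = m" using k True by (auto simp: J_def card_image)
  have fJ: "finite J" by (simp add: J_def)
  \<comment> \<open>The position of \<open>k j\<close> in the increasing enumeration of
    \<open>J\<close>, extended by the identity to become a permutation.\<close>
  define p where "p j = (if j < m then card {a \<in> J. a < k j} else j)" for j
  have pk: "pick J (p j) = k j" if "j < m" for j
    using that by (simp add: p_def pick_card_in_set J_def)
  have pm: "p j < m" if "j < m" for j
  proof -
    have "{a \<in> J. a < k j} \<subset> J" using that by (auto simp: J_def)
    then have "card {a \<in> J. a < k j} < card J" by (intro psubset_card_mono fJ)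
    then show ?thesis using that J by (simp add: p_def)
  qed
  have "inj_on p {0..<m}"
  proof (rule inj_onI)
    fix i j assume "i \<in> {0..<m}" "j \<in> {0..<m}" "p i = p j"
    then show "i = j" using pk[of i] pk[of j] True by (auto simp: inj_on_def)
  qed
  moreover have "p ` {0..<m} \<subseteq> {0..<m}" using pm by auto
  ultimately have "bij_betw p {0..<m} {0..<m}" by (simp add: bij_betw_def endo_inj_surj)
  then have perm: "p permutes {0..<m}"
    by (rule bij_imp_permutes) (auto simp: p_def)
  define B where "B = submatrix A UNIV J"
  have cJ: "{j. j < n \<and> j \<in> J} = J" using J by auto
  have B: "B \<in> carrier_mat m m" using A J by (auto simp: B_def dim_submatrix cJ)
  have Bi: "B $$ (i, j) = A $$ (i, pick J j)" if "i < m" "j < m" for i j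
    unfolding B_def using that A J by (subst submatrix_index) (auto simp: cJ pick_UNIV)
  have T: "transpose_mat (select_cols A k) = mat m m (\<lambda>(i, j). transpose_mat B $$ (p i, j))"
    using A B pm by (intro eq_matI) (auto simp: select_cols_def Bi pk)
  have "det (select_cols A k) = det (transpose_mat (select_cols A k))"
    using det_transpose[OF select_cols_carrier[OF A]] by simp
  also have "\<dots> = signof p * det (transpose_mat B)"
    unfolding T by (rule det_permute_rows[OF _ perm]) (use B in auto)
  also have "\<dots> = signof p * det B" using det_transpose[OF B] by simp
  finally have "det (select_cols A k) = signof p * det B" .
  moreover have "gcd_max_minors A dvd det B"
    unfolding gcd_max_minors_def B_def using J A by (intro Gcd_dvd) auto
  ultimately show ?thesis by simp
qed

text \<open>An unsorted form of Cauchy-Binet: multilinearity expands the determinant into an integer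
  combination of determinants of selected columns.\<close>

lemma gcd_max_minors_dvd_det_mult:
  assumes A: "A \<in> carrier_mat m n" and W: "W \<in> carrier_mat n m"
  shows "gcd_max_minors A dvd det (A * W)"
proof -
  define B where "B = transpose_mat A"
  have B: "B \<in> carrier_mat n m" using A by (simp add: B_def)
  have AW: "A * W \<in> carrier_mat m m" using A W by auto
  have "det (A * W) = det (transpose_mat W * transpose_mat A)"
    using det_transpose[OF AW] transpose_mult[OF A W] by simp
  also have "transpose_mat W * transpose_mat A = mat\<^sub>r m m (\<lambda>i. finsum_vec TYPE(int) m (\<lambda>l. transpose_mat W $$ (i, l) \<cdot>\<^sub>v row B l) {0..<n})"
    unfolding B_def by (rule mat_mul_finsum_alt) (use A W in auto)
  also have "det \<dots> = (\<Sum>f | (\<forall>i\<in>{0..<m}. f i \<in> {0..<n}) \<and> (\<forall>i. i \<notin> {0..<m} \<longrightarrow> f i = i).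
      det (mat\<^sub>r m m (\<lambda>i. transpose_mat W $$ (i, f i) \<cdot>\<^sub>v row B (f i))))"
    by (rule det_linear_rows_sum) (use B in auto)
  finally have e: "det (A * W) = (\<Sum>f | (\<forall>i\<in>{0..<m}. f i \<in> {0..<n}) \<and> (\<forall>i. i \<notin> {0..<m} \<longrightarrow> f i = i).
      det (mat\<^sub>r m m (\<lambda>i. transpose_mat W $$ (i, f i) \<cdot>\<^sub>v row B (f i))))" .
  show ?thesis unfolding e
  proof (rule dvd_sum)
    fix f :: "nat \<Rightarrow> nat" assume "f \<in> {f. (\<forall>i\<in>{0..<m}. f i \<in> {0..<n}) \<and> (\<forall>i. i \<notin> {0..<m} \<longrightarrow> f i = i)}"
    then have f: "f i < n" if "i < m" for i using that by auto
    have "det (mat\<^sub>r m m (\<lambda>i. transpose_mat W $$ (i, f i) \<cdot>\<^sub>v row B (f i)))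
       = (\<Prod>i = 0..<m. transpose_mat W $$ (i, f i)) * det (mat\<^sub>r m m (\<lambda>i. row B (f i)))"
      by (rule det_rows_mul) (use B in auto)
    also have "mat\<^sub>r m m (\<lambda>i. row B (f i)) = transpose_mat (select_cols A f)"
      using A f by (intro eq_matI) (auto simp: B_def select_cols_def)
    also have "det \<dots> = det (select_cols A f)" by (rule det_transpose[OF select_cols_carrier[OF A]])
    finally show "gcd_max_minors A dvd det (mat\<^sub>r m m (\<lambda>i. transpose_mat W $$ (i, f i) \<cdot>\<^sub>v row B (f i)))"
      using gcd_max_minors_dvd_select_cols[OF A f] by simp
  qed
qed

section \<open>Factoring out a basis of the column lattice\<close>

lemma mult_mat_smult_vec:
  fixes A :: "'a :: comm_ring_1 mat"
  assumes "A \<in> carrier_mat m n" "v \<in> carrier_vec n"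
  shows "A *\<^sub>v (c \<cdot>\<^sub>v v) = c \<cdot>\<^sub>v (A *\<^sub>v v)"
  using assms by (intro eq_vecI) (auto simp: scalar_prod_def sum_distrib_left mult_ac)

lemma mult_unit_vec_eq_col:
  fixes A :: "'a :: comm_ring_1 mat"
  assumes "A \<in> carrier_mat m n" "j < n"
  shows "A *\<^sub>v unit_vec n j = col A j"
  using assms by (intro eq_vecI) (auto simp: scalar_prod_right_unit)

text \<open>Among the integer matrices \<open>W\<close> with \<open>det (A * W)\<close> nonzero, one
  of least absolute determinant is taken. If some column of \<open>A\<close> were not an integer
  combination of the columns of \<open>A * W\<close>, an exchange would produce a smaller nonzero
  determinant.\<close>

lemma exists_lattice_basis:
  fixes A :: "int mat"
  assumes A: "A \<in> carrier_mat m n" and k: "\<And>j. j < m \<Longrightarrow> k j < n" "det (select_cols A k) \<noteq> 0"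
  obtains D A' where "D \<in> carrier_mat m m" "A' \<in> carrier_mat m n" "A = D * A'" "det D \<noteq> 0" "gcd_max_minors A dvd det D"
proof -
  define Q where "Q W \<longleftrightarrow> W \<in> carrier_mat n m \<and> det (A * W) \<noteq> 0" for W
  define W0 :: "int mat" where "W0 = mat n m (\<lambda>(i, j). if i = k j then 1 else 0)"
  have "A * W0 = select_cols A k"
  proof (rule eq_matI)
    fix i j assume "i < dim_row (select_cols A k)" "j < dim_col (select_cols A k)"
    then have ij: "i < m" "j < m" using A by (auto simp: select_cols_def)
    have "(A * W0) $$ (i, j) = (\<Sum>l = 0..<n. A $$ (i, l) * (if l = k j then 1 else 0))"
      using A ij by (simp add: W0_def scalar_prod_def)
    also have "\<dots> = (\<Sum>l = 0..<n. if l = k j then A $$ (i, k j) else 0)" by (intro sum.cong) auto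
    also have "\<dots> = A $$ (i, k j)" using k(1)[OF ij(2)] by (simp add: sum.delta)
    finally show "(A * W0) $$ (i, j) = select_cols A k $$ (i, j)" using ij A by (simp add: select_cols_def)
  qed (use A in \<open>auto simp: select_cols_def W0_def\<close>)
  then have "Q W0" using k by (simp add: Q_def W0_def)
  then obtain W where W: "Q W" "\<And>V. Q V \<Longrightarrow> nat \<bar>det (A * W)\<bar> \<le> nat \<bar>det (A * V)\<bar>"
    using ex_has_least_nat[of Q W0 "\<lambda>V. nat \<bar>det (A * V)\<bar>"] by blast
  have Wc: "W \<in> carrier_mat n m" using W(1) by (simp add: Q_def)
  define D where "D = A * W"
  define \<delta> where "\<delta> = det D"
  have D: "D \<in> carrier_mat m m" using A Wc by (auto simp: D_def)
  have \<delta>: "\<delta> \<noteq> 0" using W(1) by (simp add: Q_def D_def \<delta>_def)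
  \<comment> \<open>By Cramer's rule, \<delta> times the coordinates of column \<open>j\<close> with
    respect to the columns of \<open>D\<close>.\<close>
  define z where "z j = adj_mat D *\<^sub>v col A j" for j
  have adj: "adj_mat D \<in> carrier_mat m m" "D * adj_mat D = \<delta> \<cdot>\<^sub>m 1\<^sub>m m"
    using adj_mat[OF D] by (simp_all add: \<delta>_def)
  have z: "z j \<in> carrier_vec m" for j using adj A by (auto simp: z_def)
  have cA: "col A j \<in> carrier_vec m" for j using A by auto
  have Dz: "D *\<^sub>v z j = \<delta> \<cdot>\<^sub>v col A j" for j
  proof -
    have "D *\<^sub>v z j = (D * adj_mat D) *\<^sub>v col A j"
      unfolding z_def by (rule assoc_mult_mat_vec[symmetric, OF D adj(1) cA])
    also have "\<dots> = \<delta> \<cdot>\<^sub>v col A j" unfolding adj(2)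
    proof (rule eq_vecI)
      fix i assume "i < dim_vec (\<delta> \<cdot>\<^sub>v col A j)"
      then have i: "i < m" using A by simp
      have "row (\<delta> \<cdot>\<^sub>m 1\<^sub>m m) i = \<delta> \<cdot>\<^sub>v unit_vec m i"
        using i by (intro eq_vecI) auto
      then show "((\<delta> \<cdot>\<^sub>m 1\<^sub>m m) *\<^sub>v col A j) $ i = (\<delta> \<cdot>\<^sub>v col A j) $ i"
        using i A cA[of j] by (simp add: scalar_prod_left_unit)
    qed (use A in auto)
    finally show ?thesis .
  qed
  have dvd: "\<delta> dvd z j $ i" if i: "i < m" and j: "j < n" for i j
  proof (rule ccontr)
    assume nd: "\<not> \<delta> dvd z j $ i"
    define q where "q = z j $ i div \<delta>"
    define r where "r = z j $ i mod \<delta>"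
    have r: "r \<noteq> 0" "\<bar>r\<bar> < \<bar>\<delta>\<bar>" using nd \<delta> abs_mod_less by (auto simp: r_def dvd_eq_mod_eq_0)
    \<comment> \<open>Exchange column \<open>i\<close> of \<open>W\<close> for this one: the new
      column of the product is column \<open>j\<close> of \<open>A\<close> reduced by
      \<open>q\<close> times column \<open>i\<close> of \<open>D\<close>, so its scaled coordinate
      \<open>i\<close> is the remainder \<open>r\<close>.\<close>
    define w where "w = unit_vec n j - q \<cdot>\<^sub>v col W i"
    have w: "w \<in> carrier_vec n" using Wc i by (auto simp: w_def)
    define V where "V = replace_col W w i"
    have V: "V \<in> carrier_mat n m" using Wc by (auto simp: V_def replace_col_def)
    have AV: "A * V = replace_col D (A *\<^sub>v w) i"
      using A Wc w i by (intro eq_matI) (auto simp: V_def D_def replace_col_def scalar_prod_def)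
    define y where "y = z j - (q * \<delta>) \<cdot>\<^sub>v unit_vec m i"
    have y: "y \<in> carrier_vec m" using z by (auto simp: y_def)
    have yi: "y $ i = r" using z[of j] i by (simp add: y_def r_def q_def minus_div_mult_eq_mod)
    have Aw: "A *\<^sub>v w = col A j - q \<cdot>\<^sub>v col D i"
    proof -
      have "A *\<^sub>v w = A *\<^sub>v unit_vec n j - A *\<^sub>v (q \<cdot>\<^sub>v col W i)"
        unfolding w_def by (rule mult_minus_distrib_mat_vec[OF A]) (use Wc i in auto)
      also have "A *\<^sub>v unit_vec n j = col A j" using mult_unit_vec_eq_col[OF A j] .
      also have "A *\<^sub>v (q \<cdot>\<^sub>v col W i) = q \<cdot>\<^sub>v (A *\<^sub>v col W i)"
        by (rule mult_mat_smult_vec[OF A]) (use Wc i in auto)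
      also have "A *\<^sub>v col W i = col D i" unfolding D_def by (rule col_mult2[OF A Wc i, symmetric])
      finally show ?thesis .
    qed
    have Dy: "D *\<^sub>v y = \<delta> \<cdot>\<^sub>v (A *\<^sub>v w)"
    proof -
      have "D *\<^sub>v y = D *\<^sub>v z j - D *\<^sub>v ((q * \<delta>) \<cdot>\<^sub>v unit_vec m i)"
        unfolding y_def by (rule mult_minus_distrib_mat_vec[OF D z]) auto
      also have "D *\<^sub>v ((q * \<delta>) \<cdot>\<^sub>v unit_vec m i) = (q * \<delta>) \<cdot>\<^sub>v (D *\<^sub>v unit_vec m i)"
        by (rule mult_mat_smult_vec[OF D]) auto
      also have "D *\<^sub>v unit_vec m i = col D i" using mult_unit_vec_eq_col[OF D i] .
      finally show ?thesis unfolding Aw Dz using A D i by (intro eq_vecI) (auto simp: right_diff_distrib)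
    qed
    have AVc: "A * V \<in> carrier_mat m m" using A V by auto
    \<comment> \<open>The same determinant is computed twice by Cramer's rule, from \<open>D\<close>
      and from \<open>A * V\<close>. This gives \<open>det (A * V) = r\<close>, against
      minimality.\<close>
    have "r * \<delta> = det (replace_col D (D *\<^sub>v y) i)"
      using cramer_lemma_mat[OF D y i] yi by (simp add: \<delta>_def)
    also have "replace_col D (D *\<^sub>v y) i = replace_col (A * V) ((A * V) *\<^sub>v (\<delta> \<cdot>\<^sub>v unit_vec m i)) i"
    proof -
      have "(A * V) *\<^sub>v (\<delta> \<cdot>\<^sub>v unit_vec m i) = \<delta> \<cdot>\<^sub>v ((A * V) *\<^sub>v unit_vec m i)"
        by (rule mult_mat_smult_vec[OF AVc]) auto
      also have "(A * V) *\<^sub>v unit_vec m i = col (A * V) i" by (rule mult_unit_vec_eq_col[OF AVc i])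
      also have "col (A * V) i = A *\<^sub>v w" unfolding AV using D A w i by (auto simp: replace_col_def)
      finally show ?thesis unfolding Dy AV using D by (auto simp: replace_col_def)
    qed
    also have "det \<dots> = (\<delta> \<cdot>\<^sub>v unit_vec m i) $ i * det (A * V)"
      by (rule cramer_lemma_mat[OF AVc _ i]) auto
    finally have "det (A * V) = r" using i \<delta> by simp
    then show False using W(2)[of V] V r \<delta>_def D_def by (simp add: Q_def)
  qed
  define A' where "A' = mat m n (\<lambda>(i, j). z j $ i div \<delta>)"
  have A'c: "A' \<in> carrier_mat m n" by (simp add: A'_def)
  have "A = D * A'"
  proof (rule eq_matI)
    fix i j assume "i < dim_row (D * A')" "j < dim_col (D * A')"
    then have ij: "i < m" "j < n" using D A'c by auto
    have "\<delta> * (D * A') $$ (i, j) = (\<Sum>l = 0..<m. D $$ (i, l) * (\<delta> * (z j $ l div \<delta>)))"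
      using ij D by (simp add: A'_def scalar_prod_def sum_distrib_left mult.left_commute)
    also have "\<dots> = (\<Sum>l = 0..<m. D $$ (i, l) * z j $ l)"
      using dvd ij by (intro sum.cong) auto
    also have "\<dots> = (D *\<^sub>v z j) $ i" using ij D z[of j] by (simp add: scalar_prod_def)
    also have "\<dots> = \<delta> * A $$ (i, j)" unfolding Dz using ij A by simp
    finally show "A $$ (i, j) = (D * A') $$ (i, j)" using \<delta> by simp
  qed (use A D A'c in auto)
  moreover have "gcd_max_minors A dvd det D"
    unfolding D_def by (rule gcd_max_minors_dvd_det_mult[OF A Wc])
  ultimately show ?thesis using that[OF D A'c] \<delta> by (simp add: \<delta>_def)
qed

text \<open>Used twice: with all columns of the reduced matrix for the first bound, and with few
  columns of \<open>A\<close> itself for the second.\<close>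

lemma kernel_free_bound_subset:
  fixes A :: "int mat"
  assumes A: "A \<in> carrier_mat m n" and k: "\<And>j. j < m \<Longrightarrow> k j \<in> X" "det (select_cols A k) \<noteq> 0"
    and X: "X \<subseteq> {..<n}" and S: "S \<subseteq> X"
    and nosol: "\<And>y. (\<And>j. y j \<in> {-1, 0, 1}) \<Longrightarrow> (\<And>j. j \<notin> S \<Longrightarrow> y j = 0) \<Longrightarrow>
       (\<And>q. q < m \<Longrightarrow> (\<Sum>j\<in>S. y j * A $$ (q, j)) = 0) \<Longrightarrow> y = (\<lambda>_. 0)"
  defines "G \<equiv> mat m m (\<lambda>(p, q). \<Sum>j\<in>X. real_of_int (A $$ (p, j)) * real_of_int (A $$ (q, j)))"
  shows "2 ^ card S \<le> 2 ^ m * sqrt (det G)" "0 < det G"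
    "det G \<le> (\<Prod>p<m. \<Sum>j\<in>X. (real_of_int (A $$ (p, j)))\<^sup>2)"
proof -
  have X': "finite X" using X finite_subset by blast
  note * = two_power_card_le_det[OF X' S meta_eq_to_obj_eq[OF G_def] select_cols_full[OF A k] nosol]
  show "2 ^ card S \<le> 2 ^ m * sqrt (det G)" "0 < det G"
    "det G \<le> (\<Prod>p<m. \<Sum>j\<in>X. (real_of_int (A $$ (p, j)))\<^sup>2)"
    by (rule *; assumption)+
qed

text \<open>With \<open>A = D * A'\<close>, relations among the columns of \<open>A'\<close> carry
  over to \<open>A\<close>, and \<open>det (A * A^T)\<close> is \<open>(det D)^2\<close> times the
  Gram determinant of \<open>A'\<close>. Since the gcd divides the nonzero \<open>det D\<close>, it
  is at most its absolute value.\<close>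

lemma kernel_free_bound:
  fixes A :: "int mat"
  assumes A: "A \<in> carrier_mat m n" and k: "\<And>j. j < m \<Longrightarrow> k j < n" "det (select_cols A k) \<noteq> 0"
    and S: "S \<subseteq> {..<n}"
    and nosol: "\<And>y. (\<And>j. y j \<in> {-1, 0, 1}) \<Longrightarrow> (\<And>j. j \<notin> S \<Longrightarrow> y j = 0) \<Longrightarrow>
       (\<And>q. q < m \<Longrightarrow> (\<Sum>j\<in>S. y j * A $$ (q, j)) = 0) \<Longrightarrow> y = (\<lambda>_. 0)"
  shows "2 ^ card S \<le> 2 ^ m * (sqrt (real_of_int (det (A * transpose_mat A))) / real_of_int (gcd_max_minors A))"
proof -
  define g where "g = gcd_max_minors A"
  have "g dvd det (select_cols A k)" unfolding g_def by (rule gcd_max_minors_dvd_select_cols[OF A k(1)])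
  then have "g \<noteq> 0" using k(2) by auto
  moreover have "0 \<le> g" unfolding g_def gcd_max_minors_def by simp
  ultimately have g: "0 < g" by simp
  obtain D A' where D: "D \<in> carrier_mat m m" and A': "A' \<in> carrier_mat m n" and AD: "A = D * A'"
    and dD: "det D \<noteq> 0" and gD: "g dvd det D"
    unfolding g_def by (rule exists_lattice_basis[OF A k])
  have sel: "select_cols A k = D * select_cols A' k"
    using D A' A k(1) unfolding AD by (intro eq_matI) (auto simp: select_cols_def scalar_prod_def)
  have k': "det (select_cols A' k) \<noteq> 0"
    using k(2) unfolding sel using det_mult[OF D select_cols_carrier[OF A']] by auto
  define G where "G = mat m m (\<lambda>(p, q). \<Sum>j<n. real_of_int (A' $$ (p, j)) * real_of_int (A' $$ (q, j)))"
  have "2 ^ card S \<le> 2 ^ m * sqrt (det G)" unfolding G_def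
  proof (rule kernel_free_bound_subset(1)[OF A' _ k' subset_refl S])
    fix y :: "nat \<Rightarrow> int"
    assume y: "\<And>j. y j \<in> {-1, 0, 1}" "\<And>j. j \<notin> S \<Longrightarrow> y j = 0" "\<And>q. q < m \<Longrightarrow> (\<Sum>j\<in>S. y j * A' $$ (q, j)) = 0"
    show "y = (\<lambda>_. 0)"
    proof (rule nosol[OF y(1,2)])
      fix q assume q: "q < m"
      have "(\<Sum>j\<in>S. y j * A $$ (q, j)) = (\<Sum>j\<in>S. \<Sum>l = 0..<m. D $$ (q, l) * (y j * A' $$ (l, j)))"
      proof (rule sum.cong)
        fix j assume "j \<in> S"
        then have "j < n" using S by auto
        then show "y j * A $$ (q, j) = (\<Sum>l = 0..<m. D $$ (q, l) * (y j * A' $$ (l, j)))"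
          unfolding AD using q D A' by (simp add: scalar_prod_def sum_distrib_left mult.left_commute)
      qed simp
      also have "\<dots> = (\<Sum>l = 0..<m. D $$ (q, l) * (\<Sum>j\<in>S. y j * A' $$ (l, j)))"
        by (subst sum.swap) (simp add: sum_distrib_left)
      also have "\<dots> = 0" using y(3) by (intro sum.neutral) auto
      finally show "(\<Sum>j\<in>S. y j * A $$ (q, j)) = 0" .
    qed auto
  qed (use k in auto)
  moreover have "G = map_mat real_of_int (A' * transpose_mat A')"
    using A' by (intro eq_matI) (auto simp: G_def scalar_prod_def atLeast0LessThan)
  ultimately have 1: "2 ^ card S \<le> 2 ^ m * sqrt (real_of_int (det (A' * transpose_mat A')))"
    by (simp add: det_real_of_int)
  define e where "e = det (A' * transpose_mat A')"
  have A'T: "A' * transpose_mat A' \<in> carrier_mat m m" using A' by auto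
  have "A * transpose_mat A = (D * A') * (transpose_mat A' * transpose_mat D)"
    unfolding AD using transpose_mult[OF D A'] by simp
  also have "\<dots> = D * (A' * (transpose_mat A' * transpose_mat D))"
    by (rule assoc_mult_mat[of _ m m _ n _ m]) (use D A' in auto)
  also have "A' * (transpose_mat A' * transpose_mat D) = (A' * transpose_mat A') * transpose_mat D"
    by (rule assoc_mult_mat[of _ m n _ m _ m, symmetric]) (use D A' in auto)
  finally have "det (A * transpose_mat A) = det D * det ((A' * transpose_mat A') * transpose_mat D)"
    using det_mult[OF D, of "(A' * transpose_mat A') * transpose_mat D"] A'T D by simp
  also have "det ((A' * transpose_mat A') * transpose_mat D) = e * det D"
    using det_mult[OF A'T, of "transpose_mat D"] D det_transpose[OF D] by (simp add: e_def)
  finally have "real_of_int (det (A * transpose_mat A)) = (real_of_int (det D))\<^sup>2 * real_of_int e"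
    by (simp add: power2_eq_square)
  then have 2: "sqrt (real_of_int (det (A * transpose_mat A))) = \<bar>real_of_int (det D)\<bar> * sqrt (real_of_int e)"
    by (simp add: real_sqrt_mult)
  \<comment> \<open>The real \<open>sqrt\<close> is negative on negative numbers, so the bound just
    obtained excludes a negative \<open>e\<close>.\<close>
  have "0 \<le> e"
  proof (rule ccontr)
    assume "\<not> ?thesis"
    then have "sqrt (real_of_int e) < 0" by simp
    then have "2 ^ m * sqrt (real_of_int e) < 0" by (simp add: mult_pos_neg)
    with 1 have "(2::real) ^ card S < 0" unfolding e_def by linarith
    then show False by (simp add: not_less[symmetric])
  qed
  have gle: "g \<le> \<bar>det D\<bar>" using gD dD zdvd_imp_le[of g "\<bar>det D\<bar>"] by simp
  have "real_of_int g * sqrt (real_of_int e) \<le> \<bar>real_of_int (det D)\<bar> * sqrt (real_of_int e)"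
  proof (rule mult_right_mono)
    show "real_of_int g \<le> \<bar>real_of_int (det D)\<bar>" using gle by linarith
    show "0 \<le> sqrt (real_of_int e)" using \<open>0 \<le> e\<close> by simp
  qed
  then have "sqrt (real_of_int e) \<le> sqrt (real_of_int (det (A * transpose_mat A))) / real_of_int g"
    unfolding 2 using g by (simp add: pos_le_divide_eq mult.commute)
  then have "2 ^ m * sqrt (real_of_int e) \<le> 2 ^ m * (sqrt (real_of_int (det (A * transpose_mat A))) / real_of_int g)"
    by (intro mult_left_mono) auto
  with 1 show ?thesis unfolding e_def g_def by linarith
qed

section \<open>Existence of optimal solutions\<close>

abbreviation int_form :: "nat \<Rightarrow> (nat \<Rightarrow> int) \<Rightarrow> (nat \<Rightarrow> real) \<Rightarrow> real" where
  "int_form N a \<equiv> lin_form {..<N} (\<lambda>j. real_of_int (a j))"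

text \<open>Points are functions here so that \<open>lin_form\<close> applies; for
  \<open>n \<le> N\<close> the values at indices from \<open>N\<close> on are unrestricted.\<close>

definition mip_sol :: "nat \<Rightarrow> nat \<Rightarrow> nat \<Rightarrow> int mat \<Rightarrow> int vec \<Rightarrow> (nat \<Rightarrow> real) \<Rightarrow> bool" where
  "mip_sol m n N A b x \<longleftrightarrow>
     (\<forall>q<m. int_form N (\<lambda>j. A $$ (q, j)) x = real_of_int (b $ q)) \<and>
     (\<forall>j<N. 0 \<le> x j) \<and> (\<forall>i<n. x i \<in> \<int>)"

definition kernel_vec :: "nat \<Rightarrow> nat \<Rightarrow> int mat \<Rightarrow> (nat \<Rightarrow> real) \<Rightarrow> bool" where
  "kernel_vec m N A y \<longleftrightarrow> (\<forall>q<m. int_form N (\<lambda>j. A $$ (q, j)) y = 0)"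

definition fun_supp :: "nat \<Rightarrow> (nat \<Rightarrow> real) \<Rightarrow> nat set" where
  "fun_supp N x = {j. j < N \<and> x j \<noteq> 0}"

lemma finite_fun_supp [simp]: "finite (fun_supp N x)"
  by (simp add: fun_supp_def)

lemma lin_form_add_scaled: "lin_form Q a (\<lambda>j. x j + t * y j) = lin_form Q a x + t * lin_form Q a y"
  unfolding lin_form_def by (simp add: sum.distrib sum_distrib_left algebra_simps)

text \<open>The ratio test of the simplex method: the longest step that keeps nonnegativity stops
  where some coordinate reaches zero. The index \<open>j\<close> and the value of \<open>t\<close>
  are returned because integrality of the step is read off from them later.\<close>

lemma ratio_step:
  fixes x y :: "nat \<Rightarrow> real"
  assumes x: "\<And>j. j < N \<Longrightarrow> 0 \<le> x j" and y: "\<And>j. j < N \<Longrightarrow> y j \<noteq> 0 \<Longrightarrow> x j \<noteq> 0"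
    and neg: "\<exists>j<N. y j < 0"
  obtains t j where "0 < t" "j < N" "y j < 0" "t = x j / - y j" "\<And>j. j < N \<Longrightarrow> 0 \<le> x j + t * y j"
    "fun_supp N (\<lambda>j. x j + t * y j) \<subset> fun_supp N x"
proof -
  define J where "J = {j. j < N \<and> y j < 0}"
  define t where "t = Min ((\<lambda>j. x j / - y j) ` J)"
  have J: "finite J" "J \<noteq> {}" using neg by (auto simp: J_def)
  then have "t \<in> (\<lambda>j. x j / - y j) ` J" unfolding t_def by (intro Min_in) auto
  then obtain j where j: "j \<in> J" "t = x j / - y j" by blast
  have jN: "j < N" "y j < 0" using j by (auto simp: J_def)
  have xj: "0 < x j" using x[OF jN(1)] y[OF jN(1)] jN by force
  have t: "0 < t" unfolding j(2) using xj jN by (intro divide_pos_pos) auto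
  have nn: "0 \<le> x i + t * y i" if "i < N" for i
  proof (cases "y i < 0")
    case True
    then have "t \<le> x i / - y i" unfolding t_def using that J by (intro Min_le) (auto simp: J_def)
    then have "t * - y i \<le> x i" using True by (simp add: pos_le_divide_eq del: divide_minus_right)
    then show ?thesis by simp
  next
    case False
    then show ?thesis using x[OF that] t by simp
  qed
  have z: "x j + t * y j = 0" unfolding j(2) using jN by (simp add: field_simps)
  have "fun_supp N (\<lambda>j. x j + t * y j) \<subseteq> fun_supp N x"
    unfolding fun_supp_def using y by auto
  moreover have "j \<in> fun_supp N x" "j \<notin> fun_supp N (\<lambda>j. x j + t * y j)"
    using jN xj z by (auto simp: fun_supp_def)
  ultimately have "fun_supp N (\<lambda>j. x j + t * y j) \<subset> fun_supp N x" by blast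
  with t jN j(2) nn show ?thesis using that by blast
qed

lemma mip_sol_add:
  assumes "mip_sol m n N A b x" "kernel_vec m N A y" "\<And>j. j < N \<Longrightarrow> 0 \<le> x j + t * y j" "\<And>i. i < n \<Longrightarrow> x i + t * y i \<in> \<int>"
  shows "mip_sol m n N A b (\<lambda>j. x j + t * y j)"
  using assms unfolding mip_sol_def kernel_vec_def lin_form_add_scaled by auto

lemma kernel_vec_uminus: "kernel_vec m N A y \<Longrightarrow> kernel_vec m N A (\<lambda>j. - y j)"
  unfolding kernel_vec_def lin_form_uminus by simp

text \<open>Either \<open>y\<close> or its negative does not lower the objective. A strictly
  improving direction must have a negative entry, since otherwise it would be a feasible ray on
  which the objective exceeds \<open>u\<close>; with objective change 0 the sign is free and is
  chosen to decrease some coordinate.\<close>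

lemma continuous_support_step:
  assumes x: "mip_sol m n N A b x" and y: "kernel_vec m N A y"
    and bnd: "\<And>x. mip_sol m n N A b x \<Longrightarrow> lin_form {..<N} c x \<le> u"
    and supp: "\<And>j. y j \<noteq> 0 \<Longrightarrow> n \<le> j \<and> j < N \<and> x j \<noteq> 0" and nz: "\<exists>j. y j \<noteq> 0"
  obtains x' where "mip_sol m n N A b x'" "lin_form {..<N} c x \<le> lin_form {..<N} c x'"
    "\<And>i. i < n \<Longrightarrow> x' i = x i" "fun_supp N x' \<subset> fun_supp N x"
proof -
  note result = that
  have wlog: thesis
    if y: "kernel_vec m N A y" and supp: "\<And>j. y j \<noteq> 0 \<Longrightarrow> n \<le> j \<and> j < N \<and> x j \<noteq> 0"
      and pos: "0 \<le> lin_form {..<N} c y" and neg: "\<exists>j<N. y j < 0" for y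
  proof -
    have x0: "0 \<le> x j" if "j < N" for j using x that by (simp add: mip_sol_def)
    have xy: "x j \<noteq> 0" if "j < N" "y j \<noteq> 0" for j using supp that by blast
    obtain t where t: "0 < t" "\<And>j. j < N \<Longrightarrow> 0 \<le> x j + t * y j" "fun_supp N (\<lambda>j. x j + t * y j) \<subset> fun_supp N x"
    proof (rule ratio_step[of N x y, OF x0 xy neg])
      fix t j assume "0 < t" "\<And>j. j < N \<Longrightarrow> 0 \<le> x j + t * y j" "fun_supp N (\<lambda>j. x j + t * y j) \<subset> fun_supp N x"
      then show ?thesis by (rule that)
    qed
    have y0: "y i = 0" if "i < n" for i using supp[of i] that by force
    show thesis
    proof (rule result[of "\<lambda>j. x j + t * y j"])
      show "mip_sol m n N A b (\<lambda>j. x j + t * y j)"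
        using x y0 by (intro mip_sol_add[OF x y t(2)]) (auto simp: mip_sol_def)
      show "lin_form {..<N} c x \<le> lin_form {..<N} c (\<lambda>j. x j + t * y j)"
        unfolding lin_form_add_scaled using t pos by simp
    qed (use y0 t in auto)
  qed
  have ray: "\<exists>j<N. y j < 0"
    if y: "kernel_vec m N A y" and supp: "\<And>j. y j \<noteq> 0 \<Longrightarrow> n \<le> j \<and> j < N \<and> x j \<noteq> 0"
      and pos: "0 < lin_form {..<N} c y" for y
  proof (rule ccontr)
    assume "\<not> ?thesis"
    then have y0: "0 \<le> y j" if "j < N" for j using that by (meson not_less)
    have yn: "y i = 0" if "i < n" for i using supp[of i] that by force
    \<comment> \<open>Long enough to lift the objective to \<open>u + 1\<close>.\<close>
    define t where "t = max 0 ((u - lin_form {..<N} c x + 1) / lin_form {..<N} c y)"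
    have t: "0 \<le> t" "u - lin_form {..<N} c x + 1 \<le> t * lin_form {..<N} c y"
      using pos by (auto simp: t_def pos_divide_le_eq[symmetric])
    have "mip_sol m n N A b (\<lambda>j. x j + t * y j)"
      using x yn y0 t by (intro mip_sol_add[OF x y]) (auto simp: mip_sol_def)
    from bnd[OF this] show False unfolding lin_form_add_scaled using t by linarith
  qed
  obtain j where j: "y j \<noteq> 0" using nz by blast
  have ym: "kernel_vec m N A (\<lambda>j. - y j)" "\<And>j. - y j \<noteq> 0 \<Longrightarrow> n \<le> j \<and> j < N \<and> x j \<noteq> 0"
    using kernel_vec_uminus[OF y] supp by auto
  consider "0 < lin_form {..<N} c y" | "lin_form {..<N} c y < 0" | "lin_form {..<N} c y = 0" by linarith
  then show thesis
  proof cases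
    case 1
    then show ?thesis using wlog[OF y supp _ ray[OF y supp]] by simp
  next
    case 2
    then have "0 < lin_form {..<N} c (\<lambda>j. - y j)" by (simp add: lin_form_uminus)
    then show ?thesis using wlog[OF ym _ ray[OF ym]] by simp
  next
    case 3
    then have 0: "0 \<le> lin_form {..<N} c y" "0 \<le> lin_form {..<N} c (\<lambda>j. - y j)" by (simp_all add: lin_form_uminus)
    have jN: "j < N" using supp[OF j] by simp
    show ?thesis
    proof (cases "y j < 0")
      case True
      then show ?thesis using wlog[OF y supp 0(1)] jN by blast
    next
      case False
      then have "- y j < 0" using j by simp
      then show ?thesis using wlog[OF ym 0(2)] jN by blast
    qed
  qed
qed

text \<open>Linear independence of the columns in the continuous support, phrased with kernel
  vectors.\<close>

definition cont_reduced :: "nat \<Rightarrow> nat \<Rightarrow> nat \<Rightarrow> int mat \<Rightarrow> (nat \<Rightarrow> real) \<Rightarrow> bool" where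
  "cont_reduced m n N A x \<longleftrightarrow>
     (\<forall>y. kernel_vec m N A y \<longrightarrow> (\<forall>j. y j \<noteq> 0 \<longrightarrow> n \<le> j \<and> j < N \<and> x j \<noteq> 0) \<longrightarrow> (\<forall>j. y j = 0))"

lemma exists_cont_reduced:
  assumes x: "mip_sol m n N A b x"
    and bnd: "\<And>x. mip_sol m n N A b x \<Longrightarrow> lin_form {..<N} c x \<le> u"
  obtains x' where "mip_sol m n N A b x'" "lin_form {..<N} c x \<le> lin_form {..<N} c x'" "cont_reduced m n N A x'"
proof -
  define P where "P x' \<longleftrightarrow> mip_sol m n N A b x' \<and> lin_form {..<N} c x \<le> lin_form {..<N} c x'" for x'
  have "P x" using x by (simp add: P_def)
  then obtain x' where x': "P x'" "\<And>w. P w \<Longrightarrow> card (fun_supp N x') \<le> card (fun_supp N w)"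
    using ex_has_least_nat[of P x "\<lambda>w. card (fun_supp N w)"] by blast
  have "cont_reduced m n N A x'"
    unfolding cont_reduced_def
  proof (intro allI impI, rule ccontr)
    fix y j
    assume y: "kernel_vec m N A y" "\<forall>j. y j \<noteq> 0 \<longrightarrow> n \<le> j \<and> j < N \<and> x' j \<noteq> 0" "y j \<noteq> 0"
    have sol: "mip_sol m n N A b x'" using x' by (simp add: P_def)
    obtain w where w: "mip_sol m n N A b w" "lin_form {..<N} c x' \<le> lin_form {..<N} c w" "fun_supp N w \<subset> fun_supp N x'"
      using continuous_support_step[OF sol y(1) bnd] y(2,3) by metis
    have "P w" using w x' by (auto simp: P_def)
    from x'(2)[OF this] psubset_card_mono[OF _ w(3)] show False by simp
  qed
  with x'(1) show ?thesis using that[of x'] unfolding P_def by blast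
qed

text \<open>Padding the Gram matrix of the columns in \<open>S\<close> with the identity avoids reindexing.\<close>

definition masked_gram :: "nat \<Rightarrow> nat \<Rightarrow> int mat \<Rightarrow> nat set \<Rightarrow> int mat" where
  "masked_gram m N A S = mat N N (\<lambda>(i, j). if i \<in> S \<and> j \<in> S then \<Sum>q<m. A $$ (q, i) * A $$ (q, j) else if i = j then 1 else 0)"

text \<open>A kernel vector vanishes outside \<open>S\<close> because of the identity rows, and the
  Gram block then shows that the sum of the squares of its row forms is zero.\<close>

lemma det_masked_gram_nonzero:
  assumes S: "S \<subseteq> {..<N}" and ind: "\<And>y. kernel_vec m N A y \<Longrightarrow> (\<And>j. y j \<noteq> 0 \<Longrightarrow> j \<in> S) \<Longrightarrow> (\<And>j. y j = 0)"
  shows "det (masked_gram m N A S) \<noteq> 0"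
proof
  assume "det (masked_gram m N A S) = 0"
  define B where "B = map_mat real_of_int (masked_gram m N A S)"
  have B: "B \<in> carrier_mat N N" by (simp add: B_def masked_gram_def)
  have "det B = 0" unfolding B_def using \<open>det (masked_gram m N A S) = 0\<close> by (simp add: of_int_hom.hom_det)
  then obtain v where v: "v \<in> carrier_vec N" "v \<noteq> 0\<^sub>v N" "B *\<^sub>v v = 0\<^sub>v N"
    using det_0_iff_vec_prod_zero[OF B] by blast
  have row: "(\<Sum>j<N. B $$ (i, j) * v $ j) = 0" if "i < N" for i
  proof -
    have "(B *\<^sub>v v) $ i = (\<Sum>j<N. B $$ (i, j) * v $ j)"
      using that B v(1) by (simp add: scalar_prod_def atLeast0LessThan)
    then show ?thesis using v(3) that by simp
  qed
  have out: "v $ i = 0" if i: "i < N" "i \<notin> S" for i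
  proof -
    have "(\<Sum>j<N. B $$ (i, j) * v $ j) = (\<Sum>j<N. if j = i then v $ i else 0)"
      using i by (intro sum.cong) (auto simp: B_def masked_gram_def)
    then show ?thesis using row[OF i(1)] i by (simp add: sum.delta)
  qed
  define y where "y j = (if j < N then v $ j else 0)" for j
  define L where "L q = int_form N (\<lambda>j. A $$ (q, j)) y" for q
  have yS: "j \<in> S" if "y j \<noteq> 0" for j using that out by (auto simp: y_def split: if_splits)
  have "(\<Sum>q<m. (L q)\<^sup>2) = (\<Sum>i<N. y i * (\<Sum>q<m. real_of_int (A $$ (q, i)) * L q))"
  proof -
    have "(\<Sum>i<N. y i * (\<Sum>q<m. real_of_int (A $$ (q, i)) * L q)) = (\<Sum>i<N. \<Sum>q<m. real_of_int (A $$ (q, i)) * y i * L q)"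
      by (simp add: sum_distrib_left mult_ac)
    also have "\<dots> = (\<Sum>q<m. \<Sum>i<N. real_of_int (A $$ (q, i)) * y i * L q)" by (rule sum.swap)
    also have "\<dots> = (\<Sum>q<m. (L q)\<^sup>2)"
      by (intro sum.cong refl) (simp add: power2_eq_square sum_distrib_right[symmetric], simp add: L_def lin_form_def)
    finally show ?thesis by simp
  qed
  also have "\<dots> = 0"
  proof (intro sum.neutral ballI)
    fix i assume "i \<in> {..<N}"
    then have i: "i < N" by simp
    show "y i * (\<Sum>q<m. real_of_int (A $$ (q, i)) * L q) = 0"
    proof (cases "i \<in> S")
      case True
      have "(\<Sum>q<m. real_of_int (A $$ (q, i)) * L q) = (\<Sum>q<m. \<Sum>j<N. real_of_int (A $$ (q, i)) * real_of_int (A $$ (q, j)) * y j)"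
        by (simp add: L_def lin_form_def sum_distrib_left mult.assoc)
      also have "\<dots> = (\<Sum>j<N. (\<Sum>q<m. real_of_int (A $$ (q, i)) * real_of_int (A $$ (q, j))) * y j)"
        by (subst sum.swap) (simp add: sum_distrib_right)
      also have "\<dots> = (\<Sum>j<N. B $$ (i, j) * v $ j)"
      proof (rule sum.cong)
        fix j assume "j \<in> {..<N}"
        then show "(\<Sum>q<m. real_of_int (A $$ (q, i)) * real_of_int (A $$ (q, j))) * y j = B $$ (i, j) * v $ j"
          using i True out[of j] by (cases "j \<in> S") (auto simp: B_def masked_gram_def y_def)
      qed simp
      also have "\<dots> = 0" by (rule row[OF i])
      finally show ?thesis by simp
    next
      case False
      then have "y i = 0" using yS by blast
      then show ?thesis by simp
    qed
  qed
  finally have "L q = 0" if "q < m" for q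
    using that by (simp add: sum_nonneg_eq_0_iff)
  then have "kernel_vec m N A y" by (simp add: kernel_vec_def L_def)
  from ind[OF this yS] have "y j = 0" for j by blast
  then have "v = 0\<^sub>v N" using v(1) by (intro eq_vecI) (auto simp: y_def split: if_splits, metis)
  with v(2) show False ..
qed

text \<open>The continuous part \<open>w\<close> solves normal equations whose right-hand side
  \<open>r\<close> is integral, because \<open>b\<close> and the contribution of the integer
  variables are. Multiplication by the adjugate gives the common denominator.\<close>

lemma reduced_denominator:
  assumes x: "mip_sol m n N A b x" and red: "cont_reduced m n N A x" and j: "j < N"
    and nN: "n \<le> N"
  shows "real_of_int (det (masked_gram m N A {j. n \<le> j \<and> j < N \<and> x j \<noteq> 0})) * x j \<in> \<int>"
    and "det (masked_gram m N A {j. n \<le> j \<and> j < N \<and> x j \<noteq> 0}) \<noteq> 0"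
proof -
  define S where "S = {j. n \<le> j \<and> j < N \<and> x j \<noteq> 0}"
  define B where "B = masked_gram m N A S"
  define \<delta> where "\<delta> = det B"
  have d0: "\<delta> \<noteq> 0"
    unfolding \<delta>_def B_def
  proof (rule det_masked_gram_nonzero)
    show "S \<subseteq> {..<N}" by (auto simp: S_def)
    fix y j assume "kernel_vec m N A y" "\<And>j. y j \<noteq> 0 \<Longrightarrow> j \<in> S"
    then show "y j = 0" using red unfolding cont_reduced_def S_def by blast
  qed
  then show "det (masked_gram m N A {j. n \<le> j \<and> j < N \<and> x j \<noteq> 0}) \<noteq> 0"
    by (simp add: \<delta>_def B_def S_def)
  define w where "w j = (if j \<in> S then x j else 0)" for j
  define r where "r i = (\<Sum>l<N. real_of_int (B $$ (i, l)) * w l)" for i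
  have B: "B \<in> carrier_mat N N" by (simp add: B_def masked_gram_def)
  have rInt: "r i \<in> \<int>" if i: "i < N" for i
  proof (cases "i \<in> S")
    case False
    have "r i = 0" unfolding r_def
      using False i by (intro sum.neutral) (auto simp: B_def masked_gram_def w_def)
    then show ?thesis by simp
  next
    case True
    have rows: "(\<Sum>l<N. real_of_int (A $$ (q, l)) * w l) \<in> \<int>" if "q < m" for q
    proof -
      have "(\<Sum>l<N. real_of_int (A $$ (q, l)) * x l) = (\<Sum>l<N. real_of_int (A $$ (q, l)) * w l) + (\<Sum>l<N. real_of_int (A $$ (q, l)) * (x l - w l))"
        by (simp add: sum.distrib[symmetric] algebra_simps)
      moreover have "(\<Sum>l<N. real_of_int (A $$ (q, l)) * x l) = real_of_int (b $ q)"
        using x that by (simp add: mip_sol_def lin_form_def)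
      moreover have "(\<Sum>l<N. real_of_int (A $$ (q, l)) * (x l - w l)) \<in> \<int>"
      proof (intro Ints_sum Ints_mult Ints_of_int)
        fix l assume "l \<in> {..<N}"
        then show "x l - w l \<in> \<int>" using x by (cases "l < n") (auto simp: w_def S_def mip_sol_def)
      qed
      ultimately show ?thesis by (metis Ints_diff Ints_of_int add_diff_cancel_right')
    qed
    have "r i = (\<Sum>l<N. \<Sum>q<m. real_of_int (A $$ (q, i)) * (real_of_int (A $$ (q, l)) * w l))"
      unfolding r_def
    proof (rule sum.cong)
      fix l assume "l \<in> {..<N}"
      then show "real_of_int (B $$ (i, l)) * w l = (\<Sum>q<m. real_of_int (A $$ (q, i)) * (real_of_int (A $$ (q, l)) * w l))"
        using i True by (cases "l \<in> S") (auto simp: B_def masked_gram_def w_def sum_distrib_right mult.assoc)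
    qed simp
    also have "\<dots> = (\<Sum>q<m. real_of_int (A $$ (q, i)) * (\<Sum>l<N. real_of_int (A $$ (q, l)) * w l))"
      by (subst sum.swap) (simp add: sum_distrib_left)
    also have "\<dots> \<in> \<int>"
    proof (rule Ints_sum)
      fix q assume "q \<in> {..<m}"
      then show "real_of_int (A $$ (q, i)) * (\<Sum>l<N. real_of_int (A $$ (q, l)) * w l) \<in> \<int>"
        by (intro Ints_mult[OF Ints_of_int rows]) simp
    qed
    finally show ?thesis .
  qed
  have "real_of_int \<delta> * w j = (\<Sum>l<N. real_of_int ((adj_mat B * B) $$ (j, l)) * w l)"
  proof -
    have "(\<Sum>l<N. real_of_int ((adj_mat B * B) $$ (j, l)) * w l) = (\<Sum>l<N. if l = j then real_of_int \<delta> * w j else 0)"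
      unfolding adj_mat(3)[OF B] \<delta>_def[symmetric] using j by (intro sum.cong) auto
    then show ?thesis using j by (simp add: sum.delta)
  qed
  also have "\<dots> = (\<Sum>l<N. \<Sum>i<N. real_of_int (adj_mat B $$ (j, i)) * (real_of_int (B $$ (i, l)) * w l))"
  proof (rule sum.cong)
    fix l assume "l \<in> {..<N}"
    then show "real_of_int ((adj_mat B * B) $$ (j, l)) * w l = (\<Sum>i<N. real_of_int (adj_mat B $$ (j, i)) * (real_of_int (B $$ (i, l)) * w l))"
      using j B adj_mat(1)[OF B] by (simp add: scalar_prod_def atLeast0LessThan sum_distrib_right mult.assoc)
  qed simp
  also have "\<dots> = (\<Sum>i<N. real_of_int (adj_mat B $$ (j, i)) * r i)"
    by (subst sum.swap) (simp add: r_def sum_distrib_left)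
  also have "\<dots> \<in> \<int>" using rInt by (intro Ints_sum Ints_mult Ints_of_int) auto
  finally have wI: "real_of_int \<delta> * w j \<in> \<int>" .
  have "real_of_int \<delta> * x j \<in> \<int>"
  proof (cases "j \<in> S")
    case True then show ?thesis using wI by (simp add: w_def)
  next
    case False
    then have "x j \<in> \<int>" using x j by (cases "j < n") (auto simp: S_def mip_sol_def)
    then show ?thesis by (intro Ints_mult Ints_of_int)
  qed
  then show "real_of_int (det (masked_gram m N A {j. n \<le> j \<and> j < N \<and> x j \<noteq> 0})) * x j \<in> \<int>"
    by (simp add: \<delta>_def B_def S_def)
qed

text \<open>Every solution is dominated by a reduced one, and on these \<open>K\<close> times the
  objective is an integer. A nonempty set of integers that is bounded above has a maximum.\<close>

lemma exists_mip_optimum: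
  fixes c :: "int vec"
  assumes x: "mip_sol m n N A b x" and nN: "n \<le> N"
    and bnd: "\<And>x. mip_sol m n N A b x \<Longrightarrow> int_form N (($) c) x \<le> u"
  obtains z where "mip_sol m n N A b z"
    "\<And>x. mip_sol m n N A b x \<Longrightarrow> int_form N (($) c) x \<le> int_form N (($) c) z"
proof -
  define obj where "obj x = int_form N (($) c) x" for x
  \<comment> \<open>Singular index sets contribute 1, which keeps the product \<open>K\<close> over
    all of them positive.\<close>
  define dd where "dd S = (let t = det (masked_gram m N A S) in if t = 0 then 1 else \<bar>t\<bar>)" for S
  define K where "K = (\<Prod>S\<in>Pow {..<N}. dd S)"
  have dd: "0 < dd S" for S by (simp add: dd_def Let_def)
  then have K: "0 < K" unfolding K_def by (intro prod_pos) auto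
  have KI: "real_of_int K * obj x \<in> \<int>" if x: "mip_sol m n N A b x" "cont_reduced m n N A x" for x
  proof -
    define S where "S = {j. n \<le> j \<and> j < N \<and> x j \<noteq> 0}"
    have "dd S dvd K" unfolding K_def by (rule dvd_prodI) (auto simp: S_def)
    moreover have "dd S = \<bar>det (masked_gram m N A S)\<bar>" if "0 < N"
      using reduced_denominator(2)[OF x that nN] by (simp add: dd_def S_def)
    ultimately have dvd: "det (masked_gram m N A S) dvd K" if "0 < N" using that by simp
    have Kx: "real_of_int K * x j \<in> \<int>" if j: "j < N" for j
    proof -
      obtain e where "K = det (masked_gram m N A S) * e" using dvd j by (auto elim: dvdE)
      then have "real_of_int K * x j = real_of_int e * (real_of_int (det (masked_gram m N A S)) * x j)" by simp
      also have "\<dots> \<in> \<int>" unfolding S_def by (rule Ints_mult[OF Ints_of_int reduced_denominator(1)[OF x j nN]])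
      finally show ?thesis .
    qed
    have "real_of_int K * obj x = (\<Sum>j<N. real_of_int (c $ j) * (real_of_int K * x j))"
      by (simp add: obj_def lin_form_def sum_distrib_left mult_ac)
    also have "\<dots> \<in> \<int>"
    proof (rule Ints_sum)
      fix j assume "j \<in> {..<N}"
      then show "real_of_int (c $ j) * (real_of_int K * x j) \<in> \<int>"
        by (intro Ints_mult[OF Ints_of_int Kx]) simp
    qed
    finally show ?thesis .
  qed
  define U where "U = \<lceil>real_of_int K * u\<rceil>"
  define P where "P x \<longleftrightarrow> mip_sol m n N A b x \<and> cont_reduced m n N A x" for x
  \<comment> \<open>Maximising the objective becomes minimising a natural number.\<close>
  define f where "f x = nat (U - \<lfloor>real_of_int K * obj x\<rfloor>)" for x
  obtain x' where "P x'" using exists_cont_reduced[OF x bnd] unfolding P_def by metis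
  then obtain z where z: "P z" "\<And>w. P w \<Longrightarrow> f z \<le> f w"
    using ex_has_least_nat[of P x' f] by blast
  have fin: "obj w \<le> obj z" if w: "P w" for w
  proof -
    have "real_of_int K * obj w \<le> real_of_int K * u" if "mip_sol m n N A b w" for w
      using bnd[OF that] K by (simp add: obj_def)
    then have "\<lfloor>real_of_int K * obj w\<rfloor> \<le> U" if "mip_sol m n N A b w" for w
      using that unfolding U_def by (meson floor_le_ceiling floor_mono order.trans)
    then have "\<lfloor>real_of_int K * obj w\<rfloor> \<le> \<lfloor>real_of_int K * obj z\<rfloor>"
      using z(2)[OF w] w z(1) unfolding f_def P_def by fastforce
    moreover have "real_of_int \<lfloor>real_of_int K * obj v\<rfloor> = real_of_int K * obj v" if "P v" for v
      using KI that unfolding P_def by (metis Ints_cases floor_of_int)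
    ultimately have "real_of_int K * obj w \<le> real_of_int K * obj z" using w z(1) by (metis of_int_le_iff)
    then show ?thesis using K by simp
  qed
  show ?thesis
  proof (rule that[of z])
    show "mip_sol m n N A b z" using z by (simp add: P_def)
    fix x assume x: "mip_sol m n N A b x"
    obtain w where w: "mip_sol m n N A b w" "obj x \<le> obj w" "cont_reduced m n N A w"
      using exists_cont_reduced[OF x bnd] unfolding obj_def by metis
    then have "obj w \<le> obj z" using fin by (simp add: P_def)
    with w show "int_form N (($) c) x \<le> int_form N (($) c) z"
      unfolding obj_def by linarith
  qed
qed

text \<open>More than \<open>m\<close> columns, padded by zero rows to a square matrix, give a zero
  last row, hence a kernel vector.\<close>

lemma independent_columns_card_le:
  assumes S: "S \<subseteq> {..<N}" and ind: "\<And>y. kernel_vec m N A y \<Longrightarrow> (\<And>j. y j \<noteq> 0 \<Longrightarrow> j \<in> S) \<Longrightarrow> (\<And>j. y j = 0)"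
  shows "card S \<le> m"
proof (rule ccontr)
  assume "\<not> ?thesis"
  define s where "s = card S"
  have s: "m < s" using \<open>\<not> card S \<le> m\<close> by (simp add: s_def)
  have fS: "finite S" using S finite_subset by blast
  obtain e where e: "bij_betw e {..<s} S" unfolding s_def using bij_betw_from_nat_into_finite[OF fS] by blast
  define B where "B = mat s s (\<lambda>(i, j). if i < m then real_of_int (A $$ (i, e j)) else 0)"
  have B: "B \<in> carrier_mat s s" by (simp add: B_def)
  have "transpose_mat B *\<^sub>v unit_vec s (s - 1) = 0\<^sub>v s"
    using s by (intro eq_vecI) (auto simp: B_def scalar_prod_right_unit)
  moreover have "unit_vec s (s - 1) \<noteq> (0\<^sub>v s :: real vec)"
    using s by (metis diff_less index_unit_vec(2) index_zero_vec(1) less_nat_zero_code less_one linorder_neqE_nat zero_neq_one)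
  ultimately have "det (transpose_mat B) = 0"
    using det_0_iff_vec_prod_zero[of "transpose_mat B" s] B by (metis transpose_carrier_mat unit_vec_carrier)
  then have "det B = 0" using det_transpose[OF B] by simp
  then obtain v where v: "v \<in> carrier_vec s" "v \<noteq> 0\<^sub>v s" "B *\<^sub>v v = 0\<^sub>v s"
    using det_0_iff_vec_prod_zero[OF B] by blast
  define y where "y j = (if j \<in> S then v $ (the_inv_into {..<s} e j) else 0)" for j
  have ye: "y (e i) = v $ i" if "i < s" for i
    using e that unfolding y_def bij_betw_def by (auto simp: the_inv_into_f_f)
  have "kernel_vec m N A y"
    unfolding kernel_vec_def
  proof (intro allI impI)
    fix q assume q: "q < m"
    have "int_form N (\<lambda>j. A $$ (q, j)) y = (\<Sum>j\<in>S. real_of_int (A $$ (q, j)) * y j)"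
      unfolding lin_form_def using S by (intro sum.mono_neutral_right) (auto simp: y_def)
    also have "\<dots> = (\<Sum>i<s. real_of_int (A $$ (q, e i)) * y (e i))"
      by (rule sum.reindex_bij_betw[OF e, symmetric])
    also have "\<dots> = (B *\<^sub>v v) $ q"
      using q s v(1) by (simp add: B_def scalar_prod_def atLeast0LessThan ye)
    also have "\<dots> = 0" using v(3) q s by simp
    finally show "int_form N (\<lambda>j. A $$ (q, j)) y = 0" .
  qed
  then have "y j = 0" for j by (rule ind) (auto simp: y_def split: if_splits)
  then have "v = 0\<^sub>v s" using v(1) ye by (intro eq_vecI) auto
  with v(2) show False ..
qed

section \<open>Optimal solutions of minimal support\<close>

lemma exists_sparse_mip_optimum:
  fixes c :: "int vec"
  assumes x: "mip_sol m n N A b x" and nN: "n \<le> N"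
    and bnd: "\<And>x. mip_sol m n N A b x \<Longrightarrow> int_form N (($) c) x \<le> u"
  obtains z where "mip_sol m n N A b z"
    "\<And>x. mip_sol m n N A b x \<Longrightarrow> int_form N (($) c) x \<le> int_form N (($) c) z"
    "cont_reduced m n N A z"
    "\<And>y :: nat \<Rightarrow> int. (\<And>j. y j \<in> {-1, 0, 1}) \<Longrightarrow> (\<And>j. j \<notin> {j. j < n \<and> z j \<noteq> 0} \<Longrightarrow> y j = 0) \<Longrightarrow>
       (\<And>q. q < m \<Longrightarrow> (\<Sum>j\<in>{j. j < n \<and> z j \<noteq> 0}. y j * A $$ (q, j)) = 0) \<Longrightarrow> y = (\<lambda>_. 0)"
proof -
  define obj where "obj x = int_form N (($) c) x" for x
  define P where "P z \<longleftrightarrow> mip_sol m n N A b z \<and> (\<forall>x. mip_sol m n N A b x \<longrightarrow> obj x \<le> obj z)" for z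
  obtain z0 where "P z0" using exists_mip_optimum[OF x nN bnd] unfolding P_def obj_def by metis
  then obtain z where z: "P z" "\<And>w. P w \<Longrightarrow> card (fun_supp N z) \<le> card (fun_supp N w)"
    using ex_has_least_nat[of P z0 "\<lambda>w. card (fun_supp N w)"] by blast
  have sol: "mip_sol m n N A b z" and opt: "\<And>x. mip_sol m n N A b x \<Longrightarrow> obj x \<le> obj z"
    using z(1) by (auto simp: P_def)
  have minimal: False if "mip_sol m n N A b w" "obj z \<le> obj w" "fun_supp N w \<subset> fun_supp N z" for w
  proof -
    have "P w" using that opt unfolding P_def by (meson order.trans)
    from z(2)[OF this] psubset_card_mono[OF finite_fun_supp that(3)] show False by simp
  qed
  have red: "cont_reduced m n N A z"
    unfolding cont_reduced_def
  proof (intro allI impI, rule ccontr)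
    fix y j
    assume y: "kernel_vec m N A y" "\<forall>j. y j \<noteq> 0 \<longrightarrow> n \<le> j \<and> j < N \<and> z j \<noteq> 0" "y j \<noteq> 0"
    obtain w where "mip_sol m n N A b w" "obj z \<le> obj w" "fun_supp N w \<subset> fun_supp N z"
      using continuous_support_step[OF sol y(1) bnd] y(2,3) unfolding obj_def by metis
    then show False by (rule minimal)
  qed
  define S where "S = {j. j < n \<and> z j \<noteq> 0}"
  \<comment> \<open>A negative entry is assumed to have a coordinate that decreases; the general
    case follows by changing the sign of \<open>y\<close>.\<close>
  have no_neg: False
    if y: "\<And>j. y j \<in> {-1, 0, 1}" "\<And>j. j \<notin> S \<Longrightarrow> y j = 0"
      "\<And>q. q < m \<Longrightarrow> (\<Sum>j\<in>S. y j * A $$ (q, j)) = 0" and neg: "\<exists>j. y j < 0" for y :: "nat \<Rightarrow> int"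
  proof -
    define r where "r j = real_of_int (y j)" for j
    have ker: "kernel_vec m N A r"
      unfolding kernel_vec_def
    proof (intro allI impI)
      fix q assume q: "q < m"
      have "int_form N (\<lambda>j. A $$ (q, j)) r = (\<Sum>j\<in>S. real_of_int (A $$ (q, j)) * r j)"
        unfolding lin_form_def using nN y(2) by (intro sum.mono_neutral_right) (auto simp: S_def r_def)
      also have "\<dots> = real_of_int (\<Sum>j\<in>S. y j * A $$ (q, j))" by (simp add: r_def mult.commute)
      finally show "int_form N (\<lambda>j. A $$ (q, j)) r = 0" using y(3)[OF q] by simp
    qed
    have z0: "0 \<le> z j" if "j < N" for j using sol that by (simp add: mip_sol_def)
    have zI: "z j \<in> \<int>" if "j < n" for j using sol that by (simp add: mip_sol_def)
    \<comment> \<open>Nonzero integer variables are at least 1, which leaves room for a unit step in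
      both directions.\<close>
    have z1: "1 \<le> z j" if "y j \<noteq> 0" for j
    proof -
      have j: "j < n" "z j \<noteq> 0" using y(2)[of j] that by (auto simp: S_def)
      obtain k where k: "z j = of_int k" using zI[OF j(1)] by (auto elim: Ints_cases)
      have "0 < k" using z0[of j] j nN k by auto
      then show ?thesis unfolding k by simp
    qed
    have bound: "r j \<in> {-1, 0, 1}" for j using y(1)[of j] by (auto simp: r_def)
    have shift: "mip_sol m n N A b (\<lambda>j. z j + e * r j)" if e: "e = 1 \<or> e = -1" for e
    proof (rule mip_sol_add[OF sol ker])
      show "0 \<le> z j + e * r j" if "j < N" for j
        using bound[of j] z0[OF that] z1[of j] e by (cases "y j = 0") (auto simp: r_def)
      show "z i + e * r i \<in> \<int>" if "i < n" for i
        using zI[OF that] e by (auto simp: r_def)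
    qed
    have "obj z + 1 * obj r \<le> obj z" "obj z + (-1) * obj r \<le> obj z"
      using opt[OF shift[of 1]] opt[OF shift[of "-1"]] unfolding obj_def lin_form_add_scaled by simp_all
    then have r0: "obj r = 0" by simp
    have ex: "\<exists>j<N. r j < 0"
    proof -
      obtain i where i: "y i < 0" using neg by blast
      then have "i \<in> S" using y(2)[of i] by (cases "i \<in> S") auto
      then show ?thesis using i nN by (intro exI[of _ i]) (auto simp: S_def r_def)
    qed
    have zr: "z j \<noteq> 0" if "j < N" "r j \<noteq> 0" for j using z1[of j] that by (auto simp: r_def)
    obtain t j where t: "0 < t" "j < N" "r j < 0" "t = z j / - r j" "\<And>j. j < N \<Longrightarrow> 0 \<le> z j + t * r j"
      "fun_supp N (\<lambda>j. z j + t * r j) \<subset> fun_supp N z"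
      using ratio_step[of N z r, OF z0 zr ex] by blast
    \<comment> \<open>The entry of \<open>y\<close> at the blocking index is -1, so the step length
      equals the integer \<open>z j\<close> and integrality is preserved.\<close>
    have "r j = -1" using bound[of j] t(3) by auto
    then have "t = z j" using t(4) by simp
    moreover have "j \<in> S" using y(2)[of j] t(3) by (cases "j \<in> S") (auto simp: r_def)
    then have "j < n" by (simp add: S_def)
    ultimately have tI: "t \<in> \<int>" using zI by simp
    show False
    proof (rule minimal)
      show "mip_sol m n N A b (\<lambda>j. z j + t * r j)"
        using zI tI by (intro mip_sol_add[OF sol ker t(5)]) (auto simp: r_def)
      show "obj z \<le> obj (\<lambda>j. z j + t * r j)"
        using r0 unfolding obj_def lin_form_add_scaled by simp
    qed (rule t(6))
  qed
  show ?thesis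
  proof (rule that[OF sol _ red])
    show "int_form N (($) c) x \<le> int_form N (($) c) z"
      if "mip_sol m n N A b x" for x using opt[OF that] by (simp add: obj_def)
    fix y :: "nat \<Rightarrow> int"
    assume y: "\<And>j. y j \<in> {-1, 0, 1}" "\<And>j. j \<notin> {j. j < n \<and> z j \<noteq> 0} \<Longrightarrow> y j = 0"
      "\<And>q. q < m \<Longrightarrow> (\<Sum>j\<in>{j. j < n \<and> z j \<noteq> 0}. y j * A $$ (q, j)) = 0"
    show "y = (\<lambda>_. 0)"
    proof (rule ccontr)
      assume "y \<noteq> (\<lambda>_. 0)"
      then obtain j where j: "y j \<noteq> 0" by auto
      show False
      proof (cases "y j < 0")
        case True
        then show False using no_neg[of y] y unfolding S_def by blast
      next
        case False
        then have "- y j < 0" using j by simp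
        moreover have "- y i \<in> {-1, 0, 1}" for i using y(1)[of i] by auto
        moreover have "- y i = 0" if "i \<notin> S" for i using y(2)[of i] that by (simp add: S_def)
        moreover have "(\<Sum>j\<in>S. - y j * A $$ (q, j)) = 0" if "q < m" for q
          using y(3)[OF that] by (simp add: S_def sum_negf)
        ultimately show False using no_neg[of "\<lambda>j. - y j"] by blast
      qed
    qed
  qed
qed

section \<open>Translation to vectors and the two final estimates\<close>

lemma mip_feasible_iff:
  assumes "A \<in> carrier_mat m (n + d)" "b \<in> carrier_vec m"
  shows "vec (n + d) x \<in> mip_feasible n d A b \<longleftrightarrow> mip_sol m n (n + d) A b x"
proof -
  have "(map_mat real_of_int A *\<^sub>v vec (n + d) x = map_vec real_of_int b)
    \<longleftrightarrow> (\<forall>q<m. (map_mat real_of_int A *\<^sub>v vec (n + d) x) $ q = real_of_int (b $ q))"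
    using assms by (auto simp: vec_eq_iff)
  also have "\<dots> \<longleftrightarrow> (\<forall>q<m. lin_form {..<n + d} (\<lambda>j. real_of_int (A $$ (q, j))) x = real_of_int (b $ q))"
    using assms by (simp add: lin_form_def scalar_prod_def atLeast0LessThan)
  finally show ?thesis unfolding mip_feasible_def mip_sol_def by (auto simp: less_eq_vec_def)
qed

lemma mip_objective_vec:
  "c \<in> carrier_vec N \<Longrightarrow> mip_objective c (vec N x) = int_form N (($) c) x"
  by (simp add: mip_objective_def lin_form_def scalar_prod_def atLeast0LessThan)

lemma abs_le_max_abs_entry:
  assumes "A \<in> carrier_mat m n" "i < m" "j < n"
  shows "\<bar>A $$ (i, j)\<bar> \<le> max_abs_entry A"
  unfolding max_abs_entry_def
proof (rule Max_ge)
  show "finite (insert 0 (abs ` elements_mat A))" by (simp add: elements_mat_def)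
  have "A $$ (i, j) \<in> elements_mat A" using assms by (intro elements_matI) auto
  then show "\<bar>A $$ (i, j)\<bar> \<in> insert 0 (abs ` elements_mat A)" by blast
qed

text \<open>The line \<open>x - 1\<close> is the chord of the concave function \<open>log 2\<close>
  through the arguments 1 and 2, so it lies above the graph beyond 2.\<close>

lemma log2_le_minus_one: "2 \<le> x \<Longrightarrow> log 2 x \<le> x - 1" for x :: real
proof -
  assume x: "2 \<le> x"
  have "ln (x / 2) \<le> x / 2 - 1" using x by (intro ln_le_minus_one) simp
  also have "\<dots> \<le> (x - 2) * ln 2" using x ln2_ge_two_thirds mult_left_mono[of "1/2" "ln 2" "x - 2"] by simp
  finally have "ln x \<le> (x - 1) * ln 2" using x by (simp add: ln_div algebra_simps)
  then show ?thesis by (simp add: log_def divide_le_eq)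
qed

text \<open>With \<open>x = s / m\<close> the hypothesis reads
  \<open>x \<le> 2 + (log 2 x) / 2 + L\<close>. Estimating the logarithm by \<open>x - 1\<close>
  gives \<open>x \<le> 3 + 2 * L\<close>, which is the claim because
  \<open>log 2 (2 * sqrt m * D) = 1 + L\<close>. For \<open>x < 2\<close> it is immediate from
  \<open>0 \<le> L\<close>.\<close>

lemma support_bound_from_log_bound:
  fixes m s :: nat and D :: real
  assumes m: "0 < m" and D: "1 \<le> D" and s: "m \<le> s"
    and le: "real s \<le> 2 * real m + real m / 2 * log 2 (real s * D\<^sup>2)"
  shows "real s \<le> real m + 2 * real m * log 2 (2 * sqrt (real m) * D)"
proof -
  define x where "x = real s / real m"
  define L where "L = log 2 (sqrt (real m) * D)"
  have m': "0 < real m" and s': "0 < real s" using m s by auto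
  have "1 \<le> sqrt (real m) * D" using m D mult_mono[of 1 "sqrt (real m)" 1 D] by simp
  then have L: "0 \<le> L" by (simp add: L_def)
  have x0: "0 < x" using m' s' by (simp add: x_def)
  have sx: "real s = x * real m" using m' by (simp add: x_def)
  have "real s * D\<^sup>2 = x * (sqrt (real m) * D)\<^sup>2" unfolding sx by (simp add: power_mult_distrib)
  also have "log 2 \<dots> = log 2 x + 2 * L"
    using x0 m' D unfolding L_def by (subst log_mult_pos) (auto simp: log_nat_power)
  finally have "x * real m \<le> (2 + 1 / 2 * log 2 x + L) * real m"
    using le unfolding sx by (simp add: algebra_simps)
  then have 1: "x \<le> 2 + 1 / 2 * log 2 x + L" using m' by simp
  have "x \<le> 3 + 2 * L"
  proof (cases "2 \<le> x")
    case True
    then show ?thesis using 1 log2_le_minus_one[OF True] by linarith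
  next
    case False
    then show ?thesis using L by linarith
  qed
  then have "real s \<le> (3 + 2 * L) * real m" unfolding sx using m' by simp
  moreover have "log 2 (2 * sqrt (real m) * D) = 1 + L"
    using m' D unfolding L_def by (simp add: mult.assoc log_mult_pos)
  ultimately show ?thesis by (simp add: algebra_simps)
qed

text \<open>The bound on the objective makes a maximum attainable. Both estimates hold for the same
  \<open>z\<close> and are derived side by side from the same sparse optimum.\<close>

theorem corollary4:
  fixes m n d :: nat and A :: "int mat" and b c :: "int vec"
  assumes "A \<in> carrier_mat m (n + d)"
    and "b \<in> carrier_vec m"
    and "c \<in> carrier_vec (n + d)"
    and "vec_space.rank m (map_mat real_of_int A) = m"
    and "mip_feasible n d A b \<noteq> {}"
    and "bdd_above (mip_objective c ` mip_feasible n d A b)"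
  shows "\<exists>z. mip_optimal n d A b c z \<and>
      real (card (supp_vec z)) \<le>
        2 * real m + log 2 (sqrt (real_of_int (det (A * transpose_mat A))) / real_of_int (gcd_max_minors A)) \<and>
      real (card (supp_vec z)) \<le>
        real m + 2 * real m * log 2 (2 * sqrt (real m) * real_of_int (max_abs_entry A))"
proof -
  note A = assms(1) and b = assms(2) and c = assms(3)
  define N where "N = n + d"
  note feas = mip_feasible_iff[OF A b, folded N_def]
  have vec: "z = vec N (\<lambda>j. z $ j)" if "z \<in> mip_feasible n d A b" for z
    using that by (intro eq_vecI) (auto simp: mip_feasible_def N_def)
  obtain k where k: "\<And>j. j < m \<Longrightarrow> k j < N" "det (select_cols A k) \<noteq> 0"
    using full_rank_select_cols[OF A[folded N_def] assms(4)] by blast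
  obtain x0 where x0: "mip_sol m n N A b x0"
  proof -
    obtain v where "v \<in> mip_feasible n d A b" using assms(5) by blast
    then show ?thesis using that vec feas by metis
  qed
  obtain u where u: "\<And>v. v \<in> mip_feasible n d A b \<Longrightarrow> mip_objective c v \<le> u"
    using assms(6) by (auto simp: bdd_above_def)
  have bnd: "int_form N (($) c) x \<le> u" if "mip_sol m n N A b x" for x
    using u[of "vec N x"] that feas c by (simp add: mip_objective_vec N_def)
  have nN: "n \<le> N" by (simp add: N_def)
  obtain z where z: "mip_sol m n N A b z"
    and opt: "\<And>x. mip_sol m n N A b x \<Longrightarrow> int_form N (($) c) x \<le> int_form N (($) c) z"
    and red: "cont_reduced m n N A z"
    and nosol: "\<And>y :: nat \<Rightarrow> int. (\<And>j. y j \<in> {-1, 0, 1}) \<Longrightarrow> (\<And>j. j \<notin> {j. j < n \<and> z j \<noteq> 0} \<Longrightarrow> y j = 0) \<Longrightarrow>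
       (\<And>q. q < m \<Longrightarrow> (\<Sum>j\<in>{j. j < n \<and> z j \<noteq> 0}. y j * A $$ (q, j)) = 0) \<Longrightarrow> y = (\<lambda>_. 0)"
    using exists_sparse_mip_optimum[OF x0 nN bnd] by blast
  define S where "S = {j. j < n \<and> z j \<noteq> 0}"
  define C where "C = {j. n \<le> j \<and> j < N \<and> z j \<noteq> 0}"
  have "card C \<le> m"
  proof (rule independent_columns_card_le)
    show "C \<subseteq> {..<N}" by (auto simp: C_def)
    fix y j assume "kernel_vec m N A y" "\<And>j. y j \<noteq> 0 \<Longrightarrow> j \<in> C"
    then show "y j = 0" using red unfolding cont_reduced_def C_def by blast
  qed
  \<comment> \<open>One \<open>m\<close> of the term \<open>2 * m\<close> comes from the continuous
    part \<open>C\<close>, the other from the factor \<open>2 ^ m\<close> in the bound for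
    \<open>S\<close>.\<close>
  moreover have "supp_vec (vec N z) = S \<union> C" by (auto simp: supp_vec_def S_def C_def N_def)
  ultimately have supp: "card (supp_vec (vec N z)) \<le> card S + m"
    using card_Un_le[of S C] by simp
  have SN: "S \<subseteq> {..<N}" using nN by (auto simp: S_def)
  have fS: "finite S" using SN finite_subset by blast
  have "mip_optimal n d A b c (vec N z)"
    unfolding mip_optimal_def
  proof (intro conjI ballI)
    show "vec N z \<in> mip_feasible n d A b" using feas z by blast
    fix v assume v: "v \<in> mip_feasible n d A b"
    then have "mip_sol m n N A b (\<lambda>j. v $ j)" using feas vec by metis
    from opt[OF this] have "mip_objective c (vec N (\<lambda>j. v $ j)) \<le> mip_objective c (vec N z)"
      using c by (simp add: mip_objective_vec N_def)
    then show "mip_objective c v \<le> mip_objective c (vec N z)" using vec[OF v] by simp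
  qed
  moreover have "real (card (supp_vec (vec N z))) \<le>
        2 * real m + log 2 (sqrt (real_of_int (det (A * transpose_mat A))) / real_of_int (gcd_max_minors A))"
  proof -
    define R where "R = sqrt (real_of_int (det (A * transpose_mat A))) / real_of_int (gcd_max_minors A)"
    have le: "2 ^ card S \<le> 2 ^ m * R"
      unfolding R_def using kernel_free_bound[OF A[folded N_def] k SN] nosol unfolding S_def by blast
    have "(0::real) < 2 ^ card S" by simp
    then have "0 < 2 ^ m * R" using le by (rule less_le_trans)
    then have R: "0 < R" by (simp add: zero_less_mult_iff)
    have "real (card S) = log 2 (2 ^ card S)" by simp
    also have "\<dots> \<le> log 2 (2 ^ m * R)" using le R by (subst log_le_cancel_iff) auto
    also have "\<dots> = real m + log 2 R" using R by (simp add: log_mult_pos)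
    finally show ?thesis using supp unfolding R_def by linarith
  qed
  moreover have "real (card (supp_vec (vec N z))) \<le>
        real m + 2 * real m * log 2 (2 * sqrt (real m) * real_of_int (max_abs_entry A))"
  proof -
    \<comment> \<open>The added \<open>m\<close> columns guarantee a nonsingular Gram matrix at the
      price of at most \<open>m\<close> further elements.\<close>
    define X where "X = S \<union> k ` {..<m}"
    define D where "D = real_of_int (max_abs_entry A)"
    define G where "G = mat m m (\<lambda>(p, q). \<Sum>j\<in>X. real_of_int (A $$ (p, j)) * real_of_int (A $$ (q, j)))"
    have X: "X \<subseteq> {..<N}" "finite X" "S \<subseteq> X" "\<And>j. j < m \<Longrightarrow> k j \<in> X"
      using SN k(1) fS by (auto simp: X_def)
    have cX: "card X \<le> card S + m"
      using card_Un_le[of S "k ` {..<m}"] card_image_le[of "{..<m}" k] by (simp add: X_def)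
    have kf: "2 ^ card S \<le> 2 ^ m * sqrt (det G)" "det G \<le> (\<Prod>p<m. \<Sum>j\<in>X. (real_of_int (A $$ (p, j)))\<^sup>2)" "0 < det G"
      using kernel_free_bound_subset[OF A[folded N_def] X(4) k(2) X(1,3)] nosol unfolding S_def G_def by blast+
    show ?thesis
    proof (cases "m = 0")
      case True
      then have "(2::real) ^ card S \<le> sqrt (det G)" "det G \<le> 1" using kf by auto
      then have le1: "(2::real) ^ card S \<le> 1" by (meson order.trans real_sqrt_le_1_iff)
      have "card S = 0"
      proof (rule ccontr)
        assume "card S \<noteq> 0"
        then have "1 < (2::real) ^ card S" by (intro one_less_power) auto
        with le1 show False by linarith
      qed
      then show ?thesis using supp True by simp
    next
      case False
      then have m: "0 < m" by simp
      have DA: "\<bar>real_of_int (A $$ (p, j))\<bar> \<le> D" if "p < m" "j < N" for p j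
        unfolding D_def using abs_le_max_abs_entry[OF A[folded N_def] that] by linarith
      \<comment> \<open>If all entries were zero, the first unit vector would be a zero of every
        form of the invertible column selection.\<close>
      have D1: "1 \<le> D"
      proof (rule ccontr)
        assume "\<not> ?thesis"
        then have "max_abs_entry A \<le> 0" by (simp add: D_def)
        then have "A $$ (0, k j) = 0" if "j < m" for j
          using abs_le_max_abs_entry[OF A[folded N_def] m k(1)[OF that]] by simp
        then have "lin_form {..<m} (\<lambda>q. real_of_int (A $$ (q, j))) (\<lambda>q. if q = 0 then 1 else 0) = 0" if "j \<in> k ` {..<m}" for j
          using that unfolding lin_form_def by (intro sum.neutral) auto
        moreover have "\<exists>q<m. (if q = (0::nat) then 1 else 0) \<noteq> (0::real)" using m by auto
        ultimately show False
          using select_cols_full[OF A _ k(2), of "k ` {..<m}" "\<lambda>q. if q = 0 then 1 else 0"] by blast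
      qed
      \<comment> \<open>The same number bounds the support and the size of \<open>X\<close>, which
        makes the resulting inequality one in \<open>s\<close> alone.\<close>
      define s where "s = card S + m"
      have s: "0 < real s" using m by (simp add: s_def)
      have "det G \<le> (\<Prod>p<m. real s * D\<^sup>2)"
      proof (rule order.trans[OF kf(2)], rule prod_mono, intro conjI)
        fix p assume "p \<in> {..<m}"
        then have p: "p < m" by simp
        show "0 \<le> (\<Sum>j\<in>X. (real_of_int (A $$ (p, j)))\<^sup>2)" by (intro sum_nonneg) auto
        have "(\<Sum>j\<in>X. (real_of_int (A $$ (p, j)))\<^sup>2) \<le> (\<Sum>j\<in>X. D\<^sup>2)"
          using DA[OF p] X(1) D1 by (intro sum_mono) (auto simp: abs_le_square_iff[symmetric] subset_iff)
        also have "\<dots> \<le> real s * D\<^sup>2" using cX by (simp add: s_def mult_right_mono)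
        finally show "(\<Sum>j\<in>X. (real_of_int (A $$ (p, j)))\<^sup>2) \<le> real s * D\<^sup>2" .
      qed
      then have dG: "det G \<le> (real s * D\<^sup>2) ^ m" by simp
      have "2 ^ card S \<le> 2 ^ m * sqrt ((real s * D\<^sup>2) ^ m)"
      proof (rule order.trans[OF kf(1)])
        show "2 ^ m * sqrt (det G) \<le> 2 ^ m * sqrt ((real s * D\<^sup>2) ^ m)"
          using dG by (intro mult_left_mono) auto
      qed
      then have "log 2 (2 ^ card S) \<le> log 2 (2 ^ m * sqrt ((real s * D\<^sup>2) ^ m))"
        using s D1 by (subst log_le_cancel_iff) auto
      also have "\<dots> = real m + log 2 (sqrt ((real s * D\<^sup>2) ^ m))"
        using s D1 by (simp add: log_mult_pos)
      also have "log 2 (sqrt ((real s * D\<^sup>2) ^ m)) = real m / 2 * log 2 (real s * D\<^sup>2)"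
      proof -
        define T where "T = real s * D\<^sup>2"
        have T: "0 < T" using s D1 by (simp add: T_def)
        have "2 * log 2 (sqrt (T ^ m)) = log 2 ((sqrt (T ^ m)) ^ 2)"
          using T by (subst log_nat_power) auto
        also have "\<dots> = real m * log 2 T" using T by (simp add: log_nat_power)
        finally show ?thesis unfolding T_def[symmetric] by simp
      qed
      finally have "real s \<le> 2 * real m + real m / 2 * log 2 (real s * D\<^sup>2)" by (simp add: s_def)
      then have "real s \<le> real m + 2 * real m * log 2 (2 * sqrt (real m) * D)"
        by (intro support_bound_from_log_bound m D1) (simp_all add: s_def)
      then show ?thesis using supp unfolding s_def D_def by linarith
    qed
  qed
  ultimately show ?thesis by blast
qed

end
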